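(* Let $\mathcal{A}\subseteq\mathbb{N}$ be a finite alphabet with $|\mathcal{A}|\ge 2$, and let $\delta_{\mathcal{A}}$ denote the Hausdorff dimension of the set $\mathcal{E}_{\mathcal{A}}$ of infinite continued fractions $[d_1,d_2,\ldots]$ all of whose partial quotients $d_j$ belong to $\mathcal{A}$. For $N\ge1$ let $$\mathcal{D}_{\mathcal{A}}(N)=\Bigl\{d\in\mathbb{N}\;\Bigl|\; d\le N,\ \exists\, b\in\mathbb{N}:\ \gcd(b,d)=1,\ \tfrac{b}{d}=[d_1,\ldots,d_k]\text{ for some }k\ge1\text{ and some } d_1,\ldots,d_k\in\mathcal{A}\Bigr\}.$$ If $\delta_{\mathcal{A}}>\frac{7}{8}$, then there is a constant $c=c(\mathcal{A})>0$ such that $\#\mathcal{D}_{\mathcal{A}}(N)\ge cN$ for all sufficiently large $N$ (i.e. $\#\mathcal{D}_{\mathcal{A}}(N)\gg N$).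
   Context: Finite continued fractions are written $[d_1,d_2,\ldots,d_k]=\cfrac{1}{d_1+\cfrac{1}{d_2+\cdots+\cfrac{1}{d_k}}}$ with positive integer partial quotients $d_j$; infinite continued fractions $[d_1,d_2,\ldots]$ are defined analogously as limits. The notation $f\gg g$ means $f\ge Cg$ for a positive constant $C$ depending only on the alphabet $\mathcal{A}$. *)

theory Defs
  imports "HOL-Analysis.Analysis"
begin

text \<open>
  The \<open>s\<close>-th power of the diameter, with the usual conventions for \<open>s = 0\<close>: nonempty sets
  count 1 (whereas \<open>0 powr 0 = 0\<close>) and the empty set counts 0.
\<close>

definition diam_power :: "real \<Rightarrow> 'a::metric_space set \<Rightarrow> ennreal" where
  "diam_power s U =
     (if U = {} then 0 else if s = 0 then 1 else ennreal (diameter U powr s))"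

text \<open>
  Boundedness is required explicitly because \<^const>\<open>diameter\<close> is real-valued and carries no
  information on unbounded sets.
\<close>

definition fine_covers :: "real \<Rightarrow> 'a::metric_space set \<Rightarrow> (nat \<Rightarrow> 'a set) set" where
  "fine_covers \<epsilon> E =
     {U. E \<subseteq> (\<Union>i. U i) \<and> (\<forall>i. bounded (U i) \<and> diameter (U i) \<le> \<epsilon>)}"

definition hausdorff_measure :: "real \<Rightarrow> 'a::metric_space set \<Rightarrow> ennreal" where
  "hausdorff_measure s E =
     (SUP \<epsilon>\<in>{0<..}. INF U\<in>fine_covers \<epsilon> E. \<Sum>i. diam_power s (U i))"

definition hausdorff_dim :: "'a::metric_space set \<Rightarrow> ereal" where
  "hausdorff_dim E = (INF s\<in>{s. 0 \<le> s \<and> hausdorff_measure s E = 0}. ereal s)"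

text \<open>The value 0 at the empty list only serves to end the recursion: \<open>[d] = 1 / d\<close>.\<close>

fun cfrac :: "nat list \<Rightarrow> real" where
  "cfrac [] = 0"
| "cfrac (d # ds) = 1 / (real d + cfrac ds)"

definition cfrac_set :: "nat set \<Rightarrow> real set" where
  "cfrac_set A =
     {x. \<exists>d :: nat \<Rightarrow> nat. (\<forall>j. d j \<in> A) \<and> (\<lambda>k. cfrac (map d [0..<k])) \<longlonglongrightarrow> x}"

definition cfrac_denoms :: "nat set \<Rightarrow> real \<Rightarrow> nat set" where
  "cfrac_denoms A N =
     {d. 0 < d \<and> real d \<le> N \<and>
         (\<exists>b::nat. 0 < b \<and> coprime b d \<and>
            (\<exists>ds. ds \<noteq> [] \<and> set ds \<subseteq> A \<and> real b / real d = cfrac ds))}"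

end

theory Submission
  imports Defs "HOL-Real_Asymp.Real_Asymp"
begin

text \<open>
  Let \<open>K(w)\<close> be the continuant of a word \<open>w\<close> over \<open>A\<close> and \<open>g(X)\<close> the number of words with
  \<open>K(w) \<le> X\<close>. By Cauchy--Schwarz it suffices that the number of pairs of words with equal
  continuant at most \<open>N\<close> is \<open>O(g(N)\<^sup>2 / N)\<close>, which is a mean square of the exponential sum
  \<open>S(\<theta>) = \<Sum> z^K(w)\<close>, \<open>z = exp (2 \<pi> i \<theta> - 1/N)\<close>, over the fractions \<open>\<theta> = j/N\<close>.

  The words with \<open>K(w) \<ge> M\<close> are exactly the concatenations \<open>x y\<close> of a word \<open>x\<close> of the stopping set at
  level \<open>M\<close> with an arbitrary word \<open>y\<close>, and \<open>K(x y)\<close> is the inner product of the integer vectors of \<open>x\<close>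
  and \<open>y\<close>. The damping factor \<open>exp (-K(x y)/N)\<close> is absorbed into \<open>z\<close>, so \<open>S\<close> is a genuine bilinear form for
  every choice of \<open>M\<close>. Completing the sum over \<open>x\<close> to all integer vectors loses a factor \<open>M^(2 - 2 s)\<close>, where
  \<open>s > 7/8\<close> is below the Hausdorff dimension, and reduces matters to counting the coincidences
  \<open>\<theta> y \<equiv> \<theta>' y'\<close> modulo 1 up to \<open>1/M\<close>.

  For \<open>\<theta>\<close> within about \<open>K/N\<close> of \<open>a/q\<close> with \<open>q K\<close> at most about \<open>N^(1/4)\<close>, choosing \<open>M\<close> slightly larger than \<open>q\<^sup>2 K\<close>
  makes these coincidences exact: \<open>q\<close> divides the determinant of \<open>y\<close> and \<open>y'\<close>, and the two directions agree up to
  \<open>1/K\<close>. A prefix of \<open>y'\<close> of size \<open>K^(1/2)\<close> controls the direction and a suffix of size \<open>q\<close> the residue class.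
  For all other \<open>\<theta>\<close> one takes \<open>M = N^(5/8)\<close> and counts the determinants \<open>D\<close> with \<open>\<theta> D\<close> close to an integer;
  this is where \<open>s > 7/8\<close> is needed.
\<close>

subsection \<open>Continuants\<close>

text \<open>The growth information on g consists of g(X) Y^(2s) << g(XY), from concatenation with
  stopping words, and a crude polynomial upper bound; hence every error is measured against g(N)
  itself. The obstacle is to beat M^(2-2s) for every \<theta>. Suppose Dirichlet denominators up to
  N^(1-\<tau>) are split at N^\<tau>, and let L = N/M. Above the split about (L^2/q + 1)(Lq/M + 1)
  determinants occur instead of g(L) >> L^(2s) words. Loss times saving is N^(2 - \<tau> - 2s),
  provided M is at least N^((1+\<tau>)/2), the point from which L^3/M no longer dominates. With
  \<tau> = 1/4 this gives both 7/8 and 5/8. Below the split M must be tied to Q^2 K and not to N: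
  the loss is then a power of Q K, is beaten by a power of Q K, and the bounds for dyadic Q and K
  can be summed. A parameter H, a tiny power of Q K or of N, truncates all tails. Kernels of high
  order k make the truncation error as small as desired, while losses polynomial in H are absorbed
  by the power saving.\<close>

fun cont cont_tl :: "nat list \<Rightarrow> nat" where
  "cont [] = 1"
| "cont (d # w) = d * cont w + cont_tl w"
| "cont_tl [] = 0"
| "cont_tl (d # w) = cont w"

text \<open>The second column of the matrix product whose first column is
  \<open>(cont w, cont_tl w)\<close>; thus \<open>cont_bl w\<close> is the continuant of \<open>butlast w\<close>.\<close>

fun cont_bl cont_mid :: "nat list \<Rightarrow> nat" where
  "cont_bl [] = 0"
| "cont_bl (d # w) = d * cont_bl w + cont_mid w"
| "cont_mid [] = 1"
| "cont_mid (d # w) = cont_bl w"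

text \<open>A word has the matrix with rows (\<open>cont\<close>, \<open>cont_bl\<close>) and
  (\<open>cont_tl\<close>, \<open>cont_mid\<close>), the product of the matrices with rows (d, 1)
  and (1, 0) of its letters. This is the first column of a product of two such matrices; its first
  entry is the inner product behind the bilinear form.\<close>

lemma cont_append:
  "cont (x @ y) = cont x * cont y + cont_bl x * cont_tl y"
  "cont_tl (x @ y) = cont_tl x * cont y + cont_mid x * cont_tl y"
proof -
  have "cont (x @ y) = cont x * cont y + cont_bl x * cont_tl y \<and>
        cont_tl (x @ y) = cont_tl x * cont y + cont_mid x * cont_tl y"
    by (induction x) (auto simp: algebra_simps)
  then show "cont (x @ y) = cont x * cont y + cont_bl x * cont_tl y"
    "cont_tl (x @ y) = cont_tl x * cont y + cont_mid x * cont_tl y" by auto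
qed

lemma cont_bl_snoc: "cont_bl (w @ [d]) = cont w" "cont_mid (w @ [d]) = cont_tl w"
proof -
  have "cont_bl (w @ [d]) = cont w \<and> cont_mid (w @ [d]) = cont_tl w"
    by (induction w) auto
  then show "cont_bl (w @ [d]) = cont w" "cont_mid (w @ [d]) = cont_tl w" by auto
qed

lemma cont_snoc: "cont (w @ [d]) = d * cont w + cont_bl w"
  by (simp add: cont_append)

text \<open>The letter matrices are symmetric, so reversing a word transposes its matrix. This turns
  prefixes into suffixes and first rows into first columns.\<close>

lemma cont_rev:
  "cont (rev w) = cont w" "cont_tl (rev w) = cont_bl w"
proof -
  have "cont (rev w) = cont w \<and> cont_tl (rev w) = cont_bl w \<and>
        cont_bl (rev w) = cont_tl w \<and> cont_mid (rev w) = cont_mid w"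
    by (induction w) (auto simp: cont_append cont_bl_snoc algebra_simps)
  then show "cont (rev w) = cont w" "cont_tl (rev w) = cont_bl w" by auto
qed

text \<open>Each letter matrix has determinant -1.\<close>

lemma cont_det:
  "int (cont w) * int (cont_mid w) - int (cont_bl w) * int (cont_tl w) = (-1) ^ length w"
proof (induction w)
  case (Cons d w)
  have "int (cont (d # w)) * int (cont_mid (d # w)) - int (cont_bl (d # w)) * int (cont_tl (d # w))
      = - (int (cont w) * int (cont_mid w) - int (cont_bl w) * int (cont_tl w))"
    by (simp add: algebra_simps)
  then show ?case using Cons by simp
qed simp

lemma coprime_cont: "coprime (cont w) (cont_tl w)"
proof -
  have "coprime (int (cont w)) (int (cont_tl w))"
  proof (rule coprimeI)
    fix c assume "c dvd int (cont w)" "c dvd int (cont_tl w)"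
    then have "c dvd (-1) ^ length w"
      unfolding cont_det[of w, symmetric] by (intro dvd_diff dvd_mult dvd_mult2)
    then show "is_unit c"
      by (metis dvd_trans is_unit_power_iff dvd_minus_iff minus_dvd_iff one_dvd dvd_refl)
  qed
  then show ?thesis by simp
qed

lemma cont_pos: "0 \<notin> set w \<Longrightarrow> 0 < cont w"
  by (induction w) auto

lemma cont_tl_le: "0 \<notin> set w \<Longrightarrow> cont_tl w \<le> cont w"
proof (cases w)
  case (Cons d x)
  assume "0 \<notin> set w"
  then have "1 * cont x \<le> d * cont x" using Cons by (intro mult_right_mono) auto
  then have "cont x \<le> d * cont x + cont_tl x" by linarith
  then show ?thesis using Cons by simp
qed simp

lemma cont_bl_le: "0 \<notin> set w \<Longrightarrow> cont_bl w \<le> cont w"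
  using cont_tl_le[of "rev w"] by (simp add: cont_rev)

lemma length_le_cont: "0 \<notin> set w \<Longrightarrow> length w \<le> cont w"
proof (induction w)
  case (Cons d w)
  show ?case
  proof (cases w)
    case (Cons e x)
    have "0 < cont_tl w" using cont_pos[of x] Cons.prems Cons by auto
    moreover have "1 * cont w \<le> d * cont w" using Cons.prems by (intro mult_right_mono) auto
    moreover have "length w \<le> cont w" using Cons.IH Cons.prems by simp
    ultimately have "Suc (length w) \<le> d * cont w + cont_tl w" by linarith
    then show ?thesis by simp
  qed (use Cons.prems in auto)
qed simp

lemma cfrac_eq_cont: "0 \<notin> set w \<Longrightarrow> cfrac w = real (cont_tl w) / real (cont w)"
proof (induction w)
  case (Cons d w)
  then have "0 < cont w" "cfrac w = real (cont_tl w) / real (cont w)"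
    using cont_pos[of w] by auto
  moreover have "real d + real (cont_tl w) / real (cont w) = real (cont (d # w)) / real (cont w)"
    using \<open>0 < cont w\<close> by (simp add: field_simps)
  ultimately show ?case by simp
qed simp

lemma cont_append_bounds:
  assumes "0 \<notin> set x" "0 \<notin> set y"
  shows "cont x * cont y \<le> cont (x @ y)" "cont (x @ y) \<le> 2 * (cont x * cont y)"
proof -
  have "cont_bl x * cont_tl y \<le> cont x * cont y"
    using assms by (intro mult_mono cont_bl_le cont_tl_le) auto
  then show "cont x * cont y \<le> cont (x @ y)" "cont (x @ y) \<le> 2 * (cont x * cont y)"
    by (auto simp: cont_append)
qed

lemma cont_append_ge:
  assumes "0 \<notin> set x" "0 \<notin> set y"
  shows "cont x \<le> cont (x @ y)" "cont y \<le> cont (x @ y)"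
proof -
  have "1 \<le> cont x" "1 \<le> cont y" using cont_pos assms by (auto simp: Suc_le_eq)
  then have "cont x * 1 \<le> cont x * cont y" "1 * cont y \<le> cont x * cont y"
    by (intro mult_mono; simp)+
  then show "cont x \<le> cont (x @ y)" "cont y \<le> cont (x @ y)"
    using cont_append_bounds(1)[OF assms] by linarith+
qed

lemma cont_tl_eq_0_iff: "0 \<notin> set w \<Longrightarrow> cont_tl w = 0 \<longleftrightarrow> w = []"
  using cont_pos by (cases w) auto

text \<open>The only ambiguity of finite continued fractions is \<open>[\<dots>, d + 1] = [\<dots>, d, 1]\<close>, which changes
  the parity of the length.\<close>

lemma cont_inj:
  assumes "0 \<notin> set x" "0 \<notin> set y" "cont x = cont y" "cont_tl x = cont_tl y"
    "even (length x) = even (length y)"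
  shows "x = y"
  using assms
proof (induction x arbitrary: y)
  case Nil
  then have "cont_tl y = 0" by simp
  then show ?case using cont_tl_eq_0_iff[of y] Nil.prems by simp
next
  case (Cons d x)
  have "0 < cont x" using Cons.prems(1) cont_pos[of x] by simp
  then have "cont_tl y \<noteq> 0" using Cons.prems(4) by simp
  then obtain e z where y: "y = e # z" by (cases y) simp_all
  have pos: "0 \<notin> set x" "0 \<notin> set z" using Cons.prems y by auto
  have K: "cont x = cont z" using Cons.prems y by auto
  have le: "cont_tl x \<le> cont x" "cont_tl z \<le> cont z" using cont_tl_le pos by auto
  have eq: "d * cont x + cont_tl x = e * cont x + cont_tl z" using Cons.prems y K by auto
  \<comment> \<open>Different first letters force \<open>e' = d' + 1\<close>, \<open>z' = []\<close>
    and \<open>x' = [1]\<close>, which is the known ambiguity; the lengths then differ by one,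
    against the parity assumption.\<close>
  have amb: False if "d' < e'" "d' * cont x' + cont_tl x' = e' * cont z' + cont_tl z'"
    "0 \<notin> set x'" "0 \<notin> set z'" "cont x' = cont z'"
    "even (length x') = even (length z')" for d' e' x' z'
  proof -
    have "cont x' > 0" using cont_pos that by auto
    have "e' * cont x' \<ge> Suc d' * cont x'" using that by (intro mult_right_mono) auto
    then have "cont_tl x' = cont x'" "cont_tl z' = 0"
      using that cont_tl_le[of x'] by auto
    then have z: "z' = []" using cont_tl_eq_0_iff that by auto
    then have c: "cont x' = 1" "cont_tl x' = 1" using that \<open>cont_tl x' = cont x'\<close> by auto
    then obtain f u where u: "x' = f # u" by (cases x') auto
    then have "cont_tl u = 0" "f = 1" using c that by auto
    then have "u = []" using cont_tl_eq_0_iff that u by auto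
    then show False using u z that by auto
  qed
  have "d = e"
  proof (rule ccontr)
    assume "d \<noteq> e"
    then consider "d < e" | "e < d" by linarith
    then show False
    proof cases
      case 1
      show False by (rule amb[OF 1 _ pos(1) pos(2) K]) (use eq K Cons.prems(5) y in simp_all)
    next
      case 2
      show False by (rule amb[OF 2 _ pos(2) pos(1) K[symmetric]]) (use eq K Cons.prems(5) y in simp_all)
    qed
  qed
  moreover have "x = z"
    by (rule Cons.IH[OF pos K]) (use \<open>d = e\<close> eq Cons.prems(5) y in simp_all)
  ultimately show ?case using y by simp
qed

text \<open>A word is determined by its first column and the parity of its length, hence the factor
  2. Later counts of words pass through counts of primitive integer vectors.\<close>

lemma card_words_le_vectors:
  assumes "finite S" "\<And>w. w \<in> S \<Longrightarrow> 0 \<notin> set w"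
  shows "card S \<le> 2 * card ((\<lambda>w. (cont w, cont_tl w)) ` S)"
proof -
  let ?f = "\<lambda>w. ((cont w, cont_tl w), even (length w))"
  have "inj_on ?f S" using cont_inj assms(2) by (intro inj_onI) auto
  then have "card S = card (?f ` S)" by (simp add: card_image)
  also have "\<dots> \<le> card ((\<lambda>w. (cont w, cont_tl w)) ` S \<times> (UNIV :: bool set))"
    using assms by (intro card_mono) auto
  also have "\<dots> = 2 * card ((\<lambda>w. (cont w, cont_tl w)) ` S)"
    by (simp add: card_cartesian_product)
  finally show ?thesis .
qed

lemma cfrac_bounds: "0 \<notin> set w \<Longrightarrow> 0 \<le> cfrac w \<and> cfrac w \<le> 1"
  using cont_pos[of w] cont_tl_le[of w] by (simp add: cfrac_eq_cont)

text \<open>Cross-multiplying the two fractions leaves the determinant of x, which is 1 or -1, times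
  \<open>cont_tl y\<close>; the denominator \<open>cont (x @ y) * cont x\<close> is at least
  \<open>cont_tl y\<close> times the square of \<open>cont x\<close>.\<close>

lemma cfrac_append_near:
  assumes "0 \<notin> set x" "0 \<notin> set y"
  shows "\<bar>cfrac (x @ y) - cfrac x\<bar> \<le> 1 / (real (cont x))\<^sup>2"
proof -
  have K: "0 < cont x" "0 < cont (x @ y)" "0 < cont y" using cont_pos assms by auto
  have le: "cont x * cont_tl y \<le> cont (x @ y)"
    using cont_append_bounds(1)[OF assms] cont_tl_le[OF assms(2)]
    by (meson mult_le_mono2 order_trans)
  have "cont_tl (x @ y) * real (cont x) - cont_tl x * real (cont (x @ y))
      = real_of_int (int (cont x) * int (cont_mid x) - int (cont_bl x) * int (cont_tl x)) * cont_tl y"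
    by (simp add: cont_append algebra_simps)
  also have "\<bar>\<dots>\<bar> = cont_tl y" unfolding cont_det by (simp add: abs_mult power_abs)
  finally have *: "\<bar>cont_tl (x @ y) * real (cont x) - cont_tl x * real (cont (x @ y))\<bar> = cont_tl y" .
  have "cfrac (x @ y) - cfrac x =
      (cont_tl (x @ y) * real (cont x) - cont_tl x * real (cont (x @ y))) / (cont (x @ y) * real (cont x))"
    using K assms by (simp add: cfrac_eq_cont field_simps)
  then have "\<bar>cfrac (x @ y) - cfrac x\<bar> = cont_tl y / (cont (x @ y) * real (cont x))"
    using * by (simp add: abs_mult)
  also have "\<dots> \<le> 1 / (real (cont x))\<^sup>2"
  proof -
    have "real (cont_tl y) * (cont x * real (cont x)) \<le> cont (x @ y) * real (cont x)"
      using mult_right_mono[OF le, of "cont x"]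
      unfolding of_nat_mult[symmetric] of_nat_le_iff by (simp add: ac_simps)
    then show ?thesis using K by (simp add: field_simps power2_eq_square)
  qed
  finally show ?thesis .
qed

subsection \<open>Words over a finite alphabet\<close>

locale alphabet =
  fixes A :: "nat set"
  assumes finite_A: "finite A" and zero_notin_A: "0 \<notin> A" and A_nonempty: "A \<noteq> {}"
begin

definition amax :: real where "amax = real (Max A)"

definition words_upto :: "real \<Rightarrow> nat list set" where
  "words_upto X = {w \<in> lists A. real (cont w) \<le> X}"

definition word_count :: "real \<Rightarrow> real" where
  "word_count X = real (card (words_upto X))"

text \<open>The words whose continuant reaches M exactly at the last letter. The separate case
  \<open>w = []\<close> settles \<open>M \<le> 1\<close>, where the empty word is the only
  member.\<close>

definition stop_words :: "real \<Rightarrow> nat list set" where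
  "stop_words M = {w \<in> lists A. M \<le> real (cont w) \<and> (w = [] \<or> real (cont (butlast w)) < M)}"

lemma pos_word: "w \<in> lists A \<Longrightarrow> 0 \<notin> set w"
  using zero_notin_A by auto

lemma cont_ge_1: "w \<in> lists A \<Longrightarrow> 1 \<le> cont w"
  using cont_pos[OF pos_word] by (simp add: Suc_le_eq)

lemma le_amax: "d \<in> A \<Longrightarrow> real d \<le> amax"
  using finite_A by (simp add: amax_def)

lemma amax_ge_1: "1 \<le> amax"
proof -
  obtain d where "d \<in> A" using A_nonempty by blast
  then have "1 \<le> d" using zero_notin_A by (cases d) auto
  then show ?thesis using le_amax[OF \<open>d \<in> A\<close>] by linarith
qed

lemma finite_words_upto: "finite (words_upto X)"
proof (rule finite_subset)
  show "words_upto X \<subseteq> {w. set w \<subseteq> A \<and> length w \<le> nat \<lfloor>X\<rfloor>}"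
  proof
    fix w assume w: "w \<in> words_upto X"
    then have "real (length w) \<le> X"
      using length_le_cont[OF pos_word, of w] by (auto simp: words_upto_def)
    then show "w \<in> {w. set w \<subseteq> A \<and> length w \<le> nat \<lfloor>X\<rfloor>}"
      using w by (auto simp: words_upto_def le_nat_floor)
  qed
qed (simp add: finite_A finite_lists_length_le)

lemma word_count_nonneg: "0 \<le> word_count X"
  by (simp add: word_count_def)

lemma word_count_mono: "X \<le> Y \<Longrightarrow> word_count X \<le> word_count Y"
  unfolding word_count_def using finite_words_upto
  by (auto simp: words_upto_def intro!: card_mono)

lemma word_count_ge_1: "1 \<le> X \<Longrightarrow> 1 \<le> word_count X"
proof -
  assume "1 \<le> X"
  then have "[] \<in> words_upto X" by (simp add: words_upto_def)
  then have "card (words_upto X) > 0" using finite_words_upto card_gt_0_iff by blast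
  then show ?thesis by (simp add: word_count_def)
qed

lemma word_count_eq_0: "X < 1 \<Longrightarrow> word_count X = 0"
proof -
  assume "X < 1"
  then have "words_upto X = {}" using cont_ge_1 by (force simp: words_upto_def)
  then show ?thesis by (simp add: word_count_def)
qed

lemma cont_snoc_le:
  assumes "w \<in> lists A" "d \<in> A"
  shows "real (cont (w @ [d])) \<le> (amax + 1) * real (cont w)"
proof -
  have "real (cont (w @ [d])) = real d * real (cont w) + real (cont_bl w)" by (simp add: cont_snoc)
  also have "\<dots> \<le> amax * real (cont w) + real (cont w)"
    using le_amax assms cont_bl_le[OF pos_word] by (intro add_mono mult_right_mono) auto
  finally show ?thesis by (simp add: algebra_simps)
qed

lemma cont_le_bl:
  assumes "w \<in> lists A" "w \<noteq> []"
  shows "real (cont w) \<le> (amax + 1) * real (cont_bl w)"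
proof -
  obtain x d where "w = x @ [d]" using assms(2) by (metis rev_exhaust)
  then show ?thesis using cont_snoc_le[of x d] assms by (simp add: cont_bl_snoc)
qed

lemma stop_words_le:
  assumes "w \<in> stop_words M" "1 \<le> M"
  shows "real (cont w) \<le> (amax + 1) * M"
proof (cases "w = []")
  case True
  then show ?thesis using assms amax_ge_1 mult_mono[of 1 "amax + 1" 1 M] by simp
next
  case False
  then obtain x d where w: "w = x @ [d]" by (metis rev_exhaust)
  then have "real (cont w) \<le> (amax + 1) * real (cont x)"
    using assms cont_snoc_le by (auto simp: stop_words_def)
  also have "\<dots> \<le> (amax + 1) * M"
    using assms w amax_ge_1 by (intro mult_left_mono) (auto simp: stop_words_def)
  finally show ?thesis .
qed

lemma stop_words_subset: "1 \<le> M \<Longrightarrow> stop_words M \<subseteq> words_upto ((amax + 1) * M)"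
  using stop_words_le by (auto simp: words_upto_def stop_words_def)

lemma finite_stop_words: "1 \<le> M \<Longrightarrow> finite (stop_words M)"
  using stop_words_subset finite_words_upto finite_subset by blast

lemma stop_words_lists: "w \<in> stop_words M \<Longrightarrow> w \<in> lists A"
  by (simp add: stop_words_def)

lemma stop_prefix_exists:
  assumes "w \<in> lists A" "M \<le> real (cont w)"
  shows "\<exists>x y. w = x @ y \<and> x \<in> stop_words M \<and> y \<in> lists A"
  using assms
proof (induction w rule: rev_induct)
  case Nil
  then show ?case by (auto simp: stop_words_def)
next
  case (snoc d w)
  show ?case
  proof (cases "M \<le> real (cont w)")
    case True
    then obtain x y where "w = x @ y" "x \<in> stop_words M" "y \<in> lists A" using snoc by auto
    then show ?thesis using snoc.prems by (intro exI[of _ x] exI[of _ "y @ [d]"]) auto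
  next
    case False
    then show ?thesis using snoc.prems
      by (intro exI[of _ "w @ [d]"] exI[of _ "[]"]) (auto simp: stop_words_def)
  qed
qed

text \<open>Removing the last letter of a proper extension of a stopping word still leaves an
  extension of that word, whose continuant is at least M. So the stopping set is a prefix
  code.\<close>

lemma stop_prefix_unique:
  assumes "x \<in> stop_words M" "x' \<in> stop_words M" "x @ y = x' @ y'"
  shows "x = x' \<and> y = y'"
proof -
  have no: "z = []" if "x \<in> stop_words M" "x @ z \<in> stop_words M" for x z
  proof (rule ccontr)
    assume "z \<noteq> []"
    then have "butlast (x @ z) = x @ butlast z" by (simp add: butlast_append)
    moreover have "0 \<notin> set x" "0 \<notin> set (butlast z)"
      using that zero_notin_A in_set_butlastD by (fastforce simp: stop_words_def)+
    then have "cont x \<le> cont (x @ butlast z)" by (rule cont_append_ge)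
    ultimately show False using that \<open>z \<noteq> []\<close> by (auto simp: stop_words_def)
  qed
  from assms(3) consider z where "x = x' @ z" "z @ y = y'" | z where "x @ z = x'" "y = z @ y'"
    by (auto simp: append_eq_append_conv2)
  then show ?thesis
  proof cases
    case 1 then show ?thesis using no[of x' z] assms by auto
  next
    case 2 then show ?thesis using no[of x z] assms by auto
  qed
qed

text \<open>Reversal preserves continuants, so this is the stopping prefix of the reversed
  word.\<close>

lemma stop_suffix_exists:
  assumes "w \<in> lists A" "M \<le> real (cont w)" "1 \<le> M"
  shows "\<exists>y z. w = y @ z \<and> y \<in> lists A \<and> z \<in> lists A \<and> M \<le> real (cont z) \<and>
           real (cont z) \<le> (amax + 1) * M"
proof -
  have "rev w \<in> lists A" using assms by auto
  then obtain x y where xy: "rev w = x @ y" "x \<in> stop_words M" "y \<in> lists A"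
    using stop_prefix_exists[of "rev w" M] assms by (auto simp: cont_rev)
  then have "w = rev y @ rev x" by (metis rev_append rev_rev_ident)
  then show ?thesis using xy stop_words_le[OF xy(2) assms(3)]
    by (intro exI[of _ "rev y"] exI[of _ "rev x"]) (auto simp: cont_rev stop_words_def)
qed

subsection \<open>Growth of the number of words\<close>

definition doubling :: real where "doubling = 1 + real (card A) + (real (card A))\<^sup>2"

lemma doubling_ge_2: "2 \<le> doubling"
proof -
  have "1 \<le> real (card A)" using finite_A A_nonempty by (simp add: Suc_le_eq card_gt_0_iff)
  then have "1 \<le> real (card A) + (real (card A))\<^sup>2" by (smt (verit) zero_le_power2)
  then show ?thesis by (simp add: doubling_def)
qed

text \<open>Two leading letters at least double the continuant. The summands of
  \<open>doubling\<close> account for the empty word, the one-letter words and the choice of two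
  leading letters.\<close>

lemma word_count_double:
  assumes "1 \<le> X"
  shows "word_count (2 * X) \<le> doubling * word_count X"
proof -
  let ?f = "\<lambda>(d, e, w). d # e # (w :: nat list)"
  have "words_upto (2 * X) \<subseteq> {[]} \<union> (\<lambda>d. [d]) ` A \<union> ?f ` (A \<times> A \<times> words_upto X)"
  proof
    fix w assume w: "w \<in> words_upto (2 * X)"
    show "w \<in> {[]} \<union> (\<lambda>d. [d]) ` A \<union> ?f ` (A \<times> A \<times> words_upto X)"
    proof (cases "\<exists>d e x. w = d # e # x")
      case True
      then obtain d e x where x: "w = d # e # x" by auto
      have mem: "d \<in> A" "e \<in> A" "x \<in> lists A" using w x by (auto simp: words_upto_def)
      then have "1 \<le> d" "1 \<le> e" using zero_notin_A by (metis not_less_eq_eq le0 le_zero_eq One_nat_def)+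
      then have "1 * (1 * cont x) \<le> d * (e * cont x)" by (intro mult_mono) auto
      moreover have "cont w = d * (e * cont x) + d * cont_tl x + cont x" by (simp add: x algebra_simps)
      ultimately have "2 * cont x \<le> cont w" by linarith
      then have "2 * real (cont x) \<le> real (cont w)" by linarith
      then have "x \<in> words_upto X" using w mem by (auto simp: words_upto_def)
      then have "?f (d, e, x) \<in> ?f ` (A \<times> A \<times> words_upto X)" using mem by (intro imageI) simp
      then show ?thesis using x by simp
    next
      case False
      then have "w = [] \<or> (\<exists>d. w = [d])" by (metis neq_Nil_conv)
      then show ?thesis using w by (auto simp: words_upto_def)
    qed
  qed
  then have "card (words_upto (2 * X)) \<le> card ({[]} \<union> (\<lambda>d. [d]) ` A \<union> ?f ` (A \<times> A \<times> words_upto X))"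
    using finite_A finite_words_upto by (intro card_mono) auto
  also have "\<dots> \<le> (1 + card A) + card A * (card A * card (words_upto X))"
  proof -
    have "card ({[]} \<union> (\<lambda>d. [d]) ` A \<union> ?f ` (A \<times> A \<times> words_upto X))
      \<le> card {[] :: nat list} + card ((\<lambda>d. [d]) ` A) + card (?f ` (A \<times> A \<times> words_upto X))"
      by (meson add_mono card_Un_le le_trans order_refl)
    also have "\<dots> \<le> 1 + card A + card (A \<times> A \<times> words_upto X)"
      using finite_A finite_words_upto by (intro add_mono card_image_le) auto
    finally show ?thesis by (simp add: card_cartesian_product)
  qed
  finally have "word_count (2 * X) \<le> (1 + real (card A)) * 1 + (real (card A))\<^sup>2 * word_count X"
    unfolding word_count_def power2_eq_square of_nat_le_iff[symmetric, where 'a = real]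
    by (simp add: mult.assoc)
  also have "\<dots> \<le> (1 + real (card A)) * word_count X + (real (card A))\<^sup>2 * word_count X"
    using word_count_ge_1[OF assms] by (intro add_mono mult_left_mono) auto
  finally show ?thesis by (simp add: doubling_def algebra_simps)
qed

definition growth_exp :: real where "growth_exp = log 2 doubling"

lemma growth_exp_ge_1: "1 \<le> growth_exp"
  using doubling_ge_2 by (simp add: growth_exp_def le_log_iff)

text \<open>Iterated doubling gives some polynomial bound. The exponent may be far from the truth:
  it is applied to dilations by constants, by multiples of the small parameter H, or against
  exponential decay.\<close>

lemma word_count_scale:
  assumes "1 \<le> X" "1 \<le> y"
  shows "word_count (y * X) \<le> doubling * y powr growth_exp * word_count X"
proof -
  have pw: "word_count (2 ^ n * X) \<le> doubling ^ n * word_count X" for n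
  proof (induction n)
    case (Suc n)
    have "1 * 1 \<le> 2 ^ n * X" using assms by (intro mult_mono) auto
    then have "word_count (2 * (2 ^ n * X)) \<le> doubling * word_count (2 ^ n * X)"
      by (intro word_count_double) auto
    also have "\<dots> \<le> doubling * (doubling ^ n * word_count X)"
      using Suc doubling_ge_2 by (intro mult_left_mono) auto
    finally show ?case by (simp add: mult.assoc)
  qed simp
  define n where "n = nat \<lceil>log 2 y\<rceil>"
  have l0: "0 \<le> log 2 y" using assms by simp
  have n: "log 2 y \<le> n" "real n \<le> log 2 y + 1" using l0 unfolding n_def by linarith+
  have "y = 2 powr (log 2 y)" using assms by simp
  also have "\<dots> \<le> 2 powr n" using n by simp
  finally have "y \<le> 2 ^ n" by (simp add: powr_realpow)
  then have "word_count (y * X) \<le> word_count (2 ^ n * X)"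
    using assms by (intro word_count_mono mult_right_mono) auto
  also have "\<dots> \<le> doubling ^ n * word_count X" by (rule pw)
  also have "doubling ^ n \<le> doubling * y powr growth_exp"
  proof -
    have "doubling ^ n = doubling powr n" using doubling_ge_2 by (simp add: powr_realpow)
    also have "\<dots> \<le> doubling powr (log 2 y + 1)" using n doubling_ge_2 by simp
    also have "\<dots> = doubling * doubling powr (log 2 y)" using doubling_ge_2 by (simp add: powr_add)
    also have "doubling powr (log 2 y) = y powr growth_exp"
      using doubling_ge_2 assms by (simp add: growth_exp_def powr_def log_def)
    finally show ?thesis .
  qed
  finally show ?thesis using word_count_nonneg by (simp add: mult_right_mono)
qed

text \<open>Concatenation is injective on a prefix code times all words, and it multiplies
  continuants up to bounded factors, which \<open>word_count_scale\<close> removes.\<close>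

lemma stop_words_mult_word_count:
  assumes "1 \<le> M" "1 \<le> X"
  shows "real (card (stop_words M)) * word_count X
       \<le> doubling * (2 * (amax + 1)) powr growth_exp * word_count (M * X)"
proof -
  let ?f = "\<lambda>(x, y). x @ (y :: nat list)"
  have "inj_on ?f (stop_words M \<times> words_upto X)"
    by (rule inj_onI) (auto dest: stop_prefix_unique)
  then have "card (stop_words M) * card (words_upto X) = card (?f ` (stop_words M \<times> words_upto X))"
    by (simp add: card_image card_cartesian_product)
  also have "\<dots> \<le> card (words_upto (2 * (amax + 1) * (M * X)))"
  proof (rule card_mono[OF finite_words_upto], safe)
    fix x y assume xy: "x \<in> stop_words M" "y \<in> words_upto X"
    then have l: "x \<in> lists A" "y \<in> lists A" by (auto simp: stop_words_def words_upto_def)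
    have "real (cont (x @ y)) \<le> 2 * (real (cont x) * real (cont y))"
      using cont_append_bounds(2)[OF pos_word pos_word, OF l]
      by (metis of_nat_le_iff of_nat_mult of_nat_numeral)
    also have "\<dots> \<le> 2 * (((amax + 1) * M) * X)"
      using stop_words_le[OF xy(1) assms(1)] xy amax_ge_1 assms
      by (intro mult_left_mono mult_mono) (auto simp: words_upto_def)
    finally show "x @ y \<in> words_upto (2 * (amax + 1) * (M * X))"
      using l by (auto simp: words_upto_def algebra_simps)
  qed
  finally have "real (card (stop_words M)) * word_count X \<le> word_count (2 * (amax + 1) * (M * X))"
    unfolding word_count_def of_nat_mult[symmetric] of_nat_le_iff .
  also have "\<dots> \<le> doubling * (2 * (amax + 1)) powr growth_exp * word_count (M * X)"
    using assms amax_ge_1 mult_mono[of 1 M 1 X] by (intro word_count_scale) auto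
  finally show ?thesis .
qed

text \<open>Words are sorted by the integer part of \<open>cont w / Y\<close>, and polynomial growth
  loses against the exponential. The constant is uniform in the cutoff Z.\<close>

lemma exp_sum_words:
  "\<exists>C>0. \<forall>Y Z. 1 \<le> Y \<longrightarrow> (\<Sum>w\<in>words_upto Z. exp (- real (cont w) / Y)) \<le> C * word_count Y"
proof -
  have "summable (\<lambda>i. (real i + 1) powr growth_exp * exp (- real i))"
  proof (rule summable_comparison_test_bigo)
    show "summable (\<lambda>i. norm (1 / (real i) ^ 2 :: real))"
      using inverse_power_summable[of 2, where 'a = real] by (simp add: field_simps)
    show "(\<lambda>i. (real i + 1) powr growth_exp * exp (- real i)) \<in> O(\<lambda>i. 1 / (real i)^2)"
      by real_asymp
  qed
  define \<sigma> where "\<sigma> = (\<Sum>i. (real i + 1) powr growth_exp * exp (- real i))"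
  have \<sigma>: "(\<Sum>i<n. (real i + 1) powr growth_exp * exp (- real i)) \<le> \<sigma>" for n
    unfolding \<sigma>_def using \<open>summable _\<close> by (intro sum_le_suminf) auto
  have "0 < \<sigma>" using \<sigma>[of 1] by simp
  moreover have "(\<Sum>w\<in>words_upto Z. exp (- real (cont w) / Y)) \<le> doubling * \<sigma> * word_count Y"
    if Y: "1 \<le> Y" for Y Z
  proof -
    define i where "i = (\<lambda>w. nat \<lfloor>real (cont w) / Y\<rfloor>)"
    define n where "n = Suc (Max (insert 0 (i ` words_upto Z)))"
    have in_range: "i ` words_upto Z \<subseteq> {..<n}"
      unfolding n_def using finite_words_upto by (auto simp: less_Suc_eq_le)
    have fl: "real (i w) \<le> cont w / Y" "cont w / Y < real (i w) + 1" for w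
      unfolding i_def using Y by (auto simp: of_nat_floor)
    have "(\<Sum>w\<in>words_upto Z. exp (- real (cont w) / Y)) \<le> (\<Sum>w\<in>words_upto Z. exp (- real (i w)))"
      using fl by (intro sum_mono) auto
    also have "\<dots> = (\<Sum>j<n. \<Sum>w\<in>{w\<in>words_upto Z. i w = j}. exp (- real (i w)))"
      using finite_words_upto in_range by (intro sum.group[symmetric]) auto
    also have "\<dots> \<le> (\<Sum>j<n. doubling * word_count Y * ((real j + 1) powr growth_exp * exp (- real j)))"
    proof (rule sum_mono)
      fix j
      have "(\<Sum>w\<in>{w\<in>words_upto Z. i w = j}. exp (- real (i w)))
          = real (card {w\<in>words_upto Z. i w = j}) * exp (- real j)" by simp
      also have "real (card {w\<in>words_upto Z. i w = j}) \<le> word_count ((real j + 1) * Y)"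
        unfolding word_count_def
      proof (intro of_nat_mono card_mono finite_words_upto subsetI)
        fix w assume "w \<in> {w\<in>words_upto Z. i w = j}"
        then show "w \<in> words_upto ((real j + 1) * Y)"
          using fl(2)[of w] Y by (auto simp: words_upto_def field_simps)
      qed
      also have "\<dots> \<le> doubling * (real j + 1) powr growth_exp * word_count Y"
        using Y by (intro word_count_scale) auto
      finally show "(\<Sum>w\<in>{w\<in>words_upto Z. i w = j}. exp (- real (i w)))
         \<le> doubling * word_count Y * ((real j + 1) powr growth_exp * exp (- real j))"
        by (simp add: algebra_simps)
    qed
    also have "\<dots> = doubling * word_count Y * (\<Sum>j<n. (real j + 1) powr growth_exp * exp (- real j))"
      by (simp add: sum_distrib_left)
    also have "\<dots> \<le> doubling * word_count Y * \<sigma>"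
      using \<sigma> doubling_ge_2 word_count_nonneg by (intro mult_left_mono) auto
    finally show ?thesis by (simp add: algebra_simps)
  qed
  ultimately show ?thesis using doubling_ge_2 by (intro exI[of _ "doubling * \<sigma>"]) auto
qed

end

subsection \<open>Hausdorff dimension and the number of words\<close>

context alphabet
begin

lemma stop_words_nonempty: "stop_words M \<noteq> {}"
proof -
  obtain d where d: "d \<in> A" using A_nonempty by blast
  let ?w = "replicate (nat \<lceil>M\<rceil>) d"
  have w: "?w \<in> lists A" using d by auto
  have "M \<le> real (length ?w)" by simp linarith
  also have "\<dots> \<le> real (cont ?w)" using length_le_cont[OF pos_word[OF w]] by simp
  finally show ?thesis using stop_prefix_exists[OF w] by blast
qed

text \<open>Some prefix of the expansion is a stopping word, all longer convergents stay within
  \<open>1 / M\<^sup>2\<close> of its value, and a closed ball keeps the limit.\<close>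

lemma cfrac_set_cover:
  assumes "0 < M" "x \<in> cfrac_set A"
  shows "\<exists>w\<in>stop_words M. x \<in> cball (cfrac w) (1 / M\<^sup>2)"
proof -
  obtain d where d: "\<forall>j. d j \<in> A" and lim: "(\<lambda>k. cfrac (map d [0..<k])) \<longlonglongrightarrow> x"
    using assms by (auto simp: cfrac_set_def)
  define n where "n = nat \<lceil>M\<rceil>"
  have lists: "map d [i..<j] \<in> lists A" for i j using d by auto
  have "M \<le> real n" unfolding n_def by linarith
  also have "\<dots> \<le> real (cont (map d [0..<n]))"
    using length_le_cont[OF pos_word[OF lists[of 0 n]]] by simp
  finally obtain w y where wy: "map d [0..<n] = w @ y" "w \<in> stop_words M"
    using stop_prefix_exists[OF lists] by blast
  define k where "k = length w"
  have "w = take k (map d [0..<n])" using wy k_def by simp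
  moreover have "k \<le> n" using arg_cong[OF wy(1), of length] k_def by simp
  ultimately have w: "w = map d [0..<k]" by (simp add: take_map)
  have "cfrac (map d [0..<j]) \<in> cball (cfrac w) (1 / M\<^sup>2)" if "j \<ge> k" for j
  proof -
    have "map d [0..<j] = w @ map d [k..<j]"
      using w that by (metis map_append upt_add_eq_append le_add_diff_inverse zero_le)
    then have "\<bar>cfrac (map d [0..<j]) - cfrac w\<bar> \<le> 1 / (real (cont w))\<^sup>2"
      using cfrac_append_near[OF pos_word[OF stop_words_lists[OF wy(2)]] pos_word[OF lists]] by simp
    also have "\<dots> \<le> 1 / M\<^sup>2"
      using assms(1) wy(2) by (intro divide_left_mono power_mono mult_pos_pos zero_less_power)
        (auto simp: stop_words_def)
    finally show ?thesis by (simp add: dist_real_def abs_minus_commute)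
  qed
  then have "x \<in> cball (cfrac w) (1 / M\<^sup>2)"
    by (intro Lim_in_closed_set[OF closed_cball _ _ lim]) (auto simp: eventually_at_top_linorder)
  then show ?thesis using wy by blast
qed

text \<open>The balls around the fractions of the stopping words form a cover of cost
  \<open>card * (2 / M\<^sup>2) powr s\<close>. Nonzero measure keeps the cost of all covers finer
  than some fixed \<epsilon> away from 0.\<close>

lemma stop_words_lower_bound:
  assumes s: "0 < s" and meas: "hausdorff_measure s (cfrac_set A) \<noteq> 0"
  shows "\<exists>c>0. \<forall>M\<ge>1. c * M powr (2 * s) \<le> real (card (stop_words M))"
proof -
  let ?E = "cfrac_set A"
  let ?I = "\<lambda>\<epsilon>. INF U\<in>fine_covers \<epsilon> ?E. \<Sum>i. diam_power s (U i)"
  have "\<exists>\<epsilon>>0. ?I \<epsilon> \<noteq> 0"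
  proof (rule ccontr)
    assume "\<not> (\<exists>\<epsilon>>0. ?I \<epsilon> \<noteq> 0)"
    then have "(SUP \<epsilon>\<in>{0<..}. ?I \<epsilon>) \<le> 0" by (intro SUP_least) auto
    then show False using meas by (simp add: hausdorff_measure_def)
  qed
  then obtain \<epsilon> where \<epsilon>: "0 < \<epsilon>" "?I \<epsilon> \<noteq> 0" by blast
  \<comment> \<open>Truncation at 1 turns the possibly infinite infimum into a positive
    real.\<close>
  define m where "m = enn2real (min (?I \<epsilon>) 1)"
  have mI: "ennreal m = min (?I \<epsilon>) 1"
    unfolding m_def by (rule ennreal_enn2real) (simp add: min_less_iff_disj)
  have "0 < m" using \<epsilon>(2) mI
    by (metis ennreal_0 ennreal_le_iff2 enn2real_nonneg m_def less_le min_def one_neq_zero)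
  have big: "m * (1/2) powr s * M powr (2 * s) \<le> real (card (stop_words M))"
    if M: "1 \<le> M" "2 / M\<^sup>2 \<le> \<epsilon>" for M
  proof -
    obtain ws where ws: "set ws = stop_words M" "distinct ws"
      using finite_distinct_list[OF finite_stop_words[OF M(1)]] by blast
    \<comment> \<open>The finite cover is padded by empty sets, which cost 0 in
      \<open>diam_power\<close>.\<close>
    define U where "U = (\<lambda>i. if i < length ws then cball (cfrac (ws ! i)) (1 / M\<^sup>2) else {})"
    have "U \<in> fine_covers \<epsilon> ?E"
      unfolding fine_covers_def
    proof safe
      fix x assume "x \<in> ?E"
      then obtain w where "w \<in> stop_words M" "x \<in> cball (cfrac w) (1 / M\<^sup>2)"
        using cfrac_set_cover[of M x] M by auto
      then obtain i where "i < length ws" "x \<in> cball (cfrac (ws ! i)) (1 / M\<^sup>2)"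
        using ws by (metis in_set_conv_nth)
      then have "x \<in> U i" by (simp add: U_def)
      then show "x \<in> (\<Union>i. U i)" by blast
    next
      show "bounded (U i)" for i by (simp add: U_def)
      show "diameter (U i) \<le> \<epsilon>" for i using M \<epsilon> by (simp add: U_def)
    qed
    then have "?I \<epsilon> \<le> (\<Sum>i. diam_power s (U i))" by (rule INF_lower)
    also have "\<dots> = (\<Sum>i\<in>{..<length ws}. diam_power s (U i))"
      by (rule suminf_finite) (auto simp: U_def diam_power_def)
    also have "\<dots> = (\<Sum>i\<in>{..<length ws}. ennreal ((2 / M\<^sup>2) powr s))"
      using s M by (intro sum.cong) (auto simp: U_def diam_power_def)
    also have "\<dots> = ennreal (real (length ws) * (2 / M\<^sup>2) powr s)"
      by (simp add: ennreal_mult ennreal_of_nat_eq_real_of_nat)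
    finally have "ennreal m \<le> ennreal (real (length ws) * (2 / M\<^sup>2) powr s)"
      using mI by (metis min.coboundedI1)
    then have "m \<le> real (length ws) * (2 / M\<^sup>2) powr s" by (subst (asm) ennreal_le_iff) auto
    moreover have "length ws = card (stop_words M)" using ws distinct_card by metis
    ultimately have "m \<le> real (card (stop_words M)) * (2 / M\<^sup>2) powr s" by simp
    then have "m * ((1/2) powr s * M powr (2 * s))
        \<le> real (card (stop_words M)) * (2 / M\<^sup>2) powr s * ((1/2) powr s * M powr (2 * s))"
      by (intro mult_right_mono) auto
    also have "(2 / M\<^sup>2) powr s * ((1/2) powr s * M powr (2 * s)) = 1"
    proof -
      have "M powr (2 * s) = (M\<^sup>2) powr s" using M by (simp add: powr_powr[symmetric] powr_numeral)
      then have "(2 / M\<^sup>2) powr s * ((1/2) powr s * M powr (2 * s)) = ((2 / M\<^sup>2) * (1/2) * M\<^sup>2) powr s"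
        using M by (simp add: powr_mult powr_divide)
      also have "(2 / M\<^sup>2) * (1/2) * M\<^sup>2 = 1" using M by simp
      finally show ?thesis by simp
    qed
    then have "real (card (stop_words M)) * (2 / M\<^sup>2) powr s * ((1/2) powr s * M powr (2 * s))
       = real (card (stop_words M))" by (simp add: mult.assoc)
    finally show ?thesis by (simp add: mult.assoc)
  qed
  \<comment> \<open>The second entry serves the small M with
    \<open>2 / M\<^sup>2 > \<epsilon>\<close>: there \<open>c * M powr (2 * s)\<close> is at most 1,
    and the stopping set is nonempty.\<close>
  define c where "c = min (m * (1/2) powr s) ((\<epsilon> / 2) powr s)"
  have "0 < c" using \<open>0 < m\<close> \<epsilon> by (simp add: c_def)
  moreover have "c * M powr (2 * s) \<le> real (card (stop_words M))" if M: "1 \<le> M" for M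
  proof (cases "2 / M\<^sup>2 \<le> \<epsilon>")
    case True
    have "c * M powr (2 * s) \<le> (m * (1/2) powr s) * M powr (2 * s)"
      unfolding c_def by (intro mult_right_mono) auto
    then show ?thesis using big[OF M True] by linarith
  next
    case False
    have M2: "M powr (2 * s) = (M\<^sup>2) powr s" using M by (simp add: powr_powr[symmetric] powr_numeral)
    have "c * M powr (2 * s) \<le> (\<epsilon> / 2) powr s * (M\<^sup>2) powr s"
      unfolding c_def M2 by (intro mult_right_mono) auto
    also have "(\<epsilon> / 2) powr s * (M\<^sup>2) powr s = (\<epsilon> / 2 * M\<^sup>2) powr s"
      using \<epsilon> by (simp only: powr_mult)
    also have "\<dots> \<le> 1 powr s"
      using False \<epsilon> s M by (intro powr_mono2) (auto simp: field_simps)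
    also have "\<dots> \<le> real (card (stop_words M))"
      using stop_words_nonempty finite_stop_words[OF M] by (simp add: Suc_le_eq card_gt_0_iff)
    finally show ?thesis .
  qed
  ultimately show ?thesis by blast
qed

end

subsection \<open>A weighted mean value estimate\<close>

lemma neg_binomial_sums:
  fixes z :: complex
  assumes "norm z < 1"
  shows "(\<lambda>n. of_nat ((n + k) choose k) * z ^ n) sums (1 / (1 - z) ^ Suc k)"
proof -
  have nz: "1 - z \<noteq> 0" using assms by auto
  have "(\<lambda>n. (- of_nat (Suc k) gchoose n) * (- z) ^ n) sums (1 + - z) powr (- of_nat (Suc k))"
    using assms by (intro gen_binomial_complex) simp
  moreover have "(- of_nat (Suc k) gchoose n) * (- z) ^ n = of_nat ((n + k) choose k) * z ^ n" for n
  proof -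
    have "((- of_nat (Suc k)) gchoose n :: complex)
        = (-1) ^ n * ((of_nat (Suc k) + of_nat n - 1) gchoose n)"
      by (rule gbinomial_minus)
    also have "(of_nat (Suc k) + of_nat n - 1 :: complex) = of_nat (n + k)" by simp
    also have "(of_nat (n + k) gchoose n :: complex) = of_nat ((n + k) choose n)"
      by (simp add: binomial_gbinomial)
    also have "(n + k) choose n = (n + k) choose k" using binomial_symmetric[of n "n + k"] by simp
    finally have "(- of_nat (Suc k) gchoose n) * (- z) ^ n
        = of_nat ((n + k) choose k) * ((-1) ^ n * (- z) ^ n)" by simp
    also have "(-1) ^ n * (- z) ^ n = z ^ n" by (simp add: power_mult_distrib[symmetric])
    finally show ?thesis .
  qed
  moreover have "(1 + - z) powr (- of_nat (Suc k)) = 1 / (1 - z) ^ Suc k"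
  proof -
    have "(1 - z) powr (of_nat (Suc k)) = (1 - z) ^ Suc k" by (rule powr_nat') simp
    then show ?thesis by (simp only: powr_minus add_uminus_conv_diff inverse_eq_divide)
  qed
  ultimately show ?thesis by simp
qed

text \<open>These are the Taylor coefficients of a negative power, so the exponential sums they
  weight have a closed form. The order k governs the decay: the kernel peaks at size M^(k+1) and
  falls to t^(-k-1) at distance t from the integers, while the weight itself has size M^k for n of
  order M.\<close>

definition poisson_weight :: "nat \<Rightarrow> real \<Rightarrow> nat \<Rightarrow> real" where
  "poisson_weight k M n = real ((n + k) choose k) * exp (- real n / M)"

definition poisson_kernel :: "nat \<Rightarrow> real \<Rightarrow> complex \<Rightarrow> complex" where
  "poisson_kernel k M z = 1 / (1 - of_real (exp (- 1 / M)) * z) ^ Suc k"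

lemma poisson_weight_nonneg: "0 \<le> poisson_weight k M n"
  by (simp add: poisson_weight_def)

lemma poisson_weight_sums:
  assumes "0 < M" "norm z \<le> 1"
  shows "(\<lambda>n. of_real (poisson_weight k M n) * z ^ n) sums poisson_kernel k M z"
proof -
  let ?r = "exp (- 1 / M)"
  have "?r < 1" using assms by simp
  then have "?r * norm z < 1" using assms(2)
    by (smt (verit) mult_left_le exp_ge_zero)
  then have "norm (of_real ?r * z) < 1" by (simp add: norm_mult)
  from neg_binomial_sums[OF this, of k] show ?thesis
    unfolding poisson_kernel_def poisson_weight_def
    by (simp add: power_mult_distrib exp_of_nat_mult[symmetric] mult.assoc flip: of_real_power)
qed

text \<open>Opening the square makes the sums over u and v factor into two truncated kernels. As n
  grows the left side converges to the form with full kernels, and it increases because its terms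
  are nonnegative, so every truncation stays below the limit.\<close>

lemma poisson_mean_square_le:
  fixes b x y :: "'i \<Rightarrow> complex"
  assumes "finite I" "0 < M" "\<And>i. i \<in> I \<Longrightarrow> norm (x i) \<le> 1" "\<And>i. i \<in> I \<Longrightarrow> norm (y i) \<le> 1"
  shows "(\<Sum>u<n. \<Sum>v<n. poisson_weight k M u * poisson_weight k M v *
            (cmod (\<Sum>i\<in>I. b i * x i ^ u * y i ^ v))\<^sup>2)
       \<le> (\<Sum>i\<in>I. \<Sum>j\<in>I. cmod (b i) * cmod (b j) *
            (cmod (poisson_kernel k M (x i * cnj (x j))) * cmod (poisson_kernel k M (y i * cnj (y j)))))"
proof -
  let ?\<psi> = "poisson_weight k M" and ?\<Phi> = "poisson_kernel k M"
  define L where "L = (\<lambda>n. \<Sum>u<n. \<Sum>v<n. ?\<psi> u * ?\<psi> v * (cmod (\<Sum>i\<in>I. b i * x i ^ u * y i ^ v))\<^sup>2)"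
  define P where "P = (\<lambda>n z. \<Sum>u<n. of_real (?\<psi> u) * z ^ u :: complex)"
  have L_eq: "of_real (L n) = (\<Sum>i\<in>I. \<Sum>j\<in>I. b i * cnj (b j) * (P n (x i * cnj (x j)) * P n (y i * cnj (y j))))" for n
  proof -
    have "of_real (L n) = (\<Sum>u<n. \<Sum>v<n. of_real (?\<psi> u) * of_real (?\<psi> v) *
        ((\<Sum>i\<in>I. b i * x i ^ u * y i ^ v) * (\<Sum>j\<in>I. cnj (b j) * cnj (x j) ^ u * cnj (y j) ^ v)))"
      unfolding L_def by (simp add: complex_norm_square del: of_real_power flip: of_real_power)
    also have "\<dots> = (\<Sum>u<n. \<Sum>v<n. \<Sum>i\<in>I. \<Sum>j\<in>I. b i * cnj (b j) *
        ((of_real (?\<psi> u) * (x i * cnj (x j)) ^ u) * (of_real (?\<psi> v) * (y i * cnj (y j)) ^ v)))"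
      by (subst sum_product, intro sum.cong refl)
         (simp add: sum_distrib_left power_mult_distrib ac_simps)
    also have "\<dots> = (\<Sum>u<n. \<Sum>i\<in>I. \<Sum>v<n. \<Sum>j\<in>I. b i * cnj (b j) *
        ((of_real (?\<psi> u) * (x i * cnj (x j)) ^ u) * (of_real (?\<psi> v) * (y i * cnj (y j)) ^ v)))"
      by (intro sum.cong refl sum.swap)
    also have "\<dots> = (\<Sum>i\<in>I. \<Sum>u<n. \<Sum>v<n. \<Sum>j\<in>I. b i * cnj (b j) *
        ((of_real (?\<psi> u) * (x i * cnj (x j)) ^ u) * (of_real (?\<psi> v) * (y i * cnj (y j)) ^ v)))"
      by (rule sum.swap)
    also have "\<dots> = (\<Sum>i\<in>I. \<Sum>u<n. \<Sum>j\<in>I. \<Sum>v<n. b i * cnj (b j) *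
        ((of_real (?\<psi> u) * (x i * cnj (x j)) ^ u) * (of_real (?\<psi> v) * (y i * cnj (y j)) ^ v)))"
      by (intro sum.cong refl sum.swap)
    also have "\<dots> = (\<Sum>i\<in>I. \<Sum>j\<in>I. \<Sum>u<n. \<Sum>v<n. b i * cnj (b j) *
        ((of_real (?\<psi> u) * (x i * cnj (x j)) ^ u) * (of_real (?\<psi> v) * (y i * cnj (y j)) ^ v)))"
      by (intro sum.cong refl sum.swap)
    also have "\<dots> = (\<Sum>i\<in>I. \<Sum>j\<in>I. b i * cnj (b j) * (P n (x i * cnj (x j)) * P n (y i * cnj (y j))))"
      unfolding P_def sum_product by (simp add: sum_distrib_left)
    finally show ?thesis .
  qed
  have P_lim: "(\<lambda>n. P n z) \<longlonglongrightarrow> ?\<Phi> z" if "norm z \<le> 1" for z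
    using poisson_weight_sums[OF assms(2) that] by (simp add: sums_def P_def)
  let ?R = "\<Sum>i\<in>I. \<Sum>j\<in>I. b i * cnj (b j) * (?\<Phi> (x i * cnj (x j)) * ?\<Phi> (y i * cnj (y j)))"
  have "norm (x i * cnj (x j)) \<le> 1" "norm (y i * cnj (y j)) \<le> 1" if "i \<in> I" "j \<in> I" for i j
    using assms(3,4) that by (simp_all add: norm_mult mult_le_one)
  then have "(\<lambda>n. of_real (L n)) \<longlonglongrightarrow> ?R"
    unfolding L_eq by (intro tendsto_sum tendsto_mult tendsto_const P_lim)
  then have "(\<lambda>n. norm (complex_of_real (L n))) \<longlonglongrightarrow> norm ?R" by (rule tendsto_norm)
  moreover have L0: "0 \<le> L n" for n
    unfolding L_def by (intro sum_nonneg mult_nonneg_nonneg poisson_weight_nonneg) auto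
  ultimately have lim: "L \<longlonglongrightarrow> norm ?R" by simp
  have "incseq L"
  proof (rule incseq_SucI)
    fix n
    let ?h = "\<lambda>(u, v). ?\<psi> u * ?\<psi> v * (cmod (\<Sum>i\<in>I. b i * x i ^ u * y i ^ v))\<^sup>2"
    have "L n = sum ?h ({..<n} \<times> {..<n})" for n unfolding L_def by (simp add: sum.cartesian_product)
    moreover have "sum ?h ({..<n} \<times> {..<n}) \<le> sum ?h ({..<Suc n} \<times> {..<Suc n})"
      by (rule sum_mono2) (auto intro!: mult_nonneg_nonneg poisson_weight_nonneg)
    ultimately show "L n \<le> L (Suc n)" by metis
  qed
  then have "L n \<le> norm ?R" using lim by (rule incseq_le)
  also have "\<dots> \<le> (\<Sum>i\<in>I. \<Sum>j\<in>I. cmod (b i) * cmod (b j) *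
            (cmod (?\<Phi> (x i * cnj (x j))) * cmod (?\<Phi> (y i * cnj (y j)))))"
    by (intro order.trans[OF norm_sum] sum_mono) (simp add: norm_mult)
  finally show ?thesis by (simp add: L_def)
qed

section \<open>Distance to the nearest integer and decay of the kernels\<close>

definition near_int :: "real \<Rightarrow> real \<Rightarrow> bool" where
  "near_int t x \<longleftrightarrow> (\<exists>m::int. \<bar>x - of_int m\<bar> \<le> t)"

lemma near_int_minus: "near_int t (x - y) \<longleftrightarrow> near_int t (y - x)"
proof -
  have "near_int t (y - x)" if near: "near_int t (x - y)" for x y
  proof -
    obtain m :: int where "\<bar>x - y - of_int m\<bar> \<le> t" using near unfolding near_int_def by blast
    then show ?thesis unfolding near_int_def by (intro exI[of _ "- m"]) (simp add: abs_if split: if_splits)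
  qed
  then show ?thesis by blast
qed

lemma half_le_sin:
  assumes "0 \<le> x" "x \<le> pi / 2"
  shows "x / 2 \<le> sin (x::real)"
proof -
  have "\<bar>sin x - (\<Sum>m<3. sin_coeff m * x ^ m)\<bar> \<le> inverse (fact 3) * \<bar>x\<bar> ^ 3"
    by (rule Maclaurin_sin_bound)
  moreover have "(\<Sum>m<3. sin_coeff m * x ^ m) = x"
    by (simp add: numeral_3_eq_3 sin_coeff_def)
  moreover have "inverse (fact 3) * \<bar>x\<bar> ^ 3 = x * x\<^sup>2 / 6"
    using assms by (simp add: fact_numeral power3_eq_cube power2_eq_square)
  \<comment> \<open>From \<open>pi / 2 \<le> 8 / 5\<close> one gets
    \<open>x\<^sup>2 \<le> 3\<close>, so the cubic remainder is at most half of x.\<close>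
  moreover have "x \<le> 8/5" using assms pi_less_4 pi_approx by simp
  then have "x\<^sup>2 \<le> (8/5)\<^sup>2" using assms by (intro power_mono) auto
  then have "x * x\<^sup>2 \<le> x * 3" using assms by (intro mult_left_mono) (auto simp: power2_eq_square)
  ultimately have "\<bar>sin x - x\<bar> \<le> x * 3 / 6" by simp
  then have "x - sin x \<le> x * 3 / 6" by linarith
  then show ?thesis by simp
qed

text \<open>The modulus equals \<open>2 * sin (pi * \<bar>\<eta>\<bar>)\<close> with \<eta> the
  signed distance to the nearest integer, and the sine is at least half its argument up to
  \<open>pi / 2\<close>.\<close>

lemma cmod_one_minus_cis_ge:
  assumes "\<not> near_int t \<xi>"
  shows "t \<le> cmod (1 - cis (2 * pi * \<xi>))"
proof -
  define \<eta> where "\<eta> = \<xi> - of_int (round \<xi>)"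
  have \<eta>: "\<bar>\<eta>\<bar> \<le> 1/2" "t < \<bar>\<eta>\<bar>"
    using assms of_int_round_abs_le[of \<xi>] unfolding \<eta>_def near_int_def
    by (simp_all add: abs_minus_commute not_le del: of_int_round_abs_le)
  have eq: "2 * pi * \<xi> = 2 * pi * \<eta> + 2 * pi * of_int (round \<xi>)" by (simp add: \<eta>_def algebra_simps)
  have "cis (2 * pi * \<xi>) = cis (2 * pi * \<eta>)"
    unfolding eq cis_mult[symmetric] by (simp add: cis_multiple_2pi)
  moreover have "(cmod (1 - cis (2 * pi * \<eta>)))\<^sup>2 = (2 * sin (pi * \<bar>\<eta>\<bar>))\<^sup>2"
  proof -
    have "(cmod (1 - cis (2 * pi * \<eta>)))\<^sup>2 = (1 - cos (2 * (pi * \<eta>)))\<^sup>2 + (sin (2 * (pi * \<eta>)))\<^sup>2"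
      by (simp add: cmod_power2 mult.assoc)
    also have "\<dots> = 2 - 2 * cos (2 * (pi * \<eta>))"
      by (simp add: power2_diff sin_squared_eq)
    also have "\<dots> = (2 * sin (pi * \<eta>))\<^sup>2" by (simp add: cos_double_sin power_mult_distrib)
    finally show ?thesis by (cases "\<eta> \<ge> 0") (simp_all)
  qed
  moreover have "\<bar>\<eta>\<bar> \<le> 2 * sin (pi * \<bar>\<eta>\<bar>)"
  proof -
    have "pi * \<bar>\<eta>\<bar> / 2 \<le> sin (pi * \<bar>\<eta>\<bar>)" using \<eta> by (intro half_le_sin) auto
    moreover have "1 * \<bar>\<eta>\<bar> \<le> pi * \<bar>\<eta>\<bar>" using pi_ge_two by (intro mult_right_mono) auto
    ultimately show ?thesis by simp
  qed
  ultimately show ?thesis using \<eta>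
    by (smt (verit) norm_ge_zero power2_eq_imp_eq)
qed

lemma norm_poisson_kernel:
  "cmod (poisson_kernel k M z) = inverse (cmod (1 - of_real (exp (- 1 / M)) * z)) ^ Suc k"
  unfolding poisson_kernel_def norm_divide norm_power norm_one power_inverse by (rule divide_inverse[THEN trans]) simp

lemma poisson_kernel_le:
  assumes "1 \<le> M" "norm z \<le> 1"
  shows "cmod (poisson_kernel k M z) \<le> (2 * M) ^ Suc k"
proof -
  let ?r = "exp (- 1 / M)"
  have "1 / (2 * M) \<le> 1 - ?r"
  proof -
    have "1 + 1 / M \<le> exp (1 / M)" by (rule exp_ge_add_one_self)
    then have "?r \<le> 1 / (1 + 1 / M)"
      using assms by (simp add: exp_minus inverse_eq_divide divide_left_mono add_pos_pos)
    also have "\<dots> \<le> 1 - 1 / (2 * M)" using assms by (simp add: field_simps)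
    finally show ?thesis by simp
  qed
  also have "1 - ?r \<le> cmod (1 - of_real ?r * z)"
  proof -
    have "cmod (of_real ?r * z) \<le> ?r * 1" using assms by (simp add: norm_mult)
    then show ?thesis using norm_triangle_ineq2[of 1 "of_real ?r * z"] by simp
  qed
  finally have "inverse (cmod (1 - of_real ?r * z)) \<le> inverse (1 / (2 * M))"
    using assms by (intro le_imp_inverse_le) auto
  then have "(inverse (cmod (1 - of_real ?r * z))) ^ Suc k \<le> (2 * M) ^ Suc k"
    by (intro power_mono) auto
  then show ?thesis unfolding norm_poisson_kernel .
qed

text \<open>Damping by \<rho> cannot spoil the decay: with \<sigma> the total damping, the
  denominator dominates both \<open>1 - \<sigma>\<close> and
  \<open>cmod (1 - ?e) - (1 - \<sigma>)\<close>, hence half of \<open>cmod (1 - ?e)\<close>. This is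
  what allows the factor exp (-1/N) to be kept inside the base.\<close>

lemma poisson_kernel_far_le:
  assumes "0 < M" "0 \<le> \<rho>" "\<rho> \<le> 1" "0 < t" "\<not> near_int t \<xi>"
  shows "cmod (poisson_kernel k M (of_real \<rho> * cis (2 * pi * \<xi>))) \<le> (2 / t) ^ Suc k"
proof -
  define \<sigma> where "\<sigma> = exp (- 1 / M) * \<rho>"
  let ?e = "cis (2 * pi * \<xi>)"
  have \<sigma>: "0 \<le> \<sigma>" "\<sigma> \<le> 1" unfolding \<sigma>_def using assms by (auto intro!: mult_le_one)
  have "1 - ?e = (1 - of_real \<sigma> * ?e) + (of_real \<sigma> * ?e - ?e)" by simp
  then have "cmod (1 - ?e) \<le> cmod (1 - of_real \<sigma> * ?e) + cmod (of_real \<sigma> * ?e - ?e)"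
    by (metis norm_triangle_ineq)
  moreover have "cmod (of_real \<sigma> * ?e - ?e) = 1 - \<sigma>"
  proof -
    have "of_real \<sigma> * ?e - ?e = - (of_real (1 - \<sigma>) * ?e)" by (simp add: algebra_simps)
    then have "cmod (of_real \<sigma> * ?e - ?e) = \<bar>1 - \<sigma>\<bar>"
      by (simp only: norm_minus_cancel norm_mult norm_of_real norm_cis mult_1_right)
    then show ?thesis using \<sigma> by simp
  qed
  moreover have "1 - \<sigma> \<le> cmod (1 - of_real \<sigma> * ?e)"
    using norm_triangle_ineq2[of 1 "of_real \<sigma> * ?e"] \<sigma> by (simp add: norm_mult)
  moreover have "t \<le> cmod (1 - ?e)" using assms by (intro cmod_one_minus_cis_ge)
  ultimately have "t / 2 \<le> cmod (1 - of_real \<sigma> * ?e)" by simp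
  then have "inverse (cmod (1 - of_real \<sigma> * ?e)) \<le> inverse (t / 2)"
    using assms by (intro le_imp_inverse_le) auto
  then have "(inverse (cmod (1 - of_real \<sigma> * ?e))) ^ Suc k \<le> (2 / t) ^ Suc k"
    by (intro power_mono) auto
  moreover have "cmod (poisson_kernel k M (of_real \<rho> * ?e)) = (inverse (cmod (1 - of_real \<sigma> * ?e))) ^ Suc k"
    unfolding norm_poisson_kernel \<sigma>_def by (simp only: of_real_mult mult.assoc)
  ultimately show ?thesis by simp
qed

subsection \<open>The bilinear large sieve\<close>

definition damped :: "real \<Rightarrow> real \<Rightarrow> complex" where
  "damped N \<theta> = of_real (exp (- 1 / N)) * cis (2 * pi * \<theta>)"

lemma norm_damped_power: "norm (damped N \<theta> ^ n) = exp (- real n / N)"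
  by (simp add: damped_def norm_mult norm_power exp_of_nat_mult[symmetric])

lemma norm_damped_power_le_1: "0 < N \<Longrightarrow> norm (damped N \<theta> ^ n) \<le> 1"
  by (simp add: norm_damped_power)

lemma damped_mult_cnj:
  "damped N \<theta> ^ n * cnj (damped N \<theta>' ^ n')
     = of_real (exp (- (real n + real n') / N)) * cis (2 * pi * (\<theta> * real n - \<theta>' * real n'))"
proof -
  have pw: "damped N \<theta> ^ n = of_real (exp (- real n / N)) * cis (2 * pi * (\<theta> * real n))" for \<theta> n
  proof -
    have "exp (- 1 / N) ^ n = exp (- real n / N)" by (simp add: exp_of_nat_mult[symmetric])
    moreover have "cis (2 * pi * \<theta>) ^ n = cis (2 * pi * (\<theta> * real n))"
      by (simp only: Complex.DeMoivre) (simp add: ac_simps)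
    ultimately show ?thesis by (simp only: damped_def power_mult_distrib of_real_power[symmetric])
  qed
  have "damped N \<theta> ^ n * cnj (damped N \<theta>' ^ n') =
     of_real (exp (- real n / N) * exp (- real n' / N)) *
       (cis (2 * pi * (\<theta> * real n)) * cis (- (2 * pi * (\<theta>' * real n'))))"
    unfolding pw by (simp add: cis_cnj ac_simps)
  also have "exp (- real n / N) * exp (- real n' / N) = exp (- (real n + real n') / N)"
    by (simp add: exp_add[symmetric] diff_divide_distrib)
  also have "cis (2 * pi * (\<theta> * real n)) * cis (- (2 * pi * (\<theta>' * real n')))
      = cis (2 * pi * (\<theta> * real n - \<theta>' * real n'))"
    by (simp add: cis_mult algebra_simps)
  finally show ?thesis .
qed

definition near_vec :: "real \<Rightarrow> real \<Rightarrow> nat list \<Rightarrow> real \<Rightarrow> nat list \<Rightarrow> bool" where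
  "near_vec t \<theta> w \<theta>' w' \<longleftrightarrow>
     near_int t (\<theta> * real (cont w) - \<theta>' * real (cont w')) \<and>
     near_int t (\<theta> * real (cont_tl w) - \<theta>' * real (cont_tl w'))"

lemma near_vec_sym: "near_vec t \<theta> w \<theta>' w' \<longleftrightarrow> near_vec t \<theta>' w' \<theta> w"
  unfolding near_vec_def by (subst (1 2) near_int_minus) simp

text \<open>Both kernels are at most their peak, and if the vectors disagree modulo 1 then at least
  one coordinate contributes the saving \<open>1 / H ^ Suc k\<close>. So the sieve loses only true
  coincidences plus an error that k makes negligible.\<close>

lemma poisson_kernels_near_vec_le:
  assumes "0 < N" "1 \<le> M" "1 \<le> H"
  shows "cmod (poisson_kernel k M (damped N \<theta> ^ cont w * cnj (damped N \<theta>' ^ cont w'))) *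
         cmod (poisson_kernel k M (damped N \<theta> ^ cont_tl w * cnj (damped N \<theta>' ^ cont_tl w')))
       \<le> (2 * M) ^ (2 * Suc k) * ((if near_vec (H / M) \<theta> w \<theta>' w' then 1 else 0) + 1 / H ^ Suc k)"
proof -
  let ?p = "poisson_kernel k M" and ?z = "\<lambda>a b. damped N \<theta> ^ a * cnj (damped N \<theta>' ^ b)"
  have n1: "norm (?z a b) \<le> 1" for a b
    using mult_le_one[OF norm_damped_power_le_1[OF assms(1), of \<theta> a] norm_ge_zero
        norm_damped_power_le_1[OF assms(1), of \<theta>' b]]
    by (simp only: norm_mult complex_mod_cnj)
  have b1: "cmod (?p (?z a b)) \<le> (2 * M) ^ Suc k" for a b
    using assms n1 by (intro poisson_kernel_le)
  have b2: "cmod (?p (?z a b)) \<le> (2 * M) ^ Suc k / H ^ Suc k"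
    if "\<not> near_int (H / M) (\<theta> * real a - \<theta>' * real b)" for a b
  proof -
    have "cmod (?p (?z a b)) \<le> (2 / (H / M)) ^ Suc k"
      unfolding damped_mult_cnj using assms that
      by (intro poisson_kernel_far_le) (auto simp: divide_nonpos_pos)
    then show ?thesis by (simp add: power_divide power_mult_distrib)
  qed
  have sq: "(2 * M) ^ (2 * Suc k) = (2 * M) ^ Suc k * (2 * M) ^ Suc k" by (simp only: mult_2 power_add)
  show ?thesis
  proof (cases "near_vec (H / M) \<theta> w \<theta>' w'")
    case True
    have "cmod (?p (?z (cont w) (cont w'))) * cmod (?p (?z (cont_tl w) (cont_tl w')))
        \<le> (2 * M) ^ Suc k * (2 * M) ^ Suc k"
      using b1 assms by (intro mult_mono) auto
    also have "\<dots> \<le> (2 * M) ^ Suc k * (2 * M) ^ Suc k * (1 + 1 / H ^ Suc k)"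
    proof -
      have "(2 * M) ^ Suc k * (2 * M) ^ Suc k * 1 \<le> (2 * M) ^ Suc k * (2 * M) ^ Suc k * (1 + 1 / H ^ Suc k)"
        using assms by (intro mult_left_mono mult_nonneg_nonneg zero_le_power) auto
      then show ?thesis by simp
    qed
    finally show ?thesis unfolding sq if_P[OF True] .
  next
    case False
    have "cmod (?p (?z (cont w) (cont w'))) * cmod (?p (?z (cont_tl w) (cont_tl w')))
        \<le> (2 * M) ^ Suc k * ((2 * M) ^ Suc k / H ^ Suc k)"
    proof (cases "near_int (H / M) (\<theta> * real (cont w) - \<theta>' * real (cont w'))")
      case True
      then have "\<not> near_int (H / M) (\<theta> * real (cont_tl w) - \<theta>' * real (cont_tl w'))"
        using False by (simp add: near_vec_def)
      then show ?thesis using b1 b2 assms by (intro mult_mono) auto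
    next
      case False
      then have "cmod (?p (?z (cont w) (cont w'))) * cmod (?p (?z (cont_tl w) (cont_tl w')))
        \<le> ((2 * M) ^ Suc k / H ^ Suc k) * (2 * M) ^ Suc k"
        using b1 b2 assms by (intro mult_mono) auto
      then show ?thesis by (simp add: mult.commute)
    qed
    then show ?thesis unfolding sq if_not_P[OF False] by (simp only: add_0 mult_1_right times_divide_eq_right mult.assoc)
  qed
qed

context alphabet
begin

text \<open>Completion: the first row of the matrix of x determines the reversed word up to parity,
  so each integer point of the box is hit at most twice, and a nonnegative summand may be extended
  to the whole box.\<close>

lemma sum_stop_words_le_box:
  assumes "finite U" "U \<subseteq> lists A" "\<And>u v. 0 \<le> (h u v :: real)"
    "\<And>x. x \<in> U \<Longrightarrow> cont x < n"
  shows "(\<Sum>x\<in>U. h (cont x) (cont_bl x)) \<le> 2 * (\<Sum>u<n. \<Sum>v<n. h u v)"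
proof -
  let ?g = "\<lambda>x. (cont x, cont_bl x)"
  have bl: "cont_bl x < n" if "x \<in> U" for x
  proof -
    have "x \<in> lists A" using assms(2) that by blast
    then show ?thesis using cont_bl_le[OF pos_word, of x] assms(4)[OF that] by linarith
  qed
  have img: "?g ` U \<subseteq> {..<n} \<times> {..<n}" using assms(4) bl by auto
  have fib: "card {x \<in> U. ?g x = p} \<le> 2" for p
  proof -
    let ?S = "{x \<in> U. ?g x = p}"
    have "card ?S = card (rev ` ?S)" by (simp add: card_image)
    also have "\<dots> \<le> 2 * card ((\<lambda>w. (cont w, cont_tl w)) ` rev ` ?S)"
      using assms zero_notin_A by (intro card_words_le_vectors) auto
    also have "card ((\<lambda>w. (cont w, cont_tl w)) ` rev ` ?S) \<le> card {p}"
      by (rule card_mono) (auto simp: cont_rev)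
    finally show ?thesis by simp
  qed
  have "(\<Sum>x\<in>U. h (cont x) (cont_bl x)) = (\<Sum>p\<in>{..<n} \<times> {..<n}. \<Sum>x\<in>{x\<in>U. ?g x = p}. h (cont x) (cont_bl x))"
    using assms(1) img by (intro sum.group[symmetric]) auto
  also have "\<dots> \<le> (\<Sum>p\<in>{..<n} \<times> {..<n}. 2 * h (fst p) (snd p))"
  proof (rule sum_mono)
    fix p
    have "(\<Sum>x\<in>{x\<in>U. ?g x = p}. h (cont x) (cont_bl x)) = (\<Sum>x\<in>{x\<in>U. ?g x = p}. h (fst p) (snd p))"
      by (intro sum.cong) auto
    also have "\<dots> = real (card {x\<in>U. ?g x = p}) * h (fst p) (snd p)" by simp
    also have "\<dots> \<le> 2 * h (fst p) (snd p)"
      using fib[of p] assms(3) by (intro mult_right_mono) auto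
    finally show "(\<Sum>x\<in>{x\<in>U. ?g x = p}. h (cont x) (cont_bl x)) \<le> 2 * h (fst p) (snd p)" .
  qed
  also have "\<dots> = 2 * (\<Sum>u<n. \<Sum>v<n. h u v)"
    by (simp add: sum_distrib_left sum.cartesian_product case_prod_beta)
  finally show ?thesis .
qed

lemma poisson_weight_ge:
  assumes "1 \<le> M" "M / (amax + 1) \<le> real u" "real u \<le> (amax + 1) * M"
  shows "(M / ((amax + 1) * k)) ^ k * exp (- (amax + 1)) \<le> poisson_weight k M u"
  unfolding poisson_weight_def
proof (rule mult_mono)
  have "(M / ((amax + 1) * k)) ^ k \<le> (real (u + k) / real k) ^ k"
  proof (rule power_mono)
    have "M / ((amax + 1) * k) = M / (amax + 1) / k" by simp
    also have "\<dots> \<le> real (u + k) / real k" using assms by (intro divide_right_mono) auto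
    finally show "M / ((amax + 1) * k) \<le> real (u + k) / real k" .
  qed (use assms amax_ge_1 in auto)
  also have "\<dots> \<le> real ((u + k) choose k)" by (rule binomial_ge_n_over_k_pow_k) simp
  finally show "(M / ((amax + 1) * k)) ^ k \<le> real ((u + k) choose k)" .
  show "exp (- (amax + 1)) \<le> exp (- real u / M)"
    using assms by (simp add: field_simps)
qed auto

text \<open>Duality: the mean square E is itself a sum over x of a linear form F in the row of x.
  Cauchy--Schwarz over x, completion with smooth weights and expansion over pairs (\<theta>, w)
  bound the square of E by E times the largest number of coincidences of one \<theta>.\<close>

lemma bilinear_large_sieve:
  "\<exists>C>0. \<forall>N \<Theta> V M H Bd. 0 < N \<longrightarrow> finite \<Theta> \<longrightarrow> finite V \<longrightarrow> V \<subseteq> lists A \<longrightarrow> 1 < M \<longrightarrow> 1 \<le> H \<longrightarrow> 0 \<le> Bd \<longrightarrow>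
     (\<forall>\<theta>\<in>\<Theta>. (\<Sum>w\<in>V. \<Sum>w'\<in>V. real (card {\<theta>'\<in>\<Theta>. near_vec (H / M) \<theta> w \<theta>' w'})) \<le> Bd) \<longrightarrow>
     (\<Sum>\<theta>\<in>\<Theta>. (cmod (\<Sum>x\<in>stop_words M. \<Sum>w\<in>V. damped N \<theta> ^ cont (x @ w)))\<^sup>2)
       \<le> C * real (card (stop_words M)) * M\<^sup>2 *
          (Bd + real (card V) ^ 2 * real (card \<Theta>) / H ^ Suc k)"
proof -
  \<comment> \<open>For k = 0 the quotient is 1 / 0 = 0, but its 0-th power is 1, so c is positive
    in every case.\<close>
  define c where "c = (1 / ((amax + 1) * k)) ^ k * exp (- (amax + 1))"
  have "0 < c"
    unfolding c_def using amax_ge_1 by (cases "k = 0") (auto intro!: mult_pos_pos zero_less_power)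
  define C where "C = 2 * 2 ^ (2 * Suc k) / c\<^sup>2"
  have "0 < C" using \<open>0 < c\<close> by (simp add: C_def)
  moreover have "(\<Sum>\<theta>\<in>\<Theta>. (cmod (\<Sum>x\<in>stop_words M. \<Sum>w\<in>V. damped N \<theta> ^ cont (x @ w)))\<^sup>2)
       \<le> C * real (card (stop_words M)) * M\<^sup>2 * (Bd + real (card V) ^ 2 * real (card \<Theta>) / H ^ Suc k)"
    if N: "0 < N" and fin: "finite \<Theta>" "finite V" and V: "V \<subseteq> lists A" and M: "1 < M" and H: "1 \<le> H" and Bd0: "0 \<le> Bd"
      and Bd: "\<forall>\<theta>\<in>\<Theta>. (\<Sum>w\<in>V. \<Sum>w'\<in>V. real (card {\<theta>'\<in>\<Theta>. near_vec (H / M) \<theta> w \<theta>' w'})) \<le> Bd"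
    for N \<Theta> V M H Bd
  proof -
    let ?U = "stop_words M"
    define S where "S = (\<lambda>\<theta>. \<Sum>x\<in>?U. \<Sum>w\<in>V. damped N \<theta> ^ cont (x @ w))"
    define E where "E = (\<Sum>\<theta>\<in>\<Theta>. (cmod (S \<theta>))\<^sup>2)"
    define I where "I = \<Theta> \<times> V"
    define b where "b = (\<lambda>i::real \<times> nat list. cnj (S (fst i)))"
    define X where "X = (\<lambda>i::real \<times> nat list. damped N (fst i) ^ cont (snd i))"
    define Y where "Y = (\<lambda>i::real \<times> nat list. damped N (fst i) ^ cont_tl (snd i))"
    define F where "F = (\<lambda>u v. \<Sum>i\<in>I. b i * X i ^ u * Y i ^ v)"
    have finU: "finite ?U" using finite_stop_words M by simp
    have finI: "finite I" using fin by (simp add: I_def)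
    \<comment> \<open>By \<open>cont_append\<close> the power of \<open>damped N \<theta>\<close>
      splits into powers of X and Y with exponents \<open>cont x\<close> and
      \<open>cont_bl x\<close>; in F these become free integer variables.\<close>
    have E_F: "of_real E = (\<Sum>x\<in>?U. F (cont x) (cont_bl x))"
    proof -
      have "of_real E = (\<Sum>\<theta>\<in>\<Theta>. S \<theta> * cnj (S \<theta>))"
        unfolding E_def by (simp add: complex_norm_square del: of_real_power flip: of_real_power)
      also have "\<dots> = (\<Sum>\<theta>\<in>\<Theta>. \<Sum>x\<in>?U. \<Sum>w\<in>V. damped N \<theta> ^ cont (x @ w) * cnj (S \<theta>))"
        by (intro sum.cong refl) (simp add: S_def sum_distrib_right)
      also have "\<dots> = (\<Sum>x\<in>?U. \<Sum>\<theta>\<in>\<Theta>. \<Sum>w\<in>V. damped N \<theta> ^ cont (x @ w) * cnj (S \<theta>))"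
        by (rule sum.swap)
      also have "\<dots> = (\<Sum>x\<in>?U. F (cont x) (cont_bl x))"
        unfolding F_def I_def sum.cartesian_product
        by (intro sum.cong refl)
           (auto simp: b_def X_def Y_def cont_append power_add power_mult[symmetric] ac_simps)
      finally show ?thesis .
    qed
    have E0: "0 \<le> E" unfolding E_def by (intro sum_nonneg) auto
    have "E\<^sup>2 = (cmod (\<Sum>x\<in>?U. F (cont x) (cont_bl x)))\<^sup>2"
      unfolding E_F[symmetric] by simp
    also have "\<dots> \<le> (\<Sum>x\<in>?U. cmod (F (cont x) (cont_bl x)))\<^sup>2"
      by (intro power_mono norm_sum) auto
    also have "\<dots> \<le> (\<Sum>x\<in>?U. (cmod (F (cont x) (cont_bl x)))\<^sup>2) * card ?U"
      by (rule sum_squared_le_sum_of_squares)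
    finally have 1: "E\<^sup>2 \<le> (\<Sum>x\<in>?U. (cmod (F (cont x) (cont_bl x)))\<^sup>2) * card ?U" .
    let ?\<psi> = "poisson_weight k M"
    define \<kappa> where "\<kappa> = c * M ^ k"
    have \<kappa>0: "0 < \<kappa>" using \<open>0 < c\<close> M by (simp add: \<kappa>_def)
    have \<kappa>_eq: "\<kappa> = (M / ((amax + 1) * k)) ^ k * exp (- (amax + 1))"
      by (simp add: \<kappa>_def c_def power_divide)
    have \<psi>_ge: "\<kappa> * \<kappa> \<le> ?\<psi> (cont x) * ?\<psi> (cont_bl x)" if x: "x \<in> ?U" for x
    proof -
      have l: "x \<in> lists A" and Mx: "M \<le> cont x" using x by (auto simp: stop_words_def)
      \<comment> \<open>Here \<open>1 < M\<close> matters: the empty word has \<open>cont_bl\<close>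
        equal to 0. For other words the bounded last letter keeps \<open>cont_bl x\<close>
        comparable with M, where the weight is of full size.\<close>
      have ne: "x \<noteq> []" using Mx M by auto
      have up: "real (cont x) \<le> (amax + 1) * M" using stop_words_le[OF x] M by simp
      have a: "0 < amax + 1" using amax_ge_1 by simp
      have bl1: "real (cont_bl x) \<le> real (cont x)" using cont_bl_le[OF pos_word[OF l]] by simp
      have bl2: "M \<le> (amax + 1) * real (cont_bl x)" using cont_le_bl[OF l ne] Mx by linarith
      have bl3: "M \<le> (amax + 1) * real (cont x)"
        using bl2 bl1 a by (meson mult_left_mono order_less_imp_le order_trans)
      have "\<kappa> \<le> ?\<psi> (cont x)" unfolding \<kappa>_eq
        using M up bl3 a by (intro poisson_weight_ge) (auto simp: field_simps)
      moreover have "\<kappa> \<le> ?\<psi> (cont_bl x)" unfolding \<kappa>_eq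
        using M up bl1 bl2 a by (intro poisson_weight_ge) (auto simp: field_simps)
      ultimately show ?thesis using \<kappa>0 by (intro mult_mono) auto
    qed
    define n where "n = Suc (nat \<lceil>(amax + 1) * M\<rceil>)"
    have n: "cont x < n" if "x \<in> ?U" for x
    proof -
      have "real (cont x) \<le> (amax + 1) * M" using stop_words_le[OF that] M by simp
      then show ?thesis unfolding n_def by linarith
    qed
    have "\<kappa> * \<kappa> * (\<Sum>x\<in>?U. (cmod (F (cont x) (cont_bl x)))\<^sup>2)
        \<le> (\<Sum>x\<in>?U. ?\<psi> (cont x) * ?\<psi> (cont_bl x) * (cmod (F (cont x) (cont_bl x)))\<^sup>2)"
      unfolding sum_distrib_left using \<psi>_ge by (intro sum_mono mult_right_mono) auto
    also have "\<dots> \<le> 2 * (\<Sum>u<n. \<Sum>v<n. ?\<psi> u * ?\<psi> v * (cmod (F u v))\<^sup>2)"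
      by (rule sum_stop_words_le_box[where h = "\<lambda>u v. ?\<psi> u * ?\<psi> v * (cmod (F u v))\<^sup>2"])
         (use n finU in \<open>auto simp: stop_words_def intro!: mult_nonneg_nonneg poisson_weight_nonneg\<close>)
    also have "(\<Sum>u<n. \<Sum>v<n. ?\<psi> u * ?\<psi> v * (cmod (F u v))\<^sup>2)
      \<le> (\<Sum>i\<in>I. \<Sum>j\<in>I. cmod (b i) * cmod (b j) *
            (cmod (poisson_kernel k M (X i * cnj (X j))) * cmod (poisson_kernel k M (Y i * cnj (Y j)))))"
      unfolding F_def using finI M N norm_damped_power_le_1
      by (intro poisson_mean_square_le) (auto simp: X_def Y_def)
    also have "\<dots> \<le> (2 * M) ^ (2 * Suc k) * E * (Bd + real (card V) ^ 2 * real (card \<Theta>) / H ^ Suc k)"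
    proof -
      define g where "g = (\<lambda>i j. (if near_vec (H / M) (fst i) (snd i) (fst j) (snd j) then 1 else 0 :: real) + 1 / H ^ Suc k)"
      have gsym: "g i j = g j i" for i j using near_vec_sym by (simp add: g_def)
      have g0: "0 \<le> g i j" for i j using H by (simp add: g_def)
      have "(\<Sum>i\<in>I. \<Sum>j\<in>I. cmod (b i) * cmod (b j) *
            (cmod (poisson_kernel k M (X i * cnj (X j))) * cmod (poisson_kernel k M (Y i * cnj (Y j)))))
          \<le> (\<Sum>i\<in>I. \<Sum>j\<in>I. cmod (b i) * cmod (b j) * ((2 * M) ^ (2 * Suc k) * g i j))"
        unfolding X_def Y_def g_def using N M H
        by (intro sum_mono mult_left_mono poisson_kernels_near_vec_le) auto
      \<comment> \<open>Schur test: g is symmetric, so only its row sums enter, and summed over w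
        these are what \<open>Bd\<close> controls.\<close>
      also have "\<dots> \<le> (\<Sum>i\<in>I. \<Sum>j\<in>I. ((cmod (b i))\<^sup>2 / 2 + (cmod (b j))\<^sup>2 / 2) * ((2 * M) ^ (2 * Suc k) * g i j))"
      proof (intro sum_mono mult_right_mono)
        show "cmod (b i) * cmod (b j) \<le> (cmod (b i))\<^sup>2 / 2 + (cmod (b j))\<^sup>2 / 2" for i j
          using sum_squares_bound[of "cmod (b i)" "cmod (b j)"] by simp
        show "0 \<le> (2 * M) ^ (2 * Suc k) * g i j" for i j using g0 M by simp
      qed
      also have "\<dots> = (\<Sum>i\<in>I. \<Sum>j\<in>I. (cmod (b i))\<^sup>2 / 2 * ((2 * M) ^ (2 * Suc k) * g i j)) +
          (\<Sum>i\<in>I. \<Sum>j\<in>I. (cmod (b j))\<^sup>2 / 2 * ((2 * M) ^ (2 * Suc k) * g i j))"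
        by (simp only: distrib_right sum.distrib)
      also have "(\<Sum>i\<in>I. \<Sum>j\<in>I. (cmod (b j))\<^sup>2 / 2 * ((2 * M) ^ (2 * Suc k) * g i j))
          = (\<Sum>i\<in>I. \<Sum>j\<in>I. (cmod (b i))\<^sup>2 / 2 * ((2 * M) ^ (2 * Suc k) * g i j))"
        by (subst sum.swap) (simp only: gsym)
      also have "(\<Sum>i\<in>I. \<Sum>j\<in>I. (cmod (b i))\<^sup>2 / 2 * ((2 * M) ^ (2 * Suc k) * g i j)) +
          (\<Sum>i\<in>I. \<Sum>j\<in>I. (cmod (b i))\<^sup>2 / 2 * ((2 * M) ^ (2 * Suc k) * g i j))
        = (2 * M) ^ (2 * Suc k) * (\<Sum>i\<in>I. (cmod (b i))\<^sup>2 * (\<Sum>j\<in>I. g i j))"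
        unfolding sum_distrib_left sum.distrib[symmetric] by (intro sum.cong refl) simp
      also have "(\<Sum>i\<in>I. (cmod (b i))\<^sup>2 * (\<Sum>j\<in>I. g i j))
          = (\<Sum>\<theta>\<in>\<Theta>. (cmod (S \<theta>))\<^sup>2 * (\<Sum>w\<in>V. \<Sum>j\<in>I. g (\<theta>, w) j))"
      proof -
        have "(\<Sum>i\<in>I. (cmod (b i))\<^sup>2 * (\<Sum>j\<in>I. g i j)) = (\<Sum>\<theta>\<in>\<Theta>. \<Sum>w\<in>V. (cmod (S \<theta>))\<^sup>2 * (\<Sum>j\<in>I. g (\<theta>, w) j))"
          by (subst (1) I_def, subst sum.cartesian_product) (auto simp: b_def intro!: sum.cong)
        then show ?thesis by (simp only: sum_distrib_left)
      qed
      also have "\<dots> \<le> (\<Sum>\<theta>\<in>\<Theta>. (cmod (S \<theta>))\<^sup>2 * (Bd + real (card V) ^ 2 * real (card \<Theta>) / H ^ Suc k))"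
      proof (intro sum_mono mult_left_mono)
        fix \<theta> assume \<theta>: "\<theta> \<in> \<Theta>"
        have "(\<Sum>j\<in>I. g (\<theta>, w) j) = (\<Sum>w'\<in>V. real (card {\<theta>'\<in>\<Theta>. near_vec (H / M) \<theta> w \<theta>' w'}))
            + real (card V) * real (card \<Theta>) / H ^ Suc k" for w
        proof -
          have "(\<Sum>j\<in>I. g (\<theta>, w) j) = (\<Sum>w'\<in>V. \<Sum>\<theta>'\<in>\<Theta>. g (\<theta>, w) (\<theta>', w'))"
            by (subst sum.swap) (simp add: I_def sum.cartesian_product)
          also have "\<dots> = (\<Sum>w'\<in>V. real (card {\<theta>'\<in>\<Theta>. near_vec (H / M) \<theta> w \<theta>' w'}) + real (card \<Theta>) / H ^ Suc k)"
          proof (rule sum.cong[OF refl])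
            fix w'
            have "(\<Sum>\<theta>'\<in>\<Theta>. if near_vec (H / M) \<theta> w \<theta>' w' then 1 else 0 :: real)
              = real (card {\<theta>'\<in>\<Theta>. near_vec (H / M) \<theta> w \<theta>' w'})"
              using fin by (simp add: sum.If_cases Int_def)
            then show "(\<Sum>\<theta>'\<in>\<Theta>. g (\<theta>, w) (\<theta>', w')) = real (card {\<theta>'\<in>\<Theta>. near_vec (H / M) \<theta> w \<theta>' w'}) + real (card \<Theta>) / H ^ Suc k"
              by (simp add: g_def sum.distrib)
          qed
          finally show ?thesis by (simp add: sum.distrib)
        qed
        then have "(\<Sum>w\<in>V. \<Sum>j\<in>I. g (\<theta>, w) j) =
            (\<Sum>w\<in>V. \<Sum>w'\<in>V. real (card {\<theta>'\<in>\<Theta>. near_vec (H / M) \<theta> w \<theta>' w'}))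
            + real (card V) ^ 2 * real (card \<Theta>) / H ^ Suc k"
          by (simp add: sum.distrib power2_eq_square)
        then show "(\<Sum>w\<in>V. \<Sum>j\<in>I. g (\<theta>, w) j) \<le> Bd + real (card V) ^ 2 * real (card \<Theta>) / H ^ Suc k"
          using Bd \<theta> by simp
      qed auto
      also have "\<dots> = E * (Bd + real (card V) ^ 2 * real (card \<Theta>) / H ^ Suc k)"
        by (simp only: E_def sum_distrib_right)
      finally show ?thesis using M by (simp add: mult.assoc mult_left_mono)
    qed
    finally have 2: "\<kappa> * \<kappa> * (\<Sum>x\<in>?U. (cmod (F (cont x) (cont_bl x)))\<^sup>2)
      \<le> 2 * ((2 * M) ^ (2 * Suc k) * E * (Bd + real (card V) ^ 2 * real (card \<Theta>) / H ^ Suc k))"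
      by simp
    show ?thesis
    proof (cases "E = 0")
      case True
      then show ?thesis using \<open>0 < C\<close> H M Bd0 unfolding E_def S_def by simp
    next
      case False
      then have E: "0 < E" using E0 by simp
      let ?D = "Bd + real (card V) ^ 2 * real (card \<Theta>) / H ^ Suc k"
      \<comment> \<open>E occurs squared on the left and once on the right; one factor
        cancels.\<close>
      have "\<kappa> * \<kappa> * E\<^sup>2 \<le> \<kappa> * \<kappa> * ((\<Sum>x\<in>?U. (cmod (F (cont x) (cont_bl x)))\<^sup>2) * card ?U)"
        using 1 \<kappa>0 by (intro mult_left_mono) auto
      also have "\<dots> = (\<kappa> * \<kappa> * (\<Sum>x\<in>?U. (cmod (F (cont x) (cont_bl x)))\<^sup>2)) * card ?U" by simp
      also have "\<dots> \<le> (2 * ((2 * M) ^ (2 * Suc k) * E * ?D)) * card ?U"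
        using 2 by (intro mult_right_mono) auto
      finally have "E * (\<kappa> * \<kappa> * E) \<le> E * (2 * (2 * M) ^ (2 * Suc k) * ?D * card ?U)"
        by (simp add: power2_eq_square ac_simps)
      then have "\<kappa> * \<kappa> * E \<le> 2 * (2 * M) ^ (2 * Suc k) * ?D * card ?U"
        using E by (simp only: mult_le_cancel_left_pos)
      then have "E \<le> (2 * (2 * M) ^ (2 * Suc k) * ?D * card ?U) / (\<kappa> * \<kappa>)"
        using \<kappa>0 by (simp add: pos_le_divide_eq ac_simps)
      \<comment> \<open>M^(2k+2) from the kernel peaks against M^(2k) from the weights leaves
        \<open>M\<^sup>2\<close>, the order of the number of integer vectors in the box.\<close>
      also have "\<dots> = C * real (card ?U) * M\<^sup>2 * ?D"
      proof -
        have "(2 * M) ^ (2 * Suc k) = 2 ^ (2 * Suc k) * (M\<^sup>2 * (M ^ k * M ^ k))"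
          by (simp add: power_mult_distrib power_add[symmetric] mult_2[symmetric])
        moreover have "\<kappa> * \<kappa> = c\<^sup>2 * (M ^ k * M ^ k)" by (simp add: \<kappa>_def power2_eq_square)
        moreover have "M ^ k * M ^ k \<noteq> 0" using M by simp
        ultimately show ?thesis unfolding C_def
          using nonzero_mult_divide_mult_cancel_right[of "M ^ k * M ^ k" "2 * (2 ^ (2 * Suc k) * M\<^sup>2) * ?D * card ?U" "c\<^sup>2"]
          by (simp only: ac_simps times_divide_eq_left times_divide_eq_right not_False_eq_True simp_thms)
      qed
      finally show ?thesis by (simp add: E_def S_def)
    qed
  qed
  ultimately show ?thesis by blast
qed

end

subsection \<open>Counting lemmas\<close>

lemma card_separated_le:
  fixes S :: "real set"
  assumes "0 < d" "0 \<le> len" "S \<subseteq> {l..l + len}" "\<And>x y. x \<in> S \<Longrightarrow> y \<in> S \<Longrightarrow> x \<noteq> y \<Longrightarrow> d \<le> \<bar>x - y\<bar>"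
  shows "finite S" "real (card S) \<le> len / d + 1"
proof -
  let ?f = "\<lambda>x. nat \<lfloor>(x - l) / d\<rfloor>"
  have inj: "inj_on ?f S"
  proof (rule inj_onI, rule ccontr)
    fix x y assume xy: "x \<in> S" "y \<in> S" "?f x = ?f y" "x \<noteq> y"
    then have "0 \<le> (x - l) / d" "0 \<le> (y - l) / d" using assms by auto
    then have "\<lfloor>(x - l) / d\<rfloor> = \<lfloor>(y - l) / d\<rfloor>" using xy(3) by (simp add: eq_nat_nat_iff)
    then have "\<bar>(x - l) / d - (y - l) / d\<bar> < 1" by linarith
    then have "\<bar>x - y\<bar> < d" using assms(1)
      by (simp add: diff_divide_distrib[symmetric] abs_divide pos_divide_less_eq)
    then show False using assms(4)[OF xy(1,2,4)] by simp
  qed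
  have img: "?f ` S \<subseteq> {..nat \<lfloor>len / d\<rfloor>}"
  proof safe
    fix x assume "x \<in> S"
    then have "(x - l) / d \<le> len / d" using assms by (intro divide_right_mono) auto
    then show "nat \<lfloor>(x - l) / d\<rfloor> \<le> nat \<lfloor>len / d\<rfloor>" by (intro nat_mono floor_mono)
  qed
  show "finite S" using inj img finite_imageD finite_subset by blast
  have "card S = card (?f ` S)" using inj by (simp add: card_image)
  also have "\<dots> \<le> card {..nat \<lfloor>len / d\<rfloor>}" using img by (intro card_mono) auto
  finally have "real (card S) \<le> real (nat \<lfloor>len / d\<rfloor>) + 1" by simp
  also have "real (nat \<lfloor>len / d\<rfloor>) \<le> len / d" using assms by (intro of_nat_floor) auto
  finally show "real (card S) \<le> len / d + 1" by simp
qed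

lemma card_congruent_le:
  fixes S :: "nat set"
  assumes "0 < e" "S \<subseteq> {..n}" "\<And>x y. x \<in> S \<Longrightarrow> y \<in> S \<Longrightarrow> int e dvd int x - int y"
  shows "real (card S) \<le> real n / real e + 1"
proof -
  have "real (card (real ` S)) \<le> real n / real e + 1"
  proof (rule card_separated_le(2)[where l = 0])
    fix x y assume xy: "x \<in> real ` S" "y \<in> real ` S" "x \<noteq> y"
    then obtain i j where ij: "x = real i" "y = real j" "i \<in> S" "j \<in> S" by auto
    then have "int e dvd int i - int j" "int i - int j \<noteq> 0" using assms(3) xy(3) by auto
    then have "int e \<le> \<bar>int i - int j\<bar>" using dvd_imp_le_int[of "int i - int j" "int e"] by simp
    then show "real e \<le> \<bar>x - y\<bar>" using ij by linarith
  qed (use assms in auto)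
  then show ?thesis by (simp add: card_image)
qed

definition grid :: "nat \<Rightarrow> real set" where
  "grid N = (\<lambda>j. real j / real N) ` {..<N}"

lemma finite_grid: "finite (grid N)" by (simp add: grid_def)

lemma card_grid_le: "card (grid N) \<le> N"
  unfolding grid_def by (metis card_image_le card_lessThan finite_lessThan)

lemma grid_bounds: "\<theta> \<in> grid N \<Longrightarrow> 0 \<le> \<theta> \<and> \<theta> < 1"
  by (auto simp: grid_def)

lemma card_grid_interval_le:
  assumes "0 < N" "0 \<le> \<delta>" "S \<subseteq> grid N" "S \<subseteq> {x - \<delta>..x + \<delta>}"
  shows "real (card S) \<le> 2 * real N * \<delta> + 1"
proof -
  have "real (card S) \<le> (2 * \<delta>) / (1 / real N) + 1"
  proof (rule card_separated_le(2)[where l = "x - \<delta>"])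
    fix y z assume "y \<in> S" "z \<in> S" "y \<noteq> z"
    then have "y \<in> grid N" "z \<in> grid N" using assms(3) by auto
    then obtain i j where "y = real i / real N" "z = real j / real N" by (auto simp: grid_def)
    moreover from this have "i \<noteq> j" using \<open>y \<noteq> z\<close> by auto
    moreover from \<open>i \<noteq> j\<close> have "1 \<le> \<bar>real i - real j\<bar>" by linarith
    ultimately show "1 / real N \<le> \<bar>y - z\<bar>"
      using assms(1) by (simp add: diff_divide_distrib[symmetric] abs_divide divide_right_mono)
  qed (use assms in auto)
  then show ?thesis by (simp add: ac_simps)
qed

text \<open>Points of [0, 1) that agree with a fixed one modulo 1 up to \<delta> < 1/2 lie in
  windows around its translates by -1, 0 and 1. For larger \<delta> the size of the whole grid
  suffices.\<close>

lemma card_grid_clustered_le: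
  assumes "0 < N" "0 \<le> \<delta>" "T \<subseteq> grid N" "\<And>x y. x \<in> T \<Longrightarrow> y \<in> T \<Longrightarrow> near_int \<delta> (x - y)"
  shows "real (card T) \<le> 3 * (2 * real N * \<delta> + 1)"
proof (cases "T = {} \<or> 1/2 \<le> \<delta>")
  case True
  then show ?thesis
  proof
    assume "1/2 \<le> \<delta>"
    then have "real N * (1/2) \<le> real N * \<delta>" by (intro mult_left_mono) auto
    moreover have "card T \<le> N"
      using card_mono[OF finite_grid assms(3)] card_grid_le[of N] by linarith
    ultimately show ?thesis by simp
  qed (use assms in simp)
next
  case False
  then obtain x0 where x0: "x0 \<in> T" by blast
  define Tm where "Tm = (\<lambda>m::int. T \<inter> {x0 + of_int m - \<delta>..x0 + of_int m + \<delta>})"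
  have "T \<subseteq> Tm (-1) \<union> Tm 0 \<union> Tm 1"
  proof
    fix x assume x: "x \<in> T"
    then obtain m :: int where m: "\<bar>x - x0 - of_int m\<bar> \<le> \<delta>"
      using assms(4)[OF x x0] unfolding near_int_def by blast
    have "\<bar>x - x0\<bar> < 1" using grid_bounds[of x N] grid_bounds[of x0 N] x x0 assms(3) by force
    then have "\<bar>real_of_int m\<bar> < 2" using m False by linarith
    then have "m \<in> {-1, 0, 1}" by auto
    moreover have "x \<in> Tm m" using x m unfolding Tm_def by (auto simp: abs_le_iff)
    ultimately show "x \<in> Tm (-1) \<union> Tm 0 \<union> Tm 1" by auto
  qed
  moreover have fin: "finite (Tm m)" for m
    using finite_subset[OF assms(3) finite_grid] by (simp add: Tm_def)
  ultimately have "card T \<le> card (Tm (-1) \<union> Tm 0 \<union> Tm 1)" by (intro card_mono) auto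
  also have "\<dots> \<le> card (Tm (-1)) + card (Tm 0) + card (Tm 1)"
    by (meson add_mono card_Un_le le_trans order_refl)
  finally have "real (card T) \<le> real (card (Tm (-1))) + real (card (Tm 0)) + real (card (Tm 1))"
    by linarith
  moreover have "real (card (Tm m)) \<le> 2 * real N * \<delta> + 1" for m
    using assms by (intro card_grid_interval_le[of _ _ _ "x0 + of_int m"]) (auto simp: Tm_def)
  ultimately show ?thesis by (smt (verit))
qed

text \<open>Put d = gcd r q and e = q / d. Then d divides x, because p is prime to d, and for each x
  the value y is fixed modulo e. Both d and e are at most n, so each rounding term 1 costs at most a
  factor 2.\<close>

lemma card_linear_congruence_le:
  fixes p r :: int and q n :: nat
  assumes "coprime p r" "0 < q" "q \<le> n"
  shows "real (card {(x, y). x \<le> n \<and> y \<le> n \<and> int q dvd p * int x + r * int y})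
      \<le> 4 * (real n)\<^sup>2 / real q"
proof -
  define d where "d = nat (gcd r (int q))"
  have d: "int d = gcd r (int q)" "0 < d" using assms(2) by (auto simp: d_def)
  then have dq: "d dvd q" by (metis gcd_dvd2 of_nat_dvd_iff)
  then obtain e where e: "q = d * e" by (auto simp: dvd_def)
  have e0: "0 < e" using e assms(2) by (cases e) auto
  have dle: "d \<le> n" "e \<le> n" using e d e0 assms(3)
    by (metis le_trans mult_le_mono1 mult_1 Suc_leI One_nat_def mult.commute)+
  define XS where "XS = {x. x \<le> n \<and> d dvd x}"
  define YS where "YS = (\<lambda>x. {y. y \<le> n \<and> int q dvd p * int x + r * int y})"
  have cop: "coprime (int d) p"
  proof (rule coprimeI)
    fix c assume "c dvd int d" "c dvd p"
    then have "c dvd r" using d(1) by (metis dvd_trans gcd_dvd1)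
    then show "is_unit c" using \<open>c dvd p\<close> assms(1) coprime_common_divisor by blast
  qed
  have sub: "{(x, y). x \<le> n \<and> y \<le> n \<and> int q dvd p * int x + r * int y} \<subseteq> (SIGMA x:XS. YS x)"
  proof safe
    fix x y assume xy: "x \<le> n" "y \<le> n" "int q dvd p * int x + r * int y"
    have "int d dvd int q" "int d dvd r" using d(1) by auto
    then have "int d dvd p * int x" using xy(3) by (meson dvd_add_left_iff dvd_mult2 dvd_trans)
    then have "int d dvd int x" using cop by (simp add: coprime_dvd_mult_right_iff)
    then show "x \<in> XS" using xy by (simp add: XS_def)
    show "y \<in> YS x" using xy by (simp add: YS_def)
  qed
  have XS: "real (card XS) \<le> real n / real d + 1"
  proof (rule card_congruent_le[OF d(2)])
    fix x y assume "x \<in> XS" "y \<in> XS"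
    then show "int d dvd int x - int y" by (auto simp: XS_def intro!: dvd_diff)
  qed (auto simp: XS_def)
  have YS: "real (card (YS x)) \<le> real n / real e + 1" for x
  proof (rule card_congruent_le[OF e0])
    fix y z assume yz: "y \<in> YS x" "z \<in> YS x"
    then have "int q dvd (p * int x + r * int y) - (p * int x + r * int z)"
      unfolding YS_def by (intro dvd_diff) auto
    then have "int q dvd r * (int y - int z)" by (simp add: algebra_simps)
    moreover obtain r' where r': "r = int d * r'" using d(1) by (metis dvd_def gcd_dvd1)
    ultimately have "int d * int e dvd int d * (r' * (int y - int z))" using e by (simp add: mult.assoc)
    then have "int e dvd r' * (int y - int z)" using d(2) by simp
    moreover have "coprime (int e) r'"
    proof -
      have "gcd (int d * r') (int d * int e) = int d" using d(1) r' e by simp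
      then have "int d * gcd r' (int e) = int d * 1" by (simp add: gcd_mult_left)
      then show ?thesis using d(2) by (simp add: coprime_iff_gcd_eq_1 gcd.commute)
    qed
    ultimately show "int e dvd int y - int z" by (simp add: coprime_dvd_mult_right_iff)
  qed (auto simp: YS_def)
  have finX: "finite XS" and finY: "finite (YS x)" for x by (auto simp: XS_def YS_def)
  have "card {(x, y). x \<le> n \<and> y \<le> n \<and> int q dvd p * int x + r * int y} \<le> card (SIGMA x:XS. YS x)"
    using sub finX finY by (intro card_mono) auto
  also have "\<dots> = (\<Sum>x\<in>XS. card (YS x))" using finX finY by simp
  finally have "real (card {(x, y). x \<le> n \<and> y \<le> n \<and> int q dvd p * int x + r * int y})
      \<le> (\<Sum>x\<in>XS. real (card (YS x)))" unfolding of_nat_sum[symmetric] of_nat_le_iff .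
  also have "\<dots> \<le> (\<Sum>x\<in>XS. real n / real e + 1)" by (intro sum_mono YS)
  also have "\<dots> = real (card XS) * (real n / real e + 1)" by simp
  also have "\<dots> \<le> (real n / real d + 1) * (real n / real e + 1)"
    using XS by (intro mult_right_mono) auto
  also have "\<dots> \<le> (2 * (real n / real d)) * (2 * (real n / real e))"
    using dle d(2) e0 by (intro mult_mono) (auto simp: field_simps)
  also have "\<dots> = 4 * (real n)\<^sup>2 / real q" by (simp add: e power2_eq_square)
  finally show ?thesis .
qed

text \<open>The D are cut into blocks of length q. Inside a block \<theta> D equals a fixed shift
  plus a t / q up to 1 / q, with t the residue of D. As a is prime to q, the fractions a t / q are
  distinct modulo 1 and spaced by 1 / q, so about 2 \<epsilon> q of them can lie near an
  integer.\<close>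

lemma card_near_int_multiples_le:
  fixes a q :: int and \<theta> \<epsilon> Y :: real
  assumes "coprime a q" "0 < q" "\<bar>\<theta> - a / q\<bar> \<le> 1 / (real_of_int q)\<^sup>2" "0 \<le> \<epsilon>" "0 \<le> Y"
  shows "real (card {D::int. \<bar>real_of_int D\<bar> \<le> Y \<and> near_int \<epsilon> (\<theta> * D)})
     \<le> (2 * Y / q + 2) * (2 * \<epsilon> * q + 3)"
proof -
  define S where "S = {D::int. \<bar>real_of_int D\<bar> \<le> Y \<and> near_int \<epsilon> (\<theta> * D)}"
  define blocks where "blocks = {\<lfloor>- Y / q\<rfloor>..\<lfloor>Y / q\<rfloor>}"
  define Sb where "Sb = (\<lambda>b. {D \<in> S. D div q = b})"
  have finS: "finite S"
  proof (rule finite_subset)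
    show "S \<subseteq> {-\<lceil>Y\<rceil>..\<lceil>Y\<rceil>}" unfolding S_def by (auto simp: abs_le_iff) linarith+
  qed simp
  have div_floor: "D div q = \<lfloor>real_of_int D / real_of_int q\<rfloor>" for D by (simp add: floor_divide_of_int_eq)
  have "S \<subseteq> (\<Union>b\<in>blocks. Sb b)"
  proof
    fix D assume D: "D \<in> S"
    then have "- Y \<le> D" "D \<le> Y" by (auto simp: S_def abs_le_iff)
    then have "- Y / q \<le> real_of_int D / q" "real_of_int D / q \<le> Y / q"
      using assms(2) by (intro divide_right_mono; simp)+
    then have "D div q \<in> blocks" unfolding blocks_def div_floor by (auto intro: floor_mono)
    then show "D \<in> (\<Union>b\<in>blocks. Sb b)" using D by (auto simp: Sb_def)
  qed
  then have "card S \<le> card (\<Union>b\<in>blocks. Sb b)"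
    using finS by (intro card_mono) (auto simp: Sb_def blocks_def)
  also have "\<dots> \<le> (\<Sum>b\<in>blocks. card (Sb b))" by (rule card_UN_le) (simp add: blocks_def)
  finally have "real (card S) \<le> (\<Sum>b\<in>blocks. real (card (Sb b)))"
    unfolding of_nat_sum[symmetric] of_nat_le_iff .
  also have "\<dots> \<le> (\<Sum>b\<in>blocks. 2 * \<epsilon> * q + 3)"
  proof (rule sum_mono)
    fix b
    define m where "m = (\<lambda>D. SOME m::int. \<bar>\<theta> * real_of_int D - of_int m\<bar> \<le> \<epsilon>)"
    have m: "\<bar>\<theta> * real_of_int D - of_int (m D)\<bar> \<le> \<epsilon>" if "D \<in> S" for D
      using that unfolding S_def near_int_def m_def by (auto intro: someI_ex)
    \<comment> \<open>Scaling \<theta> D by q and replacing \<theta> t by a t / q yields an integer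
      within \<open>\<epsilon> * q + 1\<close> of a point depending on the block alone; modulo q it
      recovers \<open>D mod q\<close>.\<close>
    define i where "i = (\<lambda>D. real_of_int (m D * q - (D mod q) * a))"
    have "real (card (i ` Sb b)) \<le> 2 * (\<epsilon> * q + 1) / 1 + 1"
    proof (rule card_separated_le(2)[where l = "\<theta> * (b * q) * q - (\<epsilon> * q + 1)"])
      show "i ` Sb b \<subseteq> {\<theta> * (b * q) * q - (\<epsilon> * q + 1)..\<theta> * (b * q) * q - (\<epsilon> * q + 1) + 2 * (\<epsilon> * q + 1)}"
      proof (rule image_subsetI)
        fix D assume D: "D \<in> Sb b"
        define t where "t = D mod q"
        have t: "0 \<le> t" "t < q" "D = b * q + t" using D assms(2) unfolding t_def Sb_def by auto
        have DS: "D \<in> S" using D by (simp add: Sb_def)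
        have eq: "i D - \<theta> * (b * q) * q = - (q * (\<theta> * D - m D)) + q * (t * (\<theta> - a / q))"
        proof -
          have "real_of_int D = b * q + t" using t(3) by simp
          moreover have "i D = m D * q - t * a" by (simp add: i_def t_def)
          moreover have "q * (t * (\<theta> - a / q)) = t * \<theta> * q - t * a"
            using assms(2) by (simp add: field_simps)
          ultimately show ?thesis by (simp add: algebra_simps)
        qed
        have "\<bar>q * (\<theta> * D - m D)\<bar> \<le> q * \<epsilon>"
          using m[OF DS] assms(2) by (simp add: abs_mult)
        moreover have "\<bar>q * (t * (\<theta> - a / q))\<bar> \<le> 1"
        proof -
          have "\<bar>q * (t * (\<theta> - a / q))\<bar> = q * (t * \<bar>\<theta> - a / q\<bar>)"
            using assms(2) t by (simp add: abs_mult)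
          also have "\<dots> \<le> q * (q * (1 / (real_of_int q)\<^sup>2))"
            using assms t by (intro mult_left_mono mult_mono) auto
          also have "\<dots> = 1" using assms(2) by (simp add: power2_eq_square)
          finally show ?thesis .
        qed
        ultimately have "\<bar>i D - \<theta> * (b * q) * q\<bar> \<le> \<epsilon> * q + 1" unfolding eq by (simp add: mult.commute)
        then show "i D \<in> {\<theta> * (b * q) * q - (\<epsilon> * q + 1)..\<theta> * (b * q) * q - (\<epsilon> * q + 1) + 2 * (\<epsilon> * q + 1)}"
          by (auto simp: abs_le_iff)
      qed
      fix x y assume "x \<in> i ` Sb b" "y \<in> i ` Sb b" "x \<noteq> y"
      then obtain j j' :: int where "x = of_int j" "y = of_int j'" unfolding i_def by blast
      then show "1 \<le> \<bar>x - y\<bar>" using \<open>x \<noteq> y\<close> by simp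
    qed (use assms in auto)
    moreover have "inj_on i (Sb b)"
    proof (rule inj_onI)
      fix D D' assume D: "D \<in> Sb b" "D' \<in> Sb b" "i D = i D'"
      then have "m D * q - (D mod q) * a = m D' * q - (D' mod q) * a"
        unfolding i_def by (simp only: of_int_eq_iff)
      then have "(D mod q - D' mod q) * a = (m D - m D') * q" by (simp add: algebra_simps)
      then have "q dvd (D mod q - D' mod q) * a" by simp
      then have "q dvd D mod q - D' mod q" using assms(1) by (simp add: coprime_dvd_mult_left_iff coprime_commute)
      moreover have "\<bar>D mod q - D' mod q\<bar> < q"
        using assms(2) pos_mod_bound[of q D] pos_mod_bound[of q D'] pos_mod_sign[of q D] pos_mod_sign[of q D'] by linarith
      ultimately have "D mod q = D' mod q" using dvd_imp_le_int[of "D mod q - D' mod q" q] assms(2) by force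
      moreover have "D div q = D' div q" using D by (simp add: Sb_def)
      ultimately show "D = D'" by (metis div_mult_mod_eq)
    qed
    ultimately show "real (card (Sb b)) \<le> 2 * \<epsilon> * q + 3" by (simp add: card_image)
  qed
  also have "\<dots> = real (card blocks) * (2 * \<epsilon> * q + 3)" by simp
  also have "\<dots> \<le> (2 * Y / q + 2) * (2 * \<epsilon> * q + 3)"
  proof (rule mult_right_mono)
    have "0 \<le> Y / q" using assms by simp
    then have "real (card blocks) = real_of_int (\<lfloor>Y / q\<rfloor> - \<lfloor>- Y / q\<rfloor> + 1)" unfolding blocks_def by simp linarith
    also have "\<dots> \<le> 2 * Y / q + 2" by simp linarith
    finally show "real (card blocks) \<le> 2 * Y / q + 2" .
  qed (use assms in auto)
  finally show ?thesis unfolding S_def .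
qed

section \<open>Rigidity of approximate coincidences between primitive vectors\<close>

lemma coprime_dvd_both:
  fixes q m x y :: int
  assumes "coprime x y" "q dvd m * x" "q dvd m * y"
  shows "q dvd m"
proof -
  have "q dvd gcd (m * x) (m * y)" using assms by simp
  also have "gcd (m * x) (m * y) = \<bar>m\<bar> * gcd x y" by (simp add: gcd_mult_distrib_int)
  also have "gcd x y = 1" using assms(1) by simp
  finally show ?thesis by simp
qed

text \<open>Taking the determinant against (x', y') removes the terms with a', and the unit a can be
  cancelled modulo q.\<close>

lemma cross_dvd:
  fixes x y x' y' a a' n1 n2 q :: int
  assumes "coprime a q" "a * x - a' * x' = n1 * q" "a * y - a' * y' = n2 * q"
  shows "q dvd x * y' - y * x'"
proof -
  have "a * (x * y' - y * x') = (a * x) * y' - (a * y) * x'" by (simp add: algebra_simps)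
  also have "a * x = a' * x' + n1 * q" using assms by simp
  also have "a * y = a' * y' + n2 * q" using assms by simp
  also have "(a' * x' + n1 * q) * y' - (a' * y' + n2 * q) * x' = (n1 * y' - n2 * x') * q"
    by (simp add: algebra_simps)
  finally have "q dvd a * (x * y' - y * x')" by simp
  then show ?thesis using assms(1) by (simp add: coprime_dvd_mult_right_iff coprime_commute)
qed

text \<open>Over the common denominator q q' the rational part of each coordinate, minus the nearby
  integer, is a multiple of 1 / (q q') of smaller modulus, hence 0. The perturbations alone must
  then meet the tolerance, and primitivity of both vectors makes q and q' divide each other.\<close>

lemma near_vec_exact:
  fixes a a' q q' :: int and \<kappa> \<beta> \<beta>' b Y :: real
  assumes near: "near_vec \<kappa> (a / q + \<beta>) w (a' / q' + \<beta>') w'"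
    and cop: "coprime a q" "coprime a' q'" "0 < q" "0 < q'"
    and \<beta>: "\<bar>\<beta>\<bar> \<le> b" "\<bar>\<beta>'\<bar> \<le> b" and pos: "0 \<notin> set w" "0 \<notin> set w'"
    and Y: "real (cont w) \<le> Y" "real (cont w') \<le> Y"
    and small: "\<kappa> + 2 * b * Y < 1 / (real_of_int q * real_of_int q')"
  shows "q = q' \<and> (\<exists>n1 n2. a * int (cont w) - a' * int (cont w') = n1 * q \<and>
           a * int (cont_tl w) - a' * int (cont_tl w') = n2 * q) \<and>
         \<bar>\<beta> * cont w - \<beta>' * cont w'\<bar> \<le> \<kappa> \<and> \<bar>\<beta> * cont_tl w - \<beta>' * cont_tl w'\<bar> \<le> \<kappa>"
proof -
  have exact: "\<exists>n::int. a * int u * q' - a' * int u' * q = n * (q * q') \<and> \<bar>\<beta> * u - \<beta>' * u'\<bar> \<le> \<kappa>"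
    if uY: "near_int \<kappa> ((a / q + \<beta>) * real u - (a' / q' + \<beta>') * real u')" "real u \<le> Y" "real u' \<le> Y" for u u'
  proof -
    obtain n :: int where n: "\<bar>(a / q + \<beta>) * real u - (a' / q' + \<beta>') * real u' - n\<bar> \<le> \<kappa>"
      using uY unfolding near_int_def by blast
    define z where "z = a * int u * q' - a' * int u' * q - n * (q * q')"
    have eq: "(a / q + \<beta>) * real u - (a' / q' + \<beta>') * real u' - n
        = z / (q * q') + (\<beta> * u - \<beta>' * u')"
      using cop by (simp add: z_def field_simps)
    have b: "\<bar>\<beta> * u\<bar> \<le> b * Y" "\<bar>\<beta>' * u'\<bar> \<le> b * Y"
      using \<beta> uY by (auto simp: abs_mult intro!: mult_mono)
    have "\<bar>real_of_int z / (q * q')\<bar> < 1 / (real_of_int q * real_of_int q')"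
      using n b small unfolding eq by linarith
    then have "\<bar>real_of_int z\<bar> < 1"
      using cop by (simp add: abs_mult field_simps)
    then have "z = 0" by linarith
    then show ?thesis using n unfolding eq z_def by (intro exI[of _ n]) simp
  qed
  have Y2: "real (cont_tl w) \<le> Y" "real (cont_tl w') \<le> Y"
    using Y cont_tl_le pos by (meson of_nat_le_iff order_trans)+
  obtain n1 n2 :: int where n:
    "a * int (cont w) * q' - a' * int (cont w') * q = n1 * (q * q')" "\<bar>\<beta> * cont w - \<beta>' * cont w'\<bar> \<le> \<kappa>"
    "a * int (cont_tl w) * q' - a' * int (cont_tl w') * q = n2 * (q * q')" "\<bar>\<beta> * cont_tl w - \<beta>' * cont_tl w'\<bar> \<le> \<kappa>"
    using exact[of "cont w" "cont w'"] exact[of "cont_tl w" "cont_tl w'"] near Y Y2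
    unfolding near_vec_def by blast
  have copv: "coprime (int (cont u)) (int (cont_tl u))" for u using coprime_cont by simp
  have "q dvd q' * a"
  proof (rule coprime_dvd_both[OF copv[of w]])
    have "q' * a * int (cont w) = q * (a' * int (cont w') + n1 * q')" using n(1) by (simp add: algebra_simps)
    then show "q dvd q' * a * int (cont w)" by simp
    have "q' * a * int (cont_tl w) = q * (a' * int (cont_tl w') + n2 * q')" using n(3) by (simp add: algebra_simps)
    then show "q dvd q' * a * int (cont_tl w)" by simp
  qed
  then have "q dvd q'" using cop(1) by (simp add: coprime_dvd_mult_left_iff coprime_commute)
  moreover have "q' dvd q * a'"
  proof (rule coprime_dvd_both[OF copv[of w']])
    have "q * a' * int (cont w') = q' * (a * int (cont w) - n1 * q)" using n(1) by (simp add: algebra_simps)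
    then show "q' dvd q * a' * int (cont w')" by simp
    have "q * a' * int (cont_tl w') = q' * (a * int (cont_tl w) - n2 * q)" using n(3) by (simp add: algebra_simps)
    then show "q' dvd q * a' * int (cont_tl w')" by simp
  qed
  then have "q' dvd q" using cop(2) by (simp add: coprime_dvd_mult_left_iff coprime_commute)
  ultimately have qq: "q = q'" using cop zdvd_antisym_nonneg[of q q'] by simp
  have "(a * int (cont w) - a' * int (cont w')) * q = (n1 * q) * q"
    "(a * int (cont_tl w) - a' * int (cont_tl w')) * q = (n2 * q) * q"
    using n(1,3) qq by (simp_all add: algebra_simps)
  then have "a * int (cont w) - a' * int (cont w') = n1 * q"
    "a * int (cont_tl w) - a' * int (cont_tl w') = n2 * q" using cop(3) by simp_all
  then show ?thesis using qq n(2,4) by blast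
qed

text \<open>The difference \<tau> of the two frequencies carries the primitive vector of w' to
  within \<open>2 * \<kappa>\<close> of an integer vector. The determinant of these two integer
  vectors is below 1 in modulus, so they are proportional, and \<tau> itself is near an
  integer.\<close>

lemma near_vec_difference:
  assumes "near_vec \<kappa> \<theta> w \<theta>' w'" "near_vec \<kappa> \<theta> w \<theta>'' w'" "0 \<notin> set w'" "8 * \<kappa> * real (cont w') < 1"
  shows "near_int (2 * \<kappa> / real (cont w')) (\<theta>' - \<theta>'')"
proof -
  define \<tau> where "\<tau> = \<theta>' - \<theta>''"
  let ?v1 = "cont w'" and ?v2 = "cont_tl w'"
  have diff: "near_int (2 * \<kappa>) (\<tau> * u)"
    if xu: "near_int \<kappa> (x - \<theta>' * u)" "near_int \<kappa> (x - \<theta>'' * u)" for x u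
  proof -
    obtain m m' :: int where "\<bar>x - \<theta>' * u - m\<bar> \<le> \<kappa>" "\<bar>x - \<theta>'' * u - m'\<bar> \<le> \<kappa>"
      using xu unfolding near_int_def by blast
    then have "\<bar>\<tau> * u - of_int (m' - m)\<bar> \<le> 2 * \<kappa>" unfolding \<tau>_def by (simp add: algebra_simps)
    then show ?thesis unfolding near_int_def by blast
  qed
  obtain m1 m2 :: int where m: "\<bar>\<tau> * ?v1 - m1\<bar> \<le> 2 * \<kappa>" "\<bar>\<tau> * ?v2 - m2\<bar> \<le> 2 * \<kappa>"
    using diff[of "\<theta> * cont w" ?v1] diff[of "\<theta> * cont_tl w" ?v2] assms(1,2)
    unfolding near_vec_def near_int_def by blast
  have v: "0 < ?v1" "?v2 \<le> ?v1" using cont_pos cont_tl_le assms by auto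
  have \<kappa>0: "0 \<le> \<kappa>" using m(1) by linarith
  have "real_of_int (m1 * ?v2 - m2 * ?v1) = ?v1 * (\<tau> * ?v2 - m2) - ?v2 * (\<tau> * ?v1 - m1)"
    by (simp add: algebra_simps)
  also have "\<bar>\<dots>\<bar> \<le> \<bar>?v1 * (\<tau> * ?v2 - m2)\<bar> + \<bar>?v2 * (\<tau> * ?v1 - m1)\<bar>" by (rule abs_triangle_ineq4)
  also have "\<dots> \<le> ?v1 * (2 * \<kappa>) + ?v1 * (2 * \<kappa>)"
    using m v by (intro add_mono) (auto simp: abs_mult intro!: mult_mono)
  also have "\<dots> < 1" using assms(4) \<kappa>0 v by (simp add: algebra_simps) 
  finally have "\<bar>real_of_int (m1 * ?v2 - m2 * ?v1)\<bar> < 1" by simp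
  then have "m1 * int ?v2 = m2 * int ?v1" by linarith
  then have "int ?v1 dvd m1 * int ?v2" by simp
  then have "int ?v1 dvd m1" using coprime_cont[of w']
    by (simp add: coprime_dvd_mult_left_iff)
  then obtain m where "m1 = int ?v1 * m" by (auto simp: dvd_def)
  then have "\<bar>?v1 * (\<tau> - m)\<bar> \<le> 2 * \<kappa>" using m(1) by (simp add: algebra_simps)
  then have "\<bar>\<tau> - m\<bar> \<le> 2 * \<kappa> / ?v1" using v by (simp add: abs_mult pos_le_divide_eq mult.commute)
  then show ?thesis unfolding near_int_def \<tau>_def by blast
qed

section \<open>Words with a prescribed direction or determinant\<close>

context alphabet
begin

text \<open>Distinct fractions with denominators at most D are at least \<open>1 / D\<^sup>2\<close>
  apart, and a reduced fraction comes from at most two words.\<close>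

lemma card_words_near_le:
  assumes "1 \<le> D" "0 \<le> \<rho>"
  shows "real (card {w \<in> words_upto D. \<bar>cfrac w - x\<bar> \<le> \<rho>}) \<le> 2 * (2 * \<rho> * D\<^sup>2 + 1)"
proof -
  let ?S = "{w \<in> words_upto D. \<bar>cfrac w - x\<bar> \<le> \<rho>}"
  have fin: "finite ?S" using finite_words_upto by simp
  have l: "w \<in> lists A" "0 \<notin> set w" "real (cont w) \<le> D" "0 < cont w" if "w \<in> ?S" for w
    using that pos_word cont_pos by (auto simp: words_upto_def)
  have det: "cont_tl w * cont w' = cont_tl w' * cont w \<Longrightarrow> cont w = cont w' \<and> cont_tl w = cont_tl w'"
    if "w \<in> ?S" "w' \<in> ?S" for w w'
  proof -
    assume eq: "cont_tl w * cont w' = cont_tl w' * cont w"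
    have "cont w dvd cont_tl w * cont w'" unfolding eq by simp
    then have "cont w dvd cont w'"
      using coprime_cont[of w] by (simp add: coprime_dvd_mult_right_iff)
    moreover have "cont w' dvd cont_tl w' * cont w" unfolding eq[symmetric] by simp
    then have "cont w' dvd cont w"
      using coprime_cont[of w'] by (simp add: coprime_dvd_mult_right_iff)
    ultimately have "cont w = cont w'" by (rule dvd_antisym)
    then show ?thesis using eq l[OF that(1)] by simp
  qed
  have "card ?S \<le> 2 * card ((\<lambda>w. (cont w, cont_tl w)) ` ?S)"
    using fin l by (intro card_words_le_vectors) auto
  also have "card ((\<lambda>w. (cont w, cont_tl w)) ` ?S) = card (cfrac ` ?S)"
  proof -
    have "inj_on (\<lambda>(k, t). real t / real k) ((\<lambda>w. (cont w, cont_tl w)) ` ?S)"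
    proof (rule inj_onI, clarify)
      fix w w' assume w: "w \<in> words_upto D" "\<bar>cfrac w - x\<bar> \<le> \<rho>" "w' \<in> words_upto D" "\<bar>cfrac w' - x\<bar> \<le> \<rho>"
        and eq: "real (cont_tl w) / real (cont w) = real (cont_tl w') / real (cont w')"
      have "real (cont_tl w) * real (cont w') = real (cont_tl w') * real (cont w)"
        using eq l[of w] l[of w'] w by (simp add: frac_eq_eq)
      then have "cont_tl w * cont w' = cont_tl w' * cont w"
        unfolding of_nat_mult[symmetric] of_nat_eq_iff .
      then show "cont w = cont w' \<and> cont_tl w = cont_tl w'" using det w by simp
    qed
    then have "card ((\<lambda>w. (cont w, cont_tl w)) ` ?S)
       = card ((\<lambda>(k, t). real t / real k) ` (\<lambda>w. (cont w, cont_tl w)) ` ?S)" by (simp add: card_image)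
    also have "(\<lambda>(k, t). real t / real k) ` (\<lambda>w. (cont w, cont_tl w)) ` ?S = cfrac ` ?S"
      unfolding image_image
    proof (rule image_cong[OF refl])
      fix w assume "w \<in> ?S"
      from cfrac_eq_cont[OF l(2)[OF this]]
      show "(case (cont w, cont_tl w) of (k, t) \<Rightarrow> real t / real k) = cfrac w" by simp
    qed
    finally show ?thesis .
  qed
  finally have "real (card ?S) \<le> 2 * real (card (cfrac ` ?S))" by linarith
  moreover have "real (card (cfrac ` ?S)) \<le> 2 * \<rho> / (1 / D\<^sup>2) + 1"
  proof (rule card_separated_le(2)[where l = "x - \<rho>"])
    fix y z assume "y \<in> cfrac ` ?S" "z \<in> cfrac ` ?S" "y \<noteq> z"
    then obtain w w' where w: "w \<in> ?S" "w' \<in> ?S" "y = cfrac w" "z = cfrac w'" by blast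
    have p: "0 < cont w" "0 < cont w'" "real (cont w) \<le> D" "real (cont w') \<le> D" using l w by auto
    have yz: "y - z = (real (cont_tl w) * cont w' - real (cont_tl w') * cont w) / (real (cont w) * cont w')"
      unfolding w(3,4) cfrac_eq_cont[OF l(2)[OF w(1)]] cfrac_eq_cont[OF l(2)[OF w(2)]]
      using p(1,2) by (simp add: field_simps)
    then have "real (cont_tl w) * cont w' - real (cont_tl w') * cont w \<noteq> 0" using \<open>y \<noteq> z\<close> by auto
    then have "real (cont_tl w * cont w') \<noteq> real (cont_tl w' * cont w)" by simp
    then have "cont_tl w * cont w' \<noteq> cont_tl w' * cont w" by (simp only: of_nat_eq_iff not_False_eq_True)
    then have "1 \<le> \<bar>int (cont_tl w * cont w') - int (cont_tl w' * cont w)\<bar>" by linarith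
    then have "1 \<le> \<bar>real (cont_tl w * cont w') - real (cont_tl w' * cont w)\<bar>" by linarith
    then have "1 \<le> \<bar>real (cont_tl w) * cont w' - real (cont_tl w') * cont w\<bar>" by simp
    moreover have "real (cont w) * cont w' \<le> D\<^sup>2" unfolding power2_eq_square
      using p assms by (intro mult_mono) auto
    ultimately have "1 / D\<^sup>2 \<le> \<bar>real (cont_tl w) * cont w' - real (cont_tl w') * cont w\<bar> / (real (cont w) * cont w')"
      using p assms by (intro frac_le) auto
    then show "1 / D\<^sup>2 \<le> \<bar>y - z\<bar>" unfolding yz by (simp add: abs_mult)
  qed (use assms in \<open>auto simp: abs_le_iff\<close>)
  ultimately show ?thesis by simp
qed

text \<open>The equation fixes \<open>cont w\<close> modulo v1, since v2 is invertible there, and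
  \<open>cont w\<close> fixes \<open>cont_tl w\<close>. Continuants up to 2 v1 leave 3 values,
  doubled by parity.\<close>

lemma card_words_cross_le:
  fixes v1 v2 :: nat
  assumes "0 < v1" "coprime v1 v2" "Y \<le> 2 * real v1"
  shows "real (card {w \<in> words_upto Y. int v1 * int (cont_tl w) - int v2 * int (cont w) = D}) \<le> 6"
proof -
  let ?S = "{w \<in> words_upto Y. int v1 * int (cont_tl w) - int v2 * int (cont w) = D}"
  have fin: "finite ?S" using finite_words_upto by simp
  have "card ?S \<le> 2 * card ((\<lambda>w. (cont w, cont_tl w)) ` ?S)"
    using fin pos_word by (intro card_words_le_vectors) (auto simp: words_upto_def)
  also have "card ((\<lambda>w. (cont w, cont_tl w)) ` ?S) = card (cont ` ?S)"
  proof -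
    have "inj_on fst ((\<lambda>w. (cont w, cont_tl w)) ` ?S)"
    proof (rule inj_onI, clarify)
      fix w w' assume "int v1 * int (cont_tl w') - int v2 * int (cont w') =
          int v1 * int (cont_tl w) - int v2 * int (cont w)" "fst (cont w, cont_tl w) = fst (cont w', cont_tl w')"
      then show "cont w = cont w' \<and> cont_tl w = cont_tl w'" using assms by simp
    qed
    then have "card ((\<lambda>w. (cont w, cont_tl w)) ` ?S) = card (fst ` (\<lambda>w. (cont w, cont_tl w)) ` ?S)"
      by (simp add: card_image)
    then show ?thesis by (simp add: image_image)
  qed
  finally have "real (card ?S) \<le> 2 * real (card (cont ` ?S))" by linarith
  moreover have "real (card (cont ` ?S)) \<le> real (2 * v1) / real v1 + 1"
  proof (rule card_congruent_le[OF assms(1)])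
    show "cont ` ?S \<subseteq> {..2 * v1}"
    proof (rule image_subsetI)
      fix w assume "w \<in> ?S"
      then have "real (cont w) \<le> real (2 * v1)" using assms(3) by (simp add: words_upto_def)
      then show "cont w \<in> {..2 * v1}" by (simp only: of_nat_le_iff atMost_iff)
    qed
    fix x y assume "x \<in> cont ` ?S" "y \<in> cont ` ?S"
    then obtain w w' where w: "x = cont w" "y = cont w'"
      "int v1 * int (cont_tl w) - int v2 * int (cont w) = int v1 * int (cont_tl w') - int v2 * int (cont w')"
      by auto
    then have "int v2 * (int x - int y) = int v1 * (int (cont_tl w) - int (cont_tl w'))"
      by (simp add: algebra_simps)
    then have "int v1 dvd int v2 * (int x - int y)" by simp
    then show "int v1 dvd int x - int y" using assms(2) by (simp add: coprime_dvd_mult_right_iff)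
  qed
  ultimately show ?thesis using assms(1) by simp
qed

end

subsection \<open>Counting pairs of words on a given major_arc\<close>

context alphabet
begin

text \<open>A word is cut into a prefix of size G, a free middle part and a suffix of size Q.
  Fractions of denominator about G near a given direction number O(1 + G^2 \<alpha>), and a linear
  congruence modulo q leaves O(Q^2 / q) = O(Q) suffixes. The lower bound on X keeps prefix and
  suffix from overlapping.\<close>

lemma card_words_class_le:
  "\<exists>C>0. \<forall>v1 v2 q (Q::real) (G::real) (X::real) (\<alpha>::real). 0 < v1 \<longrightarrow> coprime v1 v2 \<longrightarrow> 1 \<le> Q \<longrightarrow> 1 \<le> G \<longrightarrow> Q / 2 \<le> real q \<longrightarrow>
     real q \<le> Q \<longrightarrow> 0 \<le> \<alpha> \<longrightarrow> 2 * (amax + 1) * G * Q \<le> X \<longrightarrow>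
     real (card {w \<in> lists A. X \<le> real (cont w) \<and> real (cont w) \<le> 2 * X \<and>
        int q dvd int v1 * int (cont_tl w) - int v2 * int (cont w) \<and>
        \<bar>cfrac w - real v2 / real v1\<bar> \<le> \<alpha>})
      \<le> C * (1 + G\<^sup>2 * \<alpha>) * word_count (2 * X / (G * Q)) * Q"
proof -
  define b where "b = amax + 1"
  have b: "2 \<le> b" using amax_ge_1 by (simp add: b_def)
  define C1 where "C1 = 4 * b\<^sup>2 + 2"
  define C where "C = C1 * (16 * b\<^sup>2)"
  have C1: "0 < C1" using b by (simp add: C1_def add_nonneg_pos)
  have "0 < C" using C1 b by (simp add: C_def)
  moreover have "real (card {w \<in> lists A. X \<le> real (cont w) \<and> real (cont w) \<le> 2 * X \<and>
        int q dvd int v1 * int (cont_tl w) - int v2 * int (cont w) \<and>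
        \<bar>cfrac w - real v2 / real v1\<bar> \<le> \<alpha>})
      \<le> C * (1 + G\<^sup>2 * \<alpha>) * word_count (2 * X / (G * Q)) * Q"
    if v: "0 < v1" "coprime v1 v2" and Q: "1 \<le> Q" and G: "1 \<le> G" and q: "Q / 2 \<le> real q" "real q \<le> Q"
      and \<alpha>: "0 \<le> \<alpha>" and X: "2 * (amax + 1) * G * Q \<le> X" for v1 v2 q Q G X \<alpha>
  proof -
    let ?S = "{w \<in> lists A. X \<le> real (cont w) \<and> real (cont w) \<le> 2 * X \<and>
        int q dvd int v1 * int (cont_tl w) - int v2 * int (cont w) \<and>
        \<bar>cfrac w - real v2 / real v1\<bar> \<le> \<alpha>}"
    have q0: "0 < q" using q Q by (cases q) auto
    define \<Gamma> where "\<Gamma> = {w \<in> words_upto (b * G). \<bar>cfrac w - real v2 / real v1\<bar> \<le> \<alpha> + 1 / G\<^sup>2}"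
    define \<Delta> where "\<Delta> = words_upto (2 * X / (G * Q))"
    define n where "n = nat \<lfloor>b * Q\<rfloor>"
    define Z where "Z = (\<lambda>\<gamma>. {z \<in> lists A. cont z \<le> n \<and>
       int q dvd int v1 * int (cont_tl (\<gamma> @ z)) - int v2 * int (cont (\<gamma> @ z))})"
    have nb: "real n \<le> b * Q" unfolding n_def using b Q by (intro of_nat_floor) auto
    have "1 * Q \<le> b * Q" using b Q by (intro mult_right_mono) auto
    then have qn: "q \<le> n" unfolding n_def using q by (intro le_nat_floor) auto
    have Zsub: "Z \<gamma> \<subseteq> words_upto (b * Q)" for \<gamma>
      using nb unfolding Z_def words_upto_def by (auto intro: order_trans[rotated])
    have finZ: "finite (Z \<gamma>)" for \<gamma> using Zsub finite_words_upto finite_subset by blast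
    have sub: "?S \<subseteq> (\<Union>\<gamma>1\<in>\<Gamma>. \<Union>\<gamma>2\<in>\<Delta>. (\<lambda>z. \<gamma>1 @ \<gamma>2 @ z) ` Z (\<gamma>1 @ \<gamma>2))"
    proof
      fix w assume w: "w \<in> ?S"
      have GQ: "1 * 1 \<le> G * Q" using G Q by (intro mult_mono) auto
      have bGQ: "b * (G * Q) * 2 \<le> X" using X by (simp add: b_def algebra_simps)
      have "G * 1 \<le> G * Q" using G Q by (intro mult_left_mono) auto
      moreover have "1 * (G * Q) \<le> b * (G * Q)" using b GQ by (intro mult_right_mono) auto
      ultimately have "G \<le> X" using bGQ GQ by linarith
      then obtain \<gamma>1 y where y: "w = \<gamma>1 @ y" "\<gamma>1 \<in> stop_words G" "y \<in> lists A"
        using stop_prefix_exists[of w G] w by auto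
      have l1: "\<gamma>1 \<in> lists A" and G1: "G \<le> cont \<gamma>1" using y by (auto simp: stop_words_def)
      have G2: "real (cont \<gamma>1) \<le> b * G" using stop_words_le[OF y(2) G] by (simp add: b_def)
      have p1: "0 \<notin> set \<gamma>1" "0 \<notin> set y" using pos_word l1 y by auto
      have "X \<le> real (cont w)" using w by simp
      also have "real (cont w) \<le> real (2 * (cont \<gamma>1 * cont y))"
        unfolding y(1) of_nat_le_iff by (rule cont_append_bounds(2)[OF p1])
      also have "\<dots> = 2 * (real (cont \<gamma>1) * real (cont y))" by simp
      also have "\<dots> \<le> 2 * ((b * G) * real (cont y))" using G2 by (intro mult_left_mono mult_right_mono) auto
      finally have "b * G * Q \<le> b * G * cont y" using bGQ by (simp add: algebra_simps)
      then have "Q \<le> cont y" using b G by simp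
      then obtain \<gamma>2 z where z: "y = \<gamma>2 @ z" "\<gamma>2 \<in> lists A" "z \<in> lists A" "Q \<le> cont z" "cont z \<le> b * Q"
        using stop_suffix_exists[OF y(3) _ Q] by (auto simp: b_def)
      have p2: "0 \<notin> set \<gamma>2" "0 \<notin> set z" using pos_word z by auto
      have "real (cont \<gamma>1 * (cont \<gamma>2 * cont z)) \<le> real (cont w)"
        unfolding y(1) z(1) of_nat_le_iff
        using cont_append_bounds(1)[OF p1] cont_append_bounds(1)[OF p2] z(1)
        by (meson mult_le_mono2 order_trans)
      then have "real (cont \<gamma>1) * (real (cont \<gamma>2) * real (cont z)) \<le> 2 * X" using w by simp
      moreover have "G * (real (cont \<gamma>2) * Q) \<le> real (cont \<gamma>1) * (real (cont \<gamma>2) * real (cont z))"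
        using G1 z(4) G Q by (intro mult_mono mult_left_mono) auto
      ultimately have "real (cont \<gamma>2) * (G * Q) \<le> 2 * X" by (simp add: algebra_simps)
      then have "real (cont \<gamma>2) \<le> 2 * X / (G * Q)" using GQ by (simp add: pos_le_divide_eq)
      then have \<gamma>2: "\<gamma>2 \<in> \<Delta>" using z by (simp add: \<Delta>_def words_upto_def)
      have "\<bar>cfrac w - cfrac \<gamma>1\<bar> \<le> 1 / (real (cont \<gamma>1))\<^sup>2" unfolding y(1) by (rule cfrac_append_near[OF p1])
      also have "\<dots> \<le> 1 / G\<^sup>2" using G G1 by (intro divide_left_mono power_mono mult_pos_pos) auto
      finally have "\<bar>cfrac \<gamma>1 - real v2 / real v1\<bar> \<le> \<alpha> + 1 / G\<^sup>2" using w by auto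
      then have \<gamma>1: "\<gamma>1 \<in> \<Gamma>" using l1 G2 by (simp add: \<Gamma>_def words_upto_def)
      have "cont z \<le> n" unfolding n_def using z(5) by (intro le_nat_floor) auto
      then have "z \<in> Z (\<gamma>1 @ \<gamma>2)" using w z y by (simp add: Z_def)
      then show "w \<in> (\<Union>\<gamma>1\<in>\<Gamma>. \<Union>\<gamma>2\<in>\<Delta>. (\<lambda>z. \<gamma>1 @ \<gamma>2 @ z) ` Z (\<gamma>1 @ \<gamma>2))"
        using \<gamma>1 \<gamma>2 y(1) z(1) by blast
    qed
    have cZ: "real (card (Z \<gamma>)) \<le> 16 * b\<^sup>2 * Q" if \<gamma>: "\<gamma> \<in> lists A" for \<gamma>
    proof -
      \<comment> \<open>For fixed \<gamma> the determinant is a linear form with coefficients p and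
        r in the column of z. Since the matrix of \<gamma> is unimodular, (v1, v2) can be recovered
        from (p, r), so p and r are coprime as well.\<close>
      define p where "p = int v1 * int (cont_tl \<gamma>) - int v2 * int (cont \<gamma>)"
      define r where "r = int v1 * int (cont_mid \<gamma>) - int v2 * int (cont_bl \<gamma>)"
      define e where "e = int (cont \<gamma>) * int (cont_mid \<gamma>) - int (cont_bl \<gamma>) * int (cont_tl \<gamma>)"
      have e: "\<bar>e\<bar> = 1" unfolding e_def cont_det by (simp add: power_abs)
      have cop: "coprime p r"
      proof (rule coprimeI)
        fix c assume c: "c dvd p" "c dvd r"
        have "r * int (cont \<gamma>) - p * int (cont_bl \<gamma>) = int v1 * e"
          "r * int (cont_tl \<gamma>) - p * int (cont_mid \<gamma>) = int v2 * e"
          by (simp_all add: p_def r_def e_def algebra_simps)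
        then have "c dvd int v1 * e" "c dvd int v2 * e"
          using c by (metis dvd_diff dvd_mult2)+
        then have "c dvd int v1" "c dvd int v2"
          using e by (metis abs_mult dvd_abs_iff mult.right_neutral)+
        then show "is_unit c" using v(2) coprime_common_divisor[of "int v1" "int v2" c] by simp
      qed
      have lin: "int v1 * int (cont_tl (\<gamma> @ z)) - int v2 * int (cont (\<gamma> @ z)) = p * int (cont z) + r * int (cont_tl z)" for z
        by (simp add: cont_append p_def r_def algebra_simps)
      let ?T = "{(x, y). x \<le> n \<and> y \<le> n \<and> int q dvd p * int x + r * int y}"
      have "card (Z \<gamma>) \<le> 2 * card ((\<lambda>w. (cont w, cont_tl w)) ` Z \<gamma>)"
        using finZ pos_word by (intro card_words_le_vectors) (auto simp: Z_def)
      also have "card ((\<lambda>w. (cont w, cont_tl w)) ` Z \<gamma>) \<le> card ?T"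
      proof (rule card_mono)
        show "finite ?T" by (rule finite_subset[of _ "{..n} \<times> {..n}"]) auto
        show "(\<lambda>w. (cont w, cont_tl w)) ` Z \<gamma> \<subseteq> ?T"
        proof (rule image_subsetI)
          fix z assume z: "z \<in> Z \<gamma>"
          then have "cont_tl z \<le> cont z" using cont_tl_le[OF pos_word] by (simp add: Z_def)
          then show "(cont z, cont_tl z) \<in> ?T" using z unfolding Z_def lin by auto
        qed
      qed
      finally have "real (card (Z \<gamma>)) \<le> 2 * real (card ?T)" by linarith
      also have "real (card ?T) \<le> 4 * (real n)\<^sup>2 / real q"
        by (rule card_linear_congruence_le[OF cop q0 qn])
      also have "\<dots> \<le> 4 * (b * Q)\<^sup>2 / (Q / 2)"
        using nb q Q by (intro frac_le mult_left_mono power_mono) auto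
      also have "\<dots> = 8 * b\<^sup>2 * Q" using Q by (simp add: power2_eq_square)
      finally show ?thesis by simp
    qed
    have c\<Gamma>: "real (card \<Gamma>) \<le> C1 * (1 + G\<^sup>2 * \<alpha>)"
    proof -
      have "1 * 1 \<le> b * G" using b G by (intro mult_mono) auto
      then have "real (card \<Gamma>) \<le> 2 * (2 * (\<alpha> + 1 / G\<^sup>2) * (b * G)\<^sup>2 + 1)"
        unfolding \<Gamma>_def using \<alpha> by (intro card_words_near_le) auto
      also have "2 * (\<alpha> + 1 / G\<^sup>2) * (b * G)\<^sup>2 = 2 * b\<^sup>2 * (1 + G\<^sup>2 * \<alpha>)"
        using G by (simp add: power_mult_distrib field_simps)
      also have "2 * (2 * b\<^sup>2 * (1 + G\<^sup>2 * \<alpha>) + 1) \<le> C1 * (1 + G\<^sup>2 * \<alpha>)"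
        using \<alpha> by (simp add: C1_def algebra_simps)
      finally show ?thesis .
    qed
    have fin\<Gamma>: "finite \<Gamma>" "finite \<Delta>" using finite_words_upto by (auto simp: \<Gamma>_def \<Delta>_def)
    have "card ?S \<le> card (\<Union>\<gamma>1\<in>\<Gamma>. \<Union>\<gamma>2\<in>\<Delta>. (\<lambda>z. \<gamma>1 @ \<gamma>2 @ z) ` Z (\<gamma>1 @ \<gamma>2))"
      using sub fin\<Gamma> finZ by (intro card_mono) auto
    also have "\<dots> \<le> (\<Sum>\<gamma>1\<in>\<Gamma>. card (\<Union>\<gamma>2\<in>\<Delta>. (\<lambda>z. \<gamma>1 @ \<gamma>2 @ z) ` Z (\<gamma>1 @ \<gamma>2)))"
      by (rule card_UN_le[OF fin\<Gamma>(1)])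
    also have "\<dots> \<le> (\<Sum>\<gamma>1\<in>\<Gamma>. \<Sum>\<gamma>2\<in>\<Delta>. card ((\<lambda>z. \<gamma>1 @ \<gamma>2 @ z) ` Z (\<gamma>1 @ \<gamma>2)))"
      by (intro sum_mono card_UN_le[OF fin\<Gamma>(2)])
    also have "\<dots> \<le> (\<Sum>\<gamma>1\<in>\<Gamma>. \<Sum>\<gamma>2\<in>\<Delta>. card (Z (\<gamma>1 @ \<gamma>2)))"
      by (intro sum_mono card_image_le finZ)
    finally have "real (card ?S) \<le> (\<Sum>\<gamma>1\<in>\<Gamma>. \<Sum>\<gamma>2\<in>\<Delta>. real (card (Z (\<gamma>1 @ \<gamma>2))))"
      unfolding of_nat_sum[symmetric] of_nat_le_iff .
    also have "\<dots> \<le> (\<Sum>\<gamma>1\<in>\<Gamma>. \<Sum>\<gamma>2\<in>\<Delta>. 16 * b\<^sup>2 * Q)"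
      by (intro sum_mono cZ) (auto simp: \<Gamma>_def \<Delta>_def words_upto_def)
    also have "\<dots> = real (card \<Gamma>) * (real (card \<Delta>) * (16 * b\<^sup>2 * Q))" by simp
    also have "\<dots> \<le> (C1 * (1 + G\<^sup>2 * \<alpha>)) * (real (card \<Delta>) * (16 * b\<^sup>2 * Q))"
      using c\<Gamma> Q by (intro mult_right_mono) auto
    also have "\<dots> = C * (1 + G\<^sup>2 * \<alpha>) * word_count (2 * X / (G * Q)) * Q"
      by (simp add: C_def word_count_def \<Delta>_def)
    finally show ?thesis .
  qed
  ultimately show ?thesis by blast
qed

text \<open>Dyadic ranges for q and for the distance to a / q. The exception \<open>K = 1\<close>
  lets the innermost arc keep all smaller distances.\<close>

definition major_arc :: "nat \<Rightarrow> real \<Rightarrow> real \<Rightarrow> real set" where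
  "major_arc N Q K = {\<theta> \<in> grid N. \<exists>a q::int. coprime a q \<and> 0 < q \<and> Q / 2 \<le> q \<and> real_of_int q \<le> Q \<and>
     \<bar>\<theta> - a / q\<bar> \<le> K / N \<and> (K = 1 \<or> K / (2 * real N) \<le> \<bar>\<theta> - a / q\<bar>)}"

lemma card_major_arc_le:
  assumes "0 < N" "1 \<le> Q" "1 \<le> K" "K \<le> real N"
  shows "real (card (major_arc N Q K)) \<le> 12 * (Q\<^sup>2 * K)"
proof -
  define m where "m = \<lfloor>Q\<rfloor>"
  have m: "1 \<le> m" "real_of_int m \<le> Q" using assms(2) unfolding m_def by linarith+
  define I where "I = {1..m} \<times> {-m..2 * m}"
  define J where "J = (\<lambda>(q, a). {\<theta> \<in> grid N. \<bar>\<theta> - real_of_int a / real_of_int q\<bar> \<le> K / N})"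
  have sub: "major_arc N Q K \<subseteq> (\<Union>i\<in>I. J i)"
  proof
    fix \<theta> assume "\<theta> \<in> major_arc N Q K"
    then obtain a q :: int where aq: "\<theta> \<in> grid N" "0 < q" "q \<le> Q" "\<bar>\<theta> - a / q\<bar> \<le> K / N"
      unfolding major_arc_def by blast
    have "K / N \<le> 1" using assms by simp
    then have "-1 \<le> a / q" "a / q \<le> 2" using grid_bounds[OF aq(1)] aq(4) by linarith+
    then have "- real_of_int q \<le> a" "real_of_int a \<le> 2 * q" using aq(2) by (simp_all add: field_simps)
    then have "- q \<le> a" "a \<le> 2 * q" by linarith+
    moreover have "q \<le> m" using aq(3) unfolding m_def by linarith
    ultimately have "(q, a) \<in> I" using aq(2) by (auto simp: I_def)
    moreover have "\<theta> \<in> J (q, a)" using aq by (simp add: J_def)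
    ultimately show "\<theta> \<in> (\<Union>i\<in>I. J i)" by blast
  qed
  have finI: "finite I" by (simp add: I_def)
  have "card (major_arc N Q K) \<le> card (\<Union>i\<in>I. J i)"
    using sub finI finite_grid by (intro card_mono) (auto simp: J_def)
  also have "\<dots> \<le> (\<Sum>i\<in>I. card (J i))" by (rule card_UN_le[OF finI])
  finally have "real (card (major_arc N Q K)) \<le> (\<Sum>i\<in>I. real (card (J i)))"
    unfolding of_nat_sum[symmetric] of_nat_le_iff .
  also have "\<dots> \<le> (\<Sum>i\<in>I. 3 * K)"
  proof (rule sum_mono)
    fix i :: "int \<times> int"
    obtain q a where i: "i = (q, a)" by (cases i)
    have "real (card (J i)) \<le> 2 * real N * (K / N) + 1"
      using assms by (intro card_grid_interval_le[of _ _ _ "a / q"]) (auto simp: J_def i abs_le_iff)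
    then show "real (card (J i)) \<le> 3 * K" using assms by simp
  qed
  also have "\<dots> = real (card I) * (3 * K)" by simp
  also have "real (card I) = m * (3 * m + 1)" using m by (simp add: I_def card_cartesian_product)
  also have "\<dots> * (3 * K) \<le> (Q * (4 * Q)) * (3 * K)"
  proof (rule mult_right_mono)
    have "real_of_int m * real_of_int (3 * m + 1) \<le> Q * (4 * Q)"
      using m assms by (intro mult_mono) auto
    then show "real_of_int (m * (3 * m + 1)) \<le> Q * (4 * Q)" by simp
  qed (use assms in simp)
  finally show ?thesis by (simp add: power2_eq_square algebra_simps)
qed

lemma cross_eq_cfrac_diff:
  assumes "0 \<notin> set w" "0 \<notin> set w'"
  shows "real_of_int (int (cont w) * int (cont_tl w') - int (cont_tl w) * int (cont w'))
     = (cfrac w' - cfrac w) * (real (cont w) * real (cont w'))"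
  using assms cont_pos[of w] cont_pos[of w'] by (simp add: cfrac_eq_cont field_simps)

text \<open>The smallness hypothesis is that of \<open>near_vec_exact\<close> with b = K / N and Y =
  2 X, so every coincidence is exact. For given w this confines w' to a residue class and a
  direction, and each pair leaves O(1 + \<kappa> N / X) values of \<theta>'. Prefix size
  \<open>sqrt K\<close> matches the direction window of width about 1 / K to the spacing of the
  prefix fractions.\<close>

lemma major_arc_pairs_le:
  "\<exists>C>0. \<forall>N (Q::real) (K::real) (X::real) (\<kappa>::real) \<theta> V. 0 < N \<longrightarrow> 1 \<le> Q \<longrightarrow> 1 \<le> K \<longrightarrow> 0 < X \<longrightarrow> 0 \<le> \<kappa> \<longrightarrow>
     2 * (amax + 1) * sqrt K * Q \<le> X \<longrightarrow> \<kappa> + 4 * K * X / real N < 1 / Q\<^sup>2 \<longrightarrow> \<theta> \<in> major_arc N Q K \<longrightarrow>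
     V \<subseteq> {w \<in> lists A. X \<le> real (cont w) \<and> real (cont w) \<le> 2 * X} \<longrightarrow>
     (\<Sum>w\<in>V. \<Sum>w'\<in>V. real (card {\<theta>'\<in>major_arc N Q K. near_vec \<kappa> \<theta> w \<theta>' w'}))
       \<le> C * real (card V) * (1 + \<kappa> * N / X)\<^sup>2 * word_count (2 * X / (sqrt K * Q)) * Q"
proof -
  obtain C0 where C0: "0 < C0" and count: "\<And>v1 v2 q (Q::real) (G::real) (X::real) (\<alpha>::real). 0 < v1 \<Longrightarrow> coprime v1 v2 \<Longrightarrow> 1 \<le> Q \<Longrightarrow> 1 \<le> G \<Longrightarrow> Q / 2 \<le> real q \<Longrightarrow>
     real q \<le> Q \<Longrightarrow> 0 \<le> \<alpha> \<Longrightarrow> 2 * (amax + 1) * G * Q \<le> X \<Longrightarrow>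
     real (card {w \<in> lists A. X \<le> real (cont w) \<and> real (cont w) \<le> 2 * X \<and>
        int q dvd int v1 * int (cont_tl w) - int v2 * int (cont w) \<and>
        \<bar>cfrac w - real v2 / real v1\<bar> \<le> \<alpha>})
      \<le> C0 * (1 + G\<^sup>2 * \<alpha>) * word_count (2 * X / (G * Q)) * Q"
    using card_words_class_le by blast
  define C where "C = C0 * 64"
  have "0 < C" using C0 by (simp add: C_def)
  moreover have "(\<Sum>w\<in>V. \<Sum>w'\<in>V. real (card {\<theta>'\<in>major_arc N Q K. near_vec \<kappa> \<theta> w \<theta>' w'}))
       \<le> C * real (card V) * (1 + \<kappa> * N / X)\<^sup>2 * word_count (2 * X / (sqrt K * Q)) * Q"
    if N: "0 < N" and Q: "1 \<le> Q" and K: "1 \<le> K" and X0: "0 < X" and \<kappa>: "0 \<le> \<kappa>"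
      and X: "2 * (amax + 1) * sqrt K * Q \<le> X" and small: "\<kappa> + 4 * K * X / real N < 1 / Q\<^sup>2"
      and \<theta>: "\<theta> \<in> major_arc N Q K"
      and V: "V \<subseteq> {w \<in> lists A. X \<le> real (cont w) \<and> real (cont w) \<le> 2 * X}" for N Q K X \<kappa> \<theta> V
  proof -
    obtain a q :: int where aq: "coprime a q" "0 < q" "Q / 2 \<le> q" "q \<le> Q"
      "\<bar>\<theta> - a / q\<bar> \<le> K / N" "K = 1 \<or> K / (2 * real N) \<le> \<bar>\<theta> - a / q\<bar>" using \<theta> unfolding major_arc_def by blast
    define \<beta> where "\<beta> = \<theta> - a / q"
    have finV: "finite V"
      by (rule finite_subset[OF _ finite_words_upto[of "2 * X"]]) (use V in \<open>auto simp: words_upto_def\<close>)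
    define \<Lambda> where "\<Lambda> = 1 + \<kappa> * N / X"
    have \<Lambda>: "1 \<le> \<Lambda>" using \<kappa> X0 by (simp add: \<Lambda>_def)
    \<comment> \<open>With \<open>(sqrt K)\<^sup>2 * \<alpha> = 4 * \<Lambda>\<close> the direction
      costs a factor \<Lambda>. For K = 1 the window is at least 4 wide and so contains every value
      in [0, 1].\<close>
    define \<alpha> where "\<alpha> = 4 * \<Lambda> / K"
    define cls where "cls = (\<lambda>w. {w' \<in> lists A. X \<le> real (cont w') \<and> real (cont w') \<le> 2 * X \<and>
        int (nat q) dvd int (cont w) * int (cont_tl w') - int (cont_tl w) * int (cont w') \<and>
        \<bar>cfrac w' - real (cont_tl w) / real (cont w)\<bar> \<le> \<alpha>})"
    have Vw: "w \<in> lists A" "0 \<notin> set w" "X \<le> cont w" "cont w \<le> 2 * X" "0 < cont w" if "w \<in> V" for w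
      using V that pos_word cont_pos by blast+
    have exact: "\<exists>a' :: int. \<exists>n1 n2. \<bar>\<theta>' - a' / q\<bar> \<le> K / N \<and>
       a * int (cont w) - a' * int (cont w') = n1 * q \<and> a * int (cont_tl w) - a' * int (cont_tl w') = n2 * q \<and>
       \<bar>\<beta> * cont w - (\<theta>' - a' / q) * cont w'\<bar> \<le> \<kappa> \<and> \<bar>\<beta> * cont_tl w - (\<theta>' - a' / q) * cont_tl w'\<bar> \<le> \<kappa>"
      if w: "w \<in> V" "w' \<in> V" and near: "near_vec \<kappa> \<theta> w \<theta>' w'" and \<theta>': "\<theta>' \<in> major_arc N Q K" for w w' \<theta>'
    proof -
      obtain a' q' :: int where aq': "coprime a' q'" "0 < q'" "q' \<le> Q"
        "\<bar>\<theta>' - a' / q'\<bar> \<le> K / N" using \<theta>' unfolding major_arc_def by blast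
      have "q * real_of_int q' \<le> Q * Q" using aq aq' Q by (intro mult_mono) auto
      then have "1 / Q\<^sup>2 \<le> 1 / (q * real_of_int q')"
        using aq(2) aq'(2) Q by (intro divide_left_mono mult_pos_pos) (auto simp: power2_eq_square)
      then have "\<kappa> + 2 * (K / N) * (2 * X) < 1 / (q * real_of_int q')" using small by simp
      then have "q = q' \<and> (\<exists>n1 n2. a * int (cont w) - a' * int (cont w') = n1 * q \<and>
           a * int (cont_tl w) - a' * int (cont_tl w') = n2 * q) \<and>
         \<bar>\<beta> * cont w - (\<theta>' - a' / q') * cont w'\<bar> \<le> \<kappa> \<and> \<bar>\<beta> * cont_tl w - (\<theta>' - a' / q') * cont_tl w'\<bar> \<le> \<kappa>"
        using near Vw(2,4) w aq(1,2,5) aq'(1,2,4)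
        by (intro near_vec_exact[where b = "K / N" and Y = "2 * X"]) (auto simp: \<beta>_def)
      then show ?thesis using aq'(4) by blast
    qed
    have cls: "w' \<in> cls w"
      if w: "w \<in> V" "w' \<in> V" and near: "near_vec \<kappa> \<theta> w \<theta>' w'" and \<theta>': "\<theta>' \<in> major_arc N Q K" for w w' \<theta>'
    proof -
      obtain a' n1 n2 :: int where e: "a * int (cont w) - a' * int (cont w') = n1 * q"
        "a * int (cont_tl w) - a' * int (cont_tl w') = n2 * q"
        "\<bar>\<beta> * cont w - (\<theta>' - a' / q) * cont w'\<bar> \<le> \<kappa>" "\<bar>\<beta> * cont_tl w - (\<theta>' - a' / q) * cont_tl w'\<bar> \<le> \<kappa>"
        using exact[OF w near \<theta>'] by blast
      have dvd: "q dvd int (cont w) * int (cont_tl w') - int (cont_tl w) * int (cont w')"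
        by (rule cross_dvd[OF aq(1) e(1,2)])
      have "\<bar>cfrac w' - cfrac w\<bar> \<le> \<alpha>"
      proof (cases "K = 1")
        case True
        have "\<bar>cfrac w' - cfrac w\<bar> \<le> 1"
          using cfrac_bounds[OF Vw(2)[OF w(1)]] cfrac_bounds[OF Vw(2)[OF w(2)]] by linarith
        then show ?thesis using True \<Lambda> by (simp add: \<alpha>_def)
      next
        case False
        then have \<beta>: "K / (2 * real N) \<le> \<bar>\<beta>\<bar>" using aq(6) by (simp add: \<beta>_def)
        let ?v = "real (cont w)" and ?v' = "real (cont w')" and ?u = "real (cont_tl w)" and ?u' = "real (cont_tl w')"
        let ?\<beta>' = "\<theta>' - a' / q"
        have pp: "0 < ?v" "0 < ?v'" "X \<le> ?v" using Vw w by auto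
        have u': "?u' \<le> ?v'" using cont_tl_le[OF Vw(2)[OF w(2)]] by simp
        \<comment> \<open>Eliminating \<beta>' from the two coordinate estimates leaves \<beta>
          times the determinant; the lower bound on \<bar>\<beta>\<bar> then turns this into a bound
          for the angle.\<close>
        have "\<beta> * ((cfrac w' - cfrac w) * (?v * ?v')) = (\<beta> * ?v - ?\<beta>' * ?v') * ?u' - (\<beta> * ?u - ?\<beta>' * ?u') * ?v'"
          unfolding cross_eq_cfrac_diff[OF Vw(2)[OF w(1)] Vw(2)[OF w(2)], symmetric]
          by (simp add: algebra_simps)
        also have "\<bar>\<dots>\<bar> \<le> \<bar>(\<beta> * ?v - ?\<beta>' * ?v') * ?u'\<bar> + \<bar>(\<beta> * ?u - ?\<beta>' * ?u') * ?v'\<bar>"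
          by (rule abs_triangle_ineq4)
        also have "\<dots> \<le> \<kappa> * ?v' + \<kappa> * ?v'"
          using e(3,4) u' \<kappa> by (intro add_mono) (auto simp: abs_mult intro!: mult_mono)
        finally have "\<bar>\<beta>\<bar> * \<bar>cfrac w' - cfrac w\<bar> * ?v * ?v' \<le> (2 * \<kappa>) * ?v'"
          unfolding abs_mult by (simp add: mult.assoc)
        then have "\<bar>\<beta>\<bar> * \<bar>cfrac w' - cfrac w\<bar> * ?v \<le> 2 * \<kappa>" using pp by simp
        moreover have "K / (2 * real N) * \<bar>cfrac w' - cfrac w\<bar> * X \<le> \<bar>\<beta>\<bar> * \<bar>cfrac w' - cfrac w\<bar> * ?v"
          using \<beta> pp X0 K by (intro mult_mono mult_right_mono mult_nonneg_nonneg) auto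
        ultimately have "K / (2 * real N) * \<bar>cfrac w' - cfrac w\<bar> * X \<le> 2 * \<kappa>" by linarith
        then have "\<bar>cfrac w' - cfrac w\<bar> \<le> 4 * (\<kappa> * N / X) / K"
          using N X0 K by (simp add: field_simps)
        also have "\<dots> \<le> \<alpha>" unfolding \<alpha>_def \<Lambda>_def using K by (intro divide_right_mono) auto
        finally show ?thesis .
      qed
      moreover have "cfrac w = real (cont_tl w) / real (cont w)" by (rule cfrac_eq_cont[OF Vw(2)[OF w(1)]])
      ultimately show ?thesis using dvd Vw[OF w(2)] aq(2) by (simp add: cls_def)
    qed
    have cT: "real (card {\<theta>'\<in>major_arc N Q K. near_vec \<kappa> \<theta> w \<theta>' w'}) \<le> 12 * \<Lambda>"
      if w: "w \<in> V" "w' \<in> V" for w w'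
    proof -
      let ?T = "{\<theta>'\<in>major_arc N Q K. near_vec \<kappa> \<theta> w \<theta>' w'}"
      have "real (card ?T) \<le> 3 * (2 * real N * (2 * \<kappa> / X) + 1)"
      proof (rule card_grid_clustered_le)
        show "?T \<subseteq> grid N" by (auto simp: major_arc_def)
        fix x y assume "x \<in> ?T" "y \<in> ?T"
        then have xy: "x \<in> major_arc N Q K" "near_vec \<kappa> \<theta> w x w'" "y \<in> major_arc N Q K" "near_vec \<kappa> \<theta> w y w'" by auto
        obtain a1 n1 n2 :: int where e1: "a * int (cont w) - a1 * int (cont w') = n1 * q"
          "a * int (cont_tl w) - a1 * int (cont_tl w') = n2 * q"
          "\<bar>\<beta> * cont w - (x - a1 / q) * cont w'\<bar> \<le> \<kappa>" using exact[OF w xy(2,1)] by blast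
        obtain a2 n3 n4 :: int where e2: "a * int (cont w) - a2 * int (cont w') = n3 * q"
          "a * int (cont_tl w) - a2 * int (cont_tl w') = n4 * q"
          "\<bar>\<beta> * cont w - (y - a2 / q) * cont w'\<bar> \<le> \<kappa>" using exact[OF w xy(4,3)] by blast
        \<comment> \<open>Here \<kappa> X need not be small, so \<open>near_vec_difference\<close>
          is out of reach; the exact congruences and the primitivity of w' take its place.\<close>
        have "q dvd a1 - a2"
        proof (rule coprime_dvd_both)
          show "coprime (int (cont w')) (int (cont_tl w'))" using coprime_cont by simp
          have "(a1 - a2) * int (cont w') = (n3 - n1) * q" "(a1 - a2) * int (cont_tl w') = (n4 - n2) * q"
            using e1 e2 by (simp_all add: algebra_simps)
          then show "q dvd (a1 - a2) * int (cont w')" "q dvd (a1 - a2) * int (cont_tl w')" by simp_all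
        qed
        then obtain m where m: "a1 - a2 = q * m" by (auto simp: dvd_def)
        have am: "real_of_int a1 / q = a2 / q + m"
        proof -
          have "real_of_int a1 = a2 + q * m" using m by (metis add.commute diff_add_cancel of_int_add of_int_mult)
          then show ?thesis using aq(2) by (simp add: field_simps)
        qed
        have "(x - y - m) * cont w' = (x - a1 / q) * cont w' - (y - a2 / q) * cont w'"
          unfolding am by (simp add: algebra_simps)
        then have "\<bar>(x - y - m) * cont w'\<bar> \<le> 2 * \<kappa>" using e1(3) e2(3) by linarith
        then have "\<bar>x - y - m\<bar> * cont w' \<le> 2 * \<kappa>" by (simp add: abs_mult)
        moreover have "\<bar>x - y - m\<bar> * X \<le> \<bar>x - y - m\<bar> * cont w'"
          using Vw(3)[OF w(2)] by (intro mult_left_mono) auto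
        ultimately have "\<bar>x - y - m\<bar> \<le> 2 * \<kappa> / X" using X0 by (simp add: pos_le_divide_eq)
        then show "near_int (2 * \<kappa> / X) (x - y)" unfolding near_int_def by blast
      qed (use N \<kappa> X0 in auto)
      also have "\<dots> \<le> 12 * \<Lambda>" by (simp add: \<Lambda>_def mult.commute)
      finally show ?thesis .
    qed
    have cc: "real (card (cls w)) \<le> C0 * (5 * \<Lambda>) * word_count (2 * X / (sqrt K * Q)) * Q" if w: "w \<in> V" for w
    proof -
      have "real (card (cls w)) \<le> C0 * (1 + (sqrt K)\<^sup>2 * \<alpha>) * word_count (2 * X / (sqrt K * Q)) * Q"
        unfolding cls_def using Vw(5)[OF w] coprime_cont[of w] Q K aq X \<Lambda>
        by (intro count) (auto simp: \<alpha>_def)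
      also have "(sqrt K)\<^sup>2 * \<alpha> = 4 * \<Lambda>" using K by (simp add: \<alpha>_def)
      also have "C0 * (1 + 4 * \<Lambda>) * word_count (2 * X / (sqrt K * Q)) * Q
         \<le> C0 * (5 * \<Lambda>) * word_count (2 * X / (sqrt K * Q)) * Q"
        using C0 \<Lambda> word_count_nonneg Q by (intro mult_right_mono mult_left_mono) auto
      finally show ?thesis .
    qed
    have fin_cls: "finite (cls w)" for w
      by (rule finite_subset[OF _ finite_words_upto[of "2 * X"]]) (auto simp: cls_def words_upto_def)
    have "(\<Sum>w'\<in>V. real (card {\<theta>'\<in>major_arc N Q K. near_vec \<kappa> \<theta> w \<theta>' w'}))
        \<le> C0 * (5 * \<Lambda>) * word_count (2 * X / (sqrt K * Q)) * Q * (12 * \<Lambda>)" if w: "w \<in> V" for w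
    proof -
      have "(\<Sum>w'\<in>V. real (card {\<theta>'\<in>major_arc N Q K. near_vec \<kappa> \<theta> w \<theta>' w'}))
        = (\<Sum>w'\<in>V \<inter> cls w. real (card {\<theta>'\<in>major_arc N Q K. near_vec \<kappa> \<theta> w \<theta>' w'}))"
      proof (rule sum.mono_neutral_right[OF finV], blast, rule ballI)
        fix w' assume w': "w' \<in> V - V \<inter> cls w"
        then have "{\<theta>'\<in>major_arc N Q K. near_vec \<kappa> \<theta> w \<theta>' w'} = {}" using cls[OF w] by blast
        then show "real (card {\<theta>'\<in>major_arc N Q K. near_vec \<kappa> \<theta> w \<theta>' w'}) = 0" by (simp only: card.empty of_nat_0)
      qed
      also have "\<dots> \<le> (\<Sum>w'\<in>V \<inter> cls w. 12 * \<Lambda>)" using cT[OF w] by (intro sum_mono) auto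
      also have "\<dots> = real (card (V \<inter> cls w)) * (12 * \<Lambda>)" by simp
      also have "\<dots> \<le> real (card (cls w)) * (12 * \<Lambda>)"
        using \<Lambda> fin_cls by (intro mult_right_mono of_nat_mono card_mono) auto
      also have "\<dots> \<le> C0 * (5 * \<Lambda>) * word_count (2 * X / (sqrt K * Q)) * Q * (12 * \<Lambda>)"
        using cc[OF w] \<Lambda> by (intro mult_right_mono) auto
      finally show ?thesis .
    qed
    then have "(\<Sum>w\<in>V. \<Sum>w'\<in>V. real (card {\<theta>'\<in>major_arc N Q K. near_vec \<kappa> \<theta> w \<theta>' w'}))
        \<le> (\<Sum>w\<in>V. C0 * (5 * \<Lambda>) * word_count (2 * X / (sqrt K * Q)) * Q * (12 * \<Lambda>))"
      by (rule sum_mono)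
    also have "\<dots> = (C0 * 60) * (real (card V) * \<Lambda>\<^sup>2 * word_count (2 * X / (sqrt K * Q)) * Q)"
      by (simp add: power2_eq_square)
    also have "\<dots> \<le> C * (real (card V) * \<Lambda>\<^sup>2 * word_count (2 * X / (sqrt K * Q)) * Q)"
      unfolding C_def using C0 word_count_nonneg Q by (intro mult_right_mono mult_nonneg_nonneg) auto
    finally show ?thesis by (simp add: \<Lambda>_def mult.assoc)
  qed
  ultimately show ?thesis by blast
qed

text \<open>A coincidence puts \<theta> D near an integer for the determinant D of w and w'. The
  rational approximation of \<theta> bounds the number of such D, each D leaves at most 6 words w',
  and \<open>16 * \<kappa> * X < 1\<close> permits \<open>near_vec_difference\<close>, which bounds
  the \<theta>' of a given pair by 12 (1 + \<kappa> N / X). This gives 72 = 6 * 12.\<close>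

lemma generic_pairs_le:
  fixes a q :: int and X \<kappa> \<theta> :: real
  assumes N: "0 < N" and aq: "coprime a q" "0 < q" "\<bar>\<theta> - a / q\<bar> \<le> 1 / (real_of_int q)\<^sup>2"
    and X0: "0 < X" and \<kappa>: "0 \<le> \<kappa>" "16 * \<kappa> * X < 1" and \<Theta>: "\<Theta> \<subseteq> grid N"
    and V: "V \<subseteq> {w \<in> lists A. X \<le> real (cont w) \<and> real (cont w) \<le> 2 * X}"
  shows "(\<Sum>w\<in>V. \<Sum>w'\<in>V. real (card {\<theta>'\<in>\<Theta>. near_vec \<kappa> \<theta> w \<theta>' w'}))
       \<le> 72 * real (card V) * (1 + \<kappa> * N / X) * ((8 * X\<^sup>2 / q + 2) * (8 * \<kappa> * X * q + 3))"
proof -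
  have finV: "finite V"
    by (rule finite_subset[OF _ finite_words_upto[of "2 * X"]]) (use V in \<open>auto simp: words_upto_def\<close>)
  define \<Lambda> where "\<Lambda> = 1 + \<kappa> * N / X"
  have \<Lambda>: "1 \<le> \<Lambda>" using \<kappa> X0 by (simp add: \<Lambda>_def)
  have Vw: "w \<in> lists A" "0 \<notin> set w" "X \<le> cont w" "cont w \<le> 2 * X" "0 < cont w" if "w \<in> V" for w
    using V that pos_word cont_pos by blast+
  define DD where "DD = {D::int. \<bar>real_of_int D\<bar> \<le> 4 * X\<^sup>2 \<and> near_int (4 * \<kappa> * X) (\<theta> * D)}"
  define cls where "cls = (\<lambda>w D. {w' \<in> words_upto (2 * X). int (cont w) * int (cont_tl w') - int (cont_tl w) * int (cont w') = D})"
  have cD: "real (card DD) \<le> (8 * X\<^sup>2 / q + 2) * (8 * \<kappa> * X * q + 3)"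
    using card_near_int_multiples_le[OF aq, of "4 * \<kappa> * X" "4 * X\<^sup>2"] \<kappa> X0 by (simp add: DD_def mult.assoc)
  have finD: "finite DD"
  proof (rule finite_subset)
    show "DD \<subseteq> {-\<lceil>4 * X\<^sup>2\<rceil>..\<lceil>4 * X\<^sup>2\<rceil>}" unfolding DD_def by (auto simp: abs_le_iff) linarith+
  qed simp
  have cls: "w' \<in> (\<Union>D\<in>DD. cls w D)"
    if w: "w \<in> V" "w' \<in> V" and near: "near_vec \<kappa> \<theta> w \<theta>' w'" for w w' \<theta>'
  proof -
    let ?v = "real (cont w)" and ?v' = "real (cont w')" and ?u = "real (cont_tl w)" and ?u' = "real (cont_tl w')"
    define D where "D = int (cont w) * int (cont_tl w') - int (cont_tl w) * int (cont w')"
    have u: "?u \<le> ?v" "?u' \<le> ?v'" using cont_tl_le[OF Vw(2)] w by auto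
    have "\<bar>real_of_int D\<bar> \<le> 4 * X\<^sup>2"
    proof -
      have D: "real_of_int D = ?v * ?u' - ?u * ?v'" by (simp add: D_def)
      have "?v * ?u' \<le> (2 * X) * (2 * X)" "?u * ?v' \<le> (2 * X) * (2 * X)"
        using u Vw(4)[OF w(1)] Vw(4)[OF w(2)] X0 by (intro mult_mono; linarith)+
      moreover have "0 \<le> ?v * ?u'" "0 \<le> ?u * ?v'" by auto
      ultimately have "\<bar>?v * ?u' - ?u * ?v'\<bar> \<le> (2 * X) * (2 * X)" by linarith
      then show ?thesis unfolding D power2_eq_square by simp
    qed
    moreover have "near_int (4 * \<kappa> * X) (\<theta> * D)"
    proof -
      obtain n1 n2 :: int where n: "\<bar>\<theta> * ?v - \<theta>' * ?v' - n1\<bar> \<le> \<kappa>" "\<bar>\<theta> * ?u - \<theta>' * ?u' - n2\<bar> \<le> \<kappa>"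
        using near unfolding near_vec_def near_int_def by blast
      have "\<theta> * D - of_int (n1 * int (cont_tl w') - n2 * int (cont w')) =
        (\<theta> * ?v - \<theta>' * ?v' - n1) * ?u' - (\<theta> * ?u - \<theta>' * ?u' - n2) * ?v'"
        by (simp add: D_def algebra_simps)
      also have "\<bar>\<dots>\<bar> \<le> \<bar>(\<theta> * ?v - \<theta>' * ?v' - n1) * ?u'\<bar> + \<bar>(\<theta> * ?u - \<theta>' * ?u' - n2) * ?v'\<bar>"
        by (rule abs_triangle_ineq4)
      also have "\<dots> \<le> \<kappa> * (2 * X) + \<kappa> * (2 * X)"
        using n u \<kappa> Vw(4)[OF w(2)] by (intro add_mono) (auto simp: abs_mult intro!: mult_mono)
      finally have "\<bar>\<theta> * D - of_int (n1 * int (cont_tl w') - n2 * int (cont w'))\<bar> \<le> 4 * \<kappa> * X" by (simp add: ac_simps)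
      then show ?thesis unfolding near_int_def by blast
    qed
    ultimately have "D \<in> DD" by (simp add: DD_def)
    moreover have "w' \<in> cls w D" using Vw[OF w(2)] by (simp add: cls_def D_def words_upto_def)
    ultimately show ?thesis by blast
  qed
  have cT: "real (card {\<theta>'\<in>\<Theta>. near_vec \<kappa> \<theta> w \<theta>' w'}) \<le> 12 * \<Lambda>"
    if w: "w \<in> V" "w' \<in> V" for w w'
  proof -
    let ?T = "{\<theta>'\<in>\<Theta>. near_vec \<kappa> \<theta> w \<theta>' w'}"
    have "real (card ?T) \<le> 3 * (2 * real N * (2 * \<kappa> / X) + 1)"
    proof (rule card_grid_clustered_le)
      show "?T \<subseteq> grid N" using \<Theta> by auto
      fix x y assume "x \<in> ?T" "y \<in> ?T"
      then have xy: "near_vec \<kappa> \<theta> w x w'" "near_vec \<kappa> \<theta> w y w'" by auto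
      have "\<kappa> * cont w' \<le> \<kappa> * (2 * X)" using Vw(4)[OF w(2)] \<kappa> by (intro mult_left_mono) auto
      then have "8 * \<kappa> * cont w' < 1" using \<kappa>(2) by linarith
      then have "near_int (2 * \<kappa> / cont w') (x - y)"
        by (rule near_vec_difference[OF xy Vw(2)[OF w(2)]])
      moreover have "2 * \<kappa> / cont w' \<le> 2 * \<kappa> / X"
        using \<kappa> X0 Vw(3)[OF w(2)] by (intro divide_left_mono) auto
      ultimately show "near_int (2 * \<kappa> / X) (x - y)" unfolding near_int_def by (meson order_trans)
    qed (use N \<kappa> X0 in auto)
    also have "\<dots> \<le> 12 * \<Lambda>" by (simp add: \<Lambda>_def mult.commute)
    finally show ?thesis .
  qed
  have fin_cls: "finite (\<Union>D\<in>DD. cls w D)" for w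
    using finD finite_words_upto by (auto simp: cls_def)
  have cc: "real (card (\<Union>D\<in>DD. cls w D)) \<le> 6 * real (card DD)" if w: "w \<in> V" for w
  proof -
    have "card (\<Union>D\<in>DD. cls w D) \<le> (\<Sum>D\<in>DD. card (cls w D))" by (rule card_UN_le[OF finD])
    then have "real (card (\<Union>D\<in>DD. cls w D)) \<le> (\<Sum>D\<in>DD. real (card (cls w D)))"
      unfolding of_nat_sum[symmetric] of_nat_le_iff .
    also have "\<dots> \<le> (\<Sum>D\<in>DD. 6)"
      unfolding cls_def using Vw[OF w] coprime_cont[of w] by (intro sum_mono card_words_cross_le) auto
    finally show ?thesis by simp
  qed
  have "(\<Sum>w'\<in>V. real (card {\<theta>'\<in>\<Theta>. near_vec \<kappa> \<theta> w \<theta>' w'})) \<le> 6 * real (card DD) * (12 * \<Lambda>)"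
    if w: "w \<in> V" for w
  proof -
    have "(\<Sum>w'\<in>V. real (card {\<theta>'\<in>\<Theta>. near_vec \<kappa> \<theta> w \<theta>' w'}))
        = (\<Sum>w'\<in>V \<inter> (\<Union>D\<in>DD. cls w D). real (card {\<theta>'\<in>\<Theta>. near_vec \<kappa> \<theta> w \<theta>' w'}))"
    proof (rule sum.mono_neutral_right[OF finV], blast, rule ballI)
      fix w' assume w': "w' \<in> V - V \<inter> (\<Union>D\<in>DD. cls w D)"
      then have "{\<theta>'\<in>\<Theta>. near_vec \<kappa> \<theta> w \<theta>' w'} = {}" using cls[OF w] by blast
      then show "real (card {\<theta>'\<in>\<Theta>. near_vec \<kappa> \<theta> w \<theta>' w'}) = 0" by (simp only: card.empty of_nat_0)
    qed
    also have "\<dots> \<le> (\<Sum>w'\<in>V \<inter> (\<Union>D\<in>DD. cls w D). 12 * \<Lambda>)" using cT[OF w] by (intro sum_mono) auto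
    also have "\<dots> = real (card (V \<inter> (\<Union>D\<in>DD. cls w D))) * (12 * \<Lambda>)" by simp
    also have "\<dots> \<le> real (card (\<Union>D\<in>DD. cls w D)) * (12 * \<Lambda>)"
      using \<Lambda> fin_cls by (intro mult_right_mono of_nat_mono card_mono) auto
    also have "\<dots> \<le> 6 * real (card DD) * (12 * \<Lambda>)"
      using cc[OF w] \<Lambda> by (intro mult_right_mono) auto
    finally show ?thesis .
  qed
  then have "(\<Sum>w\<in>V. \<Sum>w'\<in>V. real (card {\<theta>'\<in>\<Theta>. near_vec \<kappa> \<theta> w \<theta>' w'}))
      \<le> (\<Sum>w\<in>V. 6 * real (card DD) * (12 * \<Lambda>))" by (rule sum_mono)
  also have "\<dots> = 72 * real (card V) * \<Lambda> * real (card DD)" by simp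
  also have "\<dots> \<le> 72 * real (card V) * \<Lambda> * ((8 * X\<^sup>2 / q + 2) * (8 * \<kappa> * X * q + 3))"
    using cD \<Lambda> by (intro mult_left_mono) auto
  finally show ?thesis by (simp add: \<Lambda>_def)
qed

end

subsection \<open>Splitting the exponential sum\<close>

lemma sum4_square_le: "(a + b + c + d)\<^sup>2 \<le> 4 * (a\<^sup>2 + b\<^sup>2 + c\<^sup>2 + (d::real)\<^sup>2)"
proof -
  have "4 * (a\<^sup>2 + b\<^sup>2 + c\<^sup>2 + d\<^sup>2) - (a + b + c + d)\<^sup>2
      = (a - b)\<^sup>2 + (a - c)\<^sup>2 + (a - d)\<^sup>2 + (b - c)\<^sup>2 + (b - d)\<^sup>2 + (c - d)\<^sup>2"
    by (simp add: power2_eq_square algebra_simps)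
  moreover have "\<dots> \<ge> 0" by simp
  ultimately show ?thesis by linarith
qed

context alphabet
begin

text \<open>Damping already concentrates the sum on continuants of order N. The cutoff at the square
  of N makes it finite, and lies so high that it does not restrict the suffixes kept in
  \<open>expsum_split\<close>.\<close>

definition expsum :: "nat \<Rightarrow> real \<Rightarrow> complex" where
  "expsum N \<theta> = (\<Sum>w\<in>words_upto ((real N)\<^sup>2). damped N \<theta> ^ cont w)"

text \<open>Words below M have no stopping prefix and form the first term. Suffixes below L / B and
  above L H are bounded trivially, the latter by means of the damping. In the dyadic blocks between,
  the range of the suffix does not depend on x, so the bilinear structure is intact.\<close>

lemma expsum_split:
  fixes M L H B :: real and n :: nat
  assumes N: "0 < N" and M: "1 < M" and H: "1 \<le> H" and HN: "2 * (amax + 1) * H \<le> N"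
    and L: "L = N / M" and B: "1 \<le> B" and n: "B * H < 2 ^ n"
  defines "V \<equiv> \<lambda>i::nat. {w \<in> words_upto (L * H). 2 ^ i * (L / B) \<le> cont w \<and> cont w < 2 ^ Suc i * (L / B)}"
  shows "cmod (expsum N \<theta>) \<le> word_count M + real (card (stop_words M)) * word_count (L / B)
     + cmod (\<Sum>i<n. \<Sum>x\<in>stop_words M. \<Sum>w\<in>V i. damped N \<theta> ^ cont (x @ w))
     + real (card (stop_words M)) * exp (- H / 2) *
         (\<Sum>w\<in>words_upto ((real N)\<^sup>2). exp (- real (cont w) / (2 * L)))"
proof -
  let ?U = "stop_words M" and ?\<Omega> = "words_upto ((real N)\<^sup>2)" and ?z = "\<lambda>w. damped N \<theta> ^ cont w"
  have finU: "finite ?U" using M by (simp add: finite_stop_words)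
  have L0: "0 < L" using L N M by simp
  have LM_eq: "M * L = N" using L M by simp
  define Y where "Y = (\<lambda>x. {y \<in> lists A. real (cont (x @ y)) \<le> (real N)\<^sup>2})"
  define V0 where "V0 = words_upto (L * H)"
  define Vs where "Vs = {w \<in> V0. cont w < L / B}"
  have normz: "cmod (?z w) \<le> 1" for w using norm_damped_power_le_1 N by simp
  have Ysub: "Y x \<subseteq> ?\<Omega>" if "x \<in> ?U" for x
  proof
    fix y assume y: "y \<in> Y x"
    then have "cont y \<le> cont (x @ y)"
      using cont_append_ge(2)[OF pos_word pos_word, of x y] stop_words_lists[OF that] by (simp add: Y_def)
    then show "y \<in> ?\<Omega>" using y by (auto simp: Y_def words_upto_def)
  qed
  have finY: "finite (Y x)" if "x \<in> ?U" for x using Ysub[OF that] finite_words_upto finite_subset by blast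
  have V0sub: "V0 \<subseteq> Y x" if x: "x \<in> ?U" for x
  proof
    fix y assume y: "y \<in> V0"
    then have l: "x \<in> lists A" "y \<in> lists A" using stop_words_lists[OF x] by (auto simp: V0_def words_upto_def)
    have "real (cont (x @ y)) \<le> real (2 * (cont x * cont y))"
      unfolding of_nat_le_iff by (rule cont_append_bounds(2)[OF pos_word[OF l(1)] pos_word[OF l(2)]])
    also have "\<dots> = 2 * (real (cont x) * real (cont y))" by simp
    also have "\<dots> \<le> 2 * (((amax + 1) * M) * (L * H))"
      using stop_words_le[OF x] M y amax_ge_1
      by (intro mult_left_mono mult_mono) (auto simp: V0_def words_upto_def)
    also have "\<dots> = (2 * (amax + 1) * H) * (M * L)" by simp
    also have "\<dots> \<le> real N * real N" unfolding LM_eq using HN by (intro mult_right_mono) auto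
    finally show "y \<in> Y x" using l by (simp add: Y_def power2_eq_square)
  qed
  have bij: "(\<Sum>w\<in>{w\<in>?\<Omega>. M \<le> cont w}. ?z w) = (\<Sum>x\<in>?U. \<Sum>y\<in>Y x. ?z (x @ y))"
  proof -
    have img: "(\<lambda>(x, y). x @ y) ` (SIGMA x:?U. Y x) = {w\<in>?\<Omega>. M \<le> cont w}"
    proof (intro equalityI subsetI)
      fix w assume "w \<in> (\<lambda>(x, y). x @ y) ` (SIGMA x:?U. Y x)"
      then obtain x y where xy: "w = x @ y" "x \<in> ?U" "y \<in> Y x" by auto
      then have l: "x \<in> lists A" "y \<in> lists A" using stop_words_lists by (auto simp: Y_def)
      have "cont x \<le> cont w" unfolding xy(1) by (rule cont_append_ge(1)[OF pos_word[OF l(1)] pos_word[OF l(2)]])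
      moreover have "M \<le> cont x" using xy(2) by (simp add: stop_words_def)
      ultimately have "M \<le> cont w" by linarith
      then show "w \<in> {w\<in>?\<Omega>. M \<le> cont w}" using xy l by (auto simp: words_upto_def Y_def)
    next
      fix w assume w: "w \<in> {w\<in>?\<Omega>. M \<le> cont w}"
      then obtain x y where xy: "w = x @ y" "x \<in> ?U" "y \<in> lists A"
        using stop_prefix_exists[of w M] by (auto simp: words_upto_def)
      then have "(x, y) \<in> (SIGMA x:?U. Y x)" using w by (auto simp: Y_def words_upto_def)
      then show "w \<in> (\<lambda>(x, y). x @ y) ` (SIGMA x:?U. Y x)" using xy(1) by force
    qed
    have inj: "inj_on (\<lambda>(x, y). x @ y) (SIGMA x:?U. Y x)"
      by (rule inj_onI) (auto dest: stop_prefix_unique)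
    have "(\<Sum>w\<in>{w\<in>?\<Omega>. M \<le> cont w}. ?z w) = (\<Sum>(x, y)\<in>(SIGMA x:?U. Y x). ?z (x @ y))"
      unfolding img[symmetric] sum.reindex[OF inj] by (simp add: case_prod_beta comp_def)
    also have "\<dots> = (\<Sum>x\<in>?U. \<Sum>y\<in>Y x. ?z (x @ y))"
      using finU finY by (intro sum.Sigma[symmetric]) auto
    finally show ?thesis .
  qed
  have V0_split: "(\<Sum>y\<in>V0. h y) = (\<Sum>y\<in>Vs. h y) + (\<Sum>i<n. \<Sum>y\<in>V i. h y)" for h :: "nat list \<Rightarrow> complex"
  proof -
    have LB: "0 < L / B" using L0 B by simp
    have fin0: "finite V0" by (simp add: V0_def finite_words_upto)
    have disj: "V i \<inter> V j = {}" if "i \<noteq> j" for i j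
    proof (rule ccontr)
      assume "V i \<inter> V j \<noteq> {}"
      then obtain w where w: "w \<in> V i" "w \<in> V j" by blast
      have no: "\<not> (2 ^ j * (L / B) \<le> cont w \<and> cont w < 2 ^ Suc i * (L / B))" if "i < j" for i j
      proof -
        have "(2::real) ^ Suc i \<le> 2 ^ j" using that by (intro power_increasing) auto
        then have "2 ^ Suc i * (L / B) \<le> 2 ^ j * (L / B)" using LB by (intro mult_right_mono) auto
        then show ?thesis by linarith
      qed
      from that consider "i < j" | "j < i" by linarith
      then show False using no[of i j] no[of j i] w by cases (auto simp: V_def)
    qed
    have un: "V0 - Vs = (\<Union>i<n. V i)"
    proof (intro equalityI subsetI)
      fix w assume w: "w \<in> V0 - Vs"
      then have lo: "2 ^ 0 * (L / B) \<le> cont w" by (auto simp: Vs_def)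
      have "real (cont w) \<le> L * H" using w by (simp add: V0_def words_upto_def)
      also have "\<dots> = (B * H) * (L / B)" using B by simp
      also have "\<dots> < 2 ^ n * (L / B)" using n LB by (intro mult_strict_right_mono) auto
      finally have up: "cont w < 2 ^ n * (L / B)" .
      have "\<exists>i<n. 2 ^ i * (L / B) \<le> cont w \<and> cont w < 2 ^ Suc i * (L / B)"
        using up
      proof (induction n)
        case 0
        then show ?case using lo by simp
      next
        case (Suc n)
        then show ?case by (cases "cont w < 2 ^ n * (L / B)") (auto simp: less_Suc_eq)
      qed
      then show "w \<in> (\<Union>i<n. V i)" using w by (auto simp: V_def V0_def)
    next
      fix w assume "w \<in> (\<Union>i<n. V i)"
      then obtain i where i: "w \<in> V i" by blast
      have "1 * (L / B) \<le> 2 ^ i * (L / B)" using LB by (intro mult_right_mono) auto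
      then show "w \<in> V0 - Vs" using i by (auto simp: V_def V0_def Vs_def)
    qed
    have "(\<Sum>y\<in>V0. h y) = (\<Sum>y\<in>V0 - Vs. h y) + (\<Sum>y\<in>Vs. h y)"
      using fin0 by (intro sum.subset_diff) (auto simp: Vs_def)
    also have "(\<Sum>y\<in>V0 - Vs. h y) = (\<Sum>i<n. \<Sum>y\<in>V i. h y)"
      unfolding un using disj by (intro sum.UNION_disjoint) (auto simp: V_def finite_words_upto)
    finally show ?thesis by simp
  qed
  define S1 where "S1 = (\<Sum>w\<in>{w\<in>?\<Omega>. cont w < M}. ?z w)"
  define S2 where "S2 = (\<Sum>x\<in>?U. \<Sum>y\<in>Vs. ?z (x @ y))"
  define S3 where "S3 = (\<Sum>i<n. \<Sum>x\<in>?U. \<Sum>y\<in>V i. ?z (x @ y))"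
  define S4 where "S4 = (\<Sum>x\<in>?U. \<Sum>y\<in>Y x - V0. ?z (x @ y))"
  have "expsum N \<theta> = S1 + (\<Sum>x\<in>?U. \<Sum>y\<in>Y x. ?z (x @ y))"
  proof -
    have "?\<Omega> = {w\<in>?\<Omega>. cont w < M} \<union> {w\<in>?\<Omega>. M \<le> cont w}" by auto
    then have "expsum N \<theta> = (\<Sum>w\<in>{w\<in>?\<Omega>. cont w < M} \<union> {w\<in>?\<Omega>. M \<le> cont w}. ?z w)"
      unfolding expsum_def by simp
    also have "\<dots> = S1 + (\<Sum>w\<in>{w\<in>?\<Omega>. M \<le> cont w}. ?z w)"
      unfolding S1_def using finite_words_upto by (intro sum.union_disjoint) auto
    finally show ?thesis using bij by simp
  qed
  also have "(\<Sum>x\<in>?U. \<Sum>y\<in>Y x. ?z (x @ y)) = (\<Sum>x\<in>?U. (\<Sum>y\<in>Y x - V0. ?z (x @ y)) + (\<Sum>y\<in>V0. ?z (x @ y)))"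
    using V0sub finY by (intro sum.cong refl sum.subset_diff) auto
  also have "\<dots> = S4 + (S2 + S3)"
    unfolding V0_split sum.distrib S4_def S2_def S3_def by (subst (3) sum.swap) simp
  finally have eq: "expsum N \<theta> = S1 + S2 + S3 + S4" by simp
  have b1: "cmod S1 \<le> word_count M"
  proof -
    have "cmod S1 \<le> (\<Sum>w\<in>{w\<in>?\<Omega>. cont w < M}. 1)"
      unfolding S1_def by (intro sum_norm_le normz)
    also have "\<dots> \<le> word_count M"
      unfolding word_count_def using finite_words_upto
      by (simp, intro card_mono) (auto simp: words_upto_def)
    finally show ?thesis .
  qed
  have b2: "cmod S2 \<le> real (card ?U) * word_count (L / B)"
  proof -
    have "cmod S2 \<le> (\<Sum>x\<in>?U. \<Sum>y\<in>Vs. 1)"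
      unfolding S2_def by (intro sum_norm_le normz)
    also have "\<dots> = real (card ?U) * real (card Vs)" by simp
    also have "\<dots> \<le> real (card ?U) * word_count (L / B)"
      unfolding word_count_def using finite_words_upto
      by (intro mult_left_mono of_nat_mono card_mono) (auto simp: words_upto_def Vs_def V0_def)
    finally show ?thesis .
  qed
  have b4: "cmod S4 \<le> real (card ?U) * exp (- H / 2) * (\<Sum>w\<in>?\<Omega>. exp (- real (cont w) / (2 * L)))"
  proof -
    have "cmod S4 \<le> (\<Sum>x\<in>?U. \<Sum>y\<in>Y x - V0. exp (- H / 2) * exp (- real (cont y) / (2 * L)))"
      unfolding S4_def
    proof (intro sum_norm_le)
      fix x y assume x: "x \<in> ?U" and y: "y \<in> Y x - V0"
      then have l: "x \<in> lists A" "y \<in> lists A" using stop_words_lists by (auto simp: Y_def)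
      have LH: "L * H < cont y" using y l by (simp add: V0_def words_upto_def)
      have "M * real (cont y) \<le> real (cont x) * real (cont y)"
        using x by (intro mult_right_mono) (auto simp: stop_words_def)
      also have "\<dots> \<le> real (cont (x @ y))"
        using cont_append_bounds(1)[OF pos_word pos_word, OF l] by (metis of_nat_le_iff of_nat_mult)
      finally have "M * real (cont y) / N \<le> real (cont (x @ y)) / N" by (intro divide_right_mono) auto
      moreover have "M * real (cont y) / N = real (cont y) / L" unfolding LM_eq[symmetric] using L0 M by simp
      moreover have "H < real (cont y) / L" using LH L0 by (simp add: pos_less_divide_eq mult.commute)
      \<comment> \<open>Half of the exponent yields exp (-H/2), the other half keeps the sum over y
        under control.\<close>
      moreover have "real (cont y) / L = real (cont y) / (2 * L) + real (cont y) / (2 * L)" by simp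
      moreover have "real (cont y) / (2 * L) = real (cont y) / L / 2" by simp
      ultimately have "- real (cont (x @ y)) / N \<le> - H / 2 + - real (cont y) / (2 * L)" by linarith
      then show "cmod (?z (x @ y)) \<le> exp (- H / 2) * exp (- real (cont y) / (2 * L))"
        unfolding norm_damped_power exp_add[symmetric] by simp
    qed
    also have "\<dots> \<le> (\<Sum>x\<in>?U. \<Sum>y\<in>?\<Omega>. exp (- H / 2) * exp (- real (cont y) / (2 * L)))"
    proof (intro sum_mono sum_mono2)
      fix x assume "x \<in> ?U" then show "Y x - V0 \<subseteq> ?\<Omega>" using Ysub by blast
    qed (auto simp: finite_words_upto)
    also have "\<dots> = real (card ?U) * exp (- H / 2) * (\<Sum>w\<in>?\<Omega>. exp (- real (cont w) / (2 * L)))"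
      by (simp add: sum_distrib_left[symmetric])
    finally show ?thesis .
  qed
  have "cmod (expsum N \<theta>) \<le> cmod S1 + cmod S2 + cmod S3 + cmod S4"
    unfolding eq by (meson norm_triangle_ineq norm_triangle_mono order_refl)
  then show ?thesis using b1 b2 b4 unfolding S3_def by linarith
qed

end

section \<open>Relative growth of the word count and reduction to counting pairs\<close>

locale dense_alphabet = alphabet +
  fixes s c0 :: real
  assumes s_bounds: "7/8 < s" "s < 9/10" and c0_pos: "0 < c0"
    and stop_words_lower: "1 \<le> M \<Longrightarrow> c0 * M powr (2 * s) \<le> real (card (stop_words M))"
begin

lemma stop_words_mult_le:
  "\<exists>C>0. \<forall>M X. 1 \<le> M \<longrightarrow> real (card (stop_words M)) * word_count X \<le> C * word_count (M * X)"
proof -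
  define C where "C = doubling * (2 * (amax + 1)) powr growth_exp"
  have "0 < C" using doubling_ge_2 amax_ge_1 by (simp add: C_def)
  moreover have "real (card (stop_words M)) * word_count X \<le> C * word_count (M * X)" if "1 \<le> M" for M X
  proof (cases "1 \<le> X")
    case True
    then show ?thesis using stop_words_mult_word_count[OF that True] by (simp add: C_def)
  next
    case False
    then show ?thesis using word_count_eq_0[of X] word_count_nonneg \<open>0 < C\<close> by simp
  qed
  ultimately show ?thesis by blast
qed

text \<open>Prefixing the c0 Y^(2s) stopping words of level Y multiplies the count accordingly. This
  replaces any asymptotic formula for the number of words.\<close>

lemma word_count_dilate:
  "\<exists>C>0. \<forall>X Y. 1 \<le> Y \<longrightarrow> word_count X * Y powr (2 * s) \<le> C * word_count (X * Y)"
proof -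
  obtain C where C: "0 < C" "\<And>M X. 1 \<le> M \<Longrightarrow> real (card (stop_words M)) * word_count X \<le> C * word_count (M * X)"
    using stop_words_mult_le by blast
  have "word_count X * Y powr (2 * s) \<le> (C / c0) * word_count (X * Y)" if "1 \<le> Y" for X Y
  proof -
    have "(c0 * Y powr (2 * s)) * word_count X \<le> real (card (stop_words Y)) * word_count X"
      using stop_words_lower[OF that] word_count_nonneg by (intro mult_right_mono) auto
    also have "\<dots> \<le> C * word_count (Y * X)" by (rule C(2)[OF that])
    finally show ?thesis using c0_pos by (simp add: field_simps)
  qed
  moreover have "0 < C / c0" using C c0_pos by simp
  ultimately show ?thesis by blast
qed

text \<open>The factor 1 + H L / X from counting \<theta>' grows for short suffixes, but their
  number shrinks faster: for X \<le> L one has L / X \<le> (L / X)^(2s), which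
  \<open>word_count_dilate\<close> absorbs. For X between L and L H everything is a power of
  H.\<close>

lemma word_count_cut:
  "\<exists>C>0. \<forall>(L::real) (G::real) (X::real) (H::real). 0 < G \<longrightarrow> 1 \<le> L / G \<longrightarrow> 0 < X \<longrightarrow> 1 \<le> H \<longrightarrow> X \<le> L * H \<longrightarrow>
     word_count (2 * X / G) * (1 + H * L / X) \<le> C * H powr (growth_exp + 1) * word_count (L / G)"
proof -
  obtain C where C: "0 < C" "\<And>X Y. 1 \<le> Y \<Longrightarrow> word_count X * Y powr (2 * s) \<le> C * word_count (X * Y)"
    using word_count_dilate by blast
  define C' where "C' = 2 * C * doubling + 2 * doubling * 2 powr growth_exp"
  have C'pos: "0 < C'" using C(1) doubling_ge_2 by (simp add: C'_def add_pos_pos)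
  have C'ge: "2 * C * doubling \<le> C'" "2 * doubling * 2 powr growth_exp \<le> C'"
    using C(1) doubling_ge_2 by (auto simp: C'_def)
  have "word_count (2 * X / G) * (1 + H * L / X) \<le> C' * H powr (growth_exp + 1) * word_count (L / G)"
    if G: "0 < G" and LG: "1 \<le> L / G" and X: "0 < X" and H: "1 \<le> H" and XL: "X \<le> L * H" for L G X H
  proof (cases "X \<le> L")
    case True
    define lam where "lam = L / X"
    have lam: "1 \<le> lam" using True X by (simp add: lam_def)
    have "1 * 1 \<le> H * lam" using lam H by (intro mult_mono) auto
    then have "1 + H * L / X \<le> 2 * H * lam" by (simp add: lam_def)
    also have "\<dots> \<le> 2 * H * lam powr (2 * s)"
      using powr_mono[of 1 "2 * s" lam] s_bounds lam H by (intro mult_left_mono) auto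
    finally have "word_count (2 * X / G) * (1 + H * L / X) \<le> word_count (2 * X / G) * (2 * H * lam powr (2 * s))"
      using word_count_nonneg by (intro mult_left_mono) auto
    also have "\<dots> = 2 * H * (word_count (2 * X / G) * lam powr (2 * s))" by simp
    also have "\<dots> \<le> 2 * H * (C * word_count (2 * X / G * lam))"
      using C(2)[OF lam, of "2 * X / G"] H by (intro mult_left_mono) auto
    also have "2 * X / G * lam = 2 * (L / G)" using X by (simp add: lam_def)
    also have "2 * H * (C * word_count (2 * (L / G))) \<le> 2 * H * (C * (doubling * word_count (L / G)))"
      using word_count_double[OF LG] C(1) H by (intro mult_left_mono) auto
    also have "\<dots> = (2 * C * doubling) * (H powr 1) * word_count (L / G)" using H by simp
    also have "\<dots> \<le> C' * H powr (growth_exp + 1) * word_count (L / G)"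
      using C'ge C'pos H growth_exp_ge_1 word_count_nonneg C(1) doubling_ge_2
      by (intro mult_right_mono mult_mono powr_mono) auto
    finally show ?thesis .
  next
    case False
    have L0: "0 < L" using LG G by (metis divide_pos_pos less_le_trans zero_less_divide_iff zero_less_one not_less_iff_gr_or_eq)
    have "H * L / X \<le> H * L / L" using False L0 H X by (intro divide_left_mono) auto
    then have a: "1 + H * L / X \<le> 2 * H" using L0 H by simp
    have "2 * X / G \<le> 2 * (L * H) / G" using XL G by (intro divide_right_mono) auto
    then have "2 * X / G \<le> (2 * H) * (L / G)" by (simp add: ac_simps)
    then have "word_count (2 * X / G) \<le> word_count ((2 * H) * (L / G))" by (rule word_count_mono)
    also have "\<dots> \<le> doubling * (2 * H) powr growth_exp * word_count (L / G)"
      using LG H by (intro word_count_scale) auto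
    finally have b: "word_count (2 * X / G) \<le> doubling * (2 * H) powr growth_exp * word_count (L / G)" .
    have "word_count (2 * X / G) * (1 + H * L / X) \<le> (doubling * (2 * H) powr growth_exp * word_count (L / G)) * (2 * H)"
      using a b H X L0 word_count_nonneg doubling_ge_2 by (intro mult_mono mult_nonneg_nonneg) auto
    also have "\<dots> = (2 * doubling * 2 powr growth_exp) * H powr (growth_exp + 1) * word_count (L / G)"
      using H by (simp add: powr_mult powr_add)
    also have "\<dots> \<le> C' * H powr (growth_exp + 1) * word_count (L / G)"
      using C'ge word_count_nonneg by (intro mult_right_mono) auto
    finally show ?thesis .
  qed
  then show ?thesis using C'pos by blast
qed

text \<open>Three parts of \<open>expsum_split\<close> are bounded pointwise by relative growth:
  words below M save (N/M)^(-4s), short suffixes B^(-4s), long ones exp (-H). The sieve handles the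
  dyadic blocks, where block i uses X = 2^i (N/M) / B; this is why D must bound the coincidences for
  all X in the range.\<close>

lemma mean_square_reduction:
  "\<exists>C>0. \<forall>N M H B \<Theta> D. 0 < N \<longrightarrow> 1 < M \<longrightarrow> M \<le> real N \<longrightarrow> 1 \<le> H \<longrightarrow> 1 \<le> B \<longrightarrow>
     2 * (amax + 1) * H \<le> real N \<longrightarrow> \<Theta> \<subseteq> grid N \<longrightarrow> 0 \<le> D \<longrightarrow>
     (\<forall>\<theta>\<in>\<Theta>. \<forall>X V. real N / M / B \<le> X \<longrightarrow> X \<le> real N / M * H \<longrightarrow>
        V \<subseteq> {w \<in> lists A. X \<le> real (cont w) \<and> real (cont w) \<le> 2 * X} \<longrightarrow>
        (\<Sum>w\<in>V. \<Sum>w'\<in>V. real (card {\<theta>'\<in>\<Theta>. near_vec (H / M) \<theta> w \<theta>' w'})) \<le> D) \<longrightarrow>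
     (\<Sum>\<theta>\<in>\<Theta>. (cmod (expsum N \<theta>))\<^sup>2) \<le>
       C * ((word_count N)\<^sup>2 * real (card \<Theta>) *
              ((real N / M) powr (- 4 * s) + B powr (- 4 * s) + exp (- H)) +
            (2 + log 2 (B * H))\<^sup>2 * real (card (stop_words M)) * M\<^sup>2 *
              (D + (word_count (real N / M * H))\<^sup>2 * real (card \<Theta>) / H ^ Suc k))"
proof -
  obtain C1 where C1: "0 < C1" "\<And>M X. 1 \<le> M \<Longrightarrow> real (card (stop_words M)) * word_count X \<le> C1 * word_count (M * X)"
    using stop_words_mult_le by blast
  obtain C2 where C2: "0 < C2" "\<And>X Y. 1 \<le> Y \<Longrightarrow> word_count X * Y powr (2 * s) \<le> C2 * word_count (X * Y)"
    using word_count_dilate by blast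
  obtain C3 where C3: "0 < C3" "\<And>Y Z. 1 \<le> Y \<Longrightarrow> (\<Sum>w\<in>words_upto Z. exp (- real (cont w) / Y)) \<le> C3 * word_count Y"
    using exp_sum_words by blast
  obtain C4 where C4: "0 < C4" "\<And>N \<Theta> V M H Bd. 0 < N \<Longrightarrow> finite \<Theta> \<Longrightarrow> finite V \<Longrightarrow> V \<subseteq> lists A \<Longrightarrow> 1 < M \<Longrightarrow> 1 \<le> H \<Longrightarrow> 0 \<le> Bd \<Longrightarrow>
     (\<forall>\<theta>\<in>\<Theta>. (\<Sum>w\<in>V. \<Sum>w'\<in>V. real (card {\<theta>'\<in>\<Theta>. near_vec (H / M) \<theta> w \<theta>' w'})) \<le> Bd) \<Longrightarrow>
     (\<Sum>\<theta>\<in>\<Theta>. (cmod (\<Sum>x\<in>stop_words M. \<Sum>w\<in>V. damped N \<theta> ^ cont (x @ w)))\<^sup>2)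
       \<le> C4 * real (card (stop_words M)) * M\<^sup>2 * (Bd + real (card V) ^ 2 * real (card \<Theta>) / H ^ Suc k)"
    using bilinear_large_sieve[of k] by blast
  define c1 where "c1 = C2\<^sup>2"
  define c2 where "c2 = (C1 * C2)\<^sup>2"
  define c4 where "c4 = (C1 * C3 * doubling)\<^sup>2"
  define C where "C = 4 * (c1 + c2 + c4 + C4)"
  have pos: "0 < c1" "0 < c2" "0 < c4" using C1 C2 C3 doubling_ge_2 by (auto simp: c1_def c2_def c4_def)
  then have "0 < C" using C4 by (simp add: C_def)
  moreover have "(\<Sum>\<theta>\<in>\<Theta>. (cmod (expsum N \<theta>))\<^sup>2) \<le>
       C * ((word_count N)\<^sup>2 * real (card \<Theta>) *
              ((real N / M) powr (- 4 * s) + B powr (- 4 * s) + exp (- H)) +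
            (2 + log 2 (B * H))\<^sup>2 * real (card (stop_words M)) * M\<^sup>2 *
              (D + (word_count (real N / M * H))\<^sup>2 * real (card \<Theta>) / H ^ Suc k))"
    if N: "0 < N" and M: "1 < M" "M \<le> real N" and H: "1 \<le> H" and B: "1 \<le> B"
      and HN: "2 * (amax + 1) * H \<le> real N" and \<Theta>: "\<Theta> \<subseteq> grid N" and D0: "0 \<le> D"
      and D: "\<forall>\<theta>\<in>\<Theta>. \<forall>X V. real N / M / B \<le> X \<longrightarrow> X \<le> real N / M * H \<longrightarrow>
        V \<subseteq> {w \<in> lists A. X \<le> real (cont w) \<and> real (cont w) \<le> 2 * X} \<longrightarrow>
        (\<Sum>w\<in>V. \<Sum>w'\<in>V. real (card {\<theta>'\<in>\<Theta>. near_vec (H / M) \<theta> w \<theta>' w'})) \<le> D"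
    for N M H B \<Theta> D
  proof -
    define L where "L = real N / M"
    have L1: "1 \<le> L" using M by (simp add: L_def)
    have LM_eq: "M * L = N" using M by (simp add: L_def)
    have BH: "1 * 1 \<le> B * H" using B H by (intro mult_mono) auto
    define f where "f = real (card (stop_words M))"
    define gN where "gN = word_count N"
    have gN0: "0 \<le> gN" by (simp add: gN_def word_count_nonneg)
    have fin\<Theta>: "finite \<Theta>" using \<Theta> finite_grid finite_subset by blast
    define n where "n = nat \<lfloor>log 2 (B * H)\<rfloor> + 1"
    have lg: "0 \<le> log 2 (B * H)" using BH by simp
    have n1: "log 2 (B * H) < n" "real n \<le> 2 + log 2 (B * H)" using lg unfolding n_def by linarith+
    have n2: "B * H < 2 ^ n"
    proof -
      have "B * H = 2 powr (log 2 (B * H))" using BH by simp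
      also have "\<dots> < 2 powr n" using n1 by simp
      finally show ?thesis by (simp add: powr_realpow)
    qed
    define V where "V = (\<lambda>i::nat. {w \<in> words_upto (L * H). 2 ^ i * (L / B) \<le> cont w \<and> cont w < 2 ^ Suc i * (L / B)})"
    define P where "P = (\<lambda>i \<theta>. \<Sum>x\<in>stop_words M. \<Sum>w\<in>V i. damped N \<theta> ^ cont (x @ w))"
    define E where "E = (\<Sum>w\<in>words_upto ((real N)\<^sup>2). exp (- real (cont w) / (2 * L)))"
    have fgL: "f * word_count L \<le> C1 * gN" using C1(2)[of M L] M LM_eq by (simp add: f_def gN_def)
    have t1: "(word_count M)\<^sup>2 \<le> c1 * (gN\<^sup>2 * L powr (- 4 * s))"
    proof -
      have "word_count M * L powr (2 * s) \<le> C2 * gN" using C2(2)[OF L1, of M] LM_eq by (simp add: gN_def)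
      then have "word_count M * L powr (2 * s) * L powr (- 2 * s) \<le> C2 * gN * L powr (- 2 * s)"
        by (intro mult_right_mono) auto
      moreover have "word_count M * L powr (2 * s) * L powr (- 2 * s) = word_count M"
        using L1 by (simp add: mult.assoc powr_add[symmetric])
      ultimately have "word_count M \<le> C2 * gN * L powr (- 2 * s)" by (simp only:)
      then have "(word_count M)\<^sup>2 \<le> (C2 * gN * L powr (- 2 * s))\<^sup>2"
        using word_count_nonneg by (intro power_mono) auto
      also have "\<dots> = c1 * (gN\<^sup>2 * (L powr (- 2 * s))\<^sup>2)" by (simp add: c1_def power_mult_distrib)
      also have "(L powr (- 2 * s))\<^sup>2 = L powr (- 4 * s)"
        using L1 by (simp add: power2_eq_square powr_add[symmetric])
      finally show ?thesis .
    qed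
    have t2: "(f * word_count (L / B))\<^sup>2 \<le> c2 * (gN\<^sup>2 * B powr (- 4 * s))"
    proof -
      have "word_count (L / B) * B powr (2 * s) \<le> C2 * word_count L" using C2(2)[OF B, of "L / B"] B by simp
      then have "word_count (L / B) * B powr (2 * s) * B powr (- 2 * s) \<le> C2 * word_count L * B powr (- 2 * s)"
        by (intro mult_right_mono) auto
      moreover have "word_count (L / B) * B powr (2 * s) * B powr (- 2 * s) = word_count (L / B)"
        using B by (simp add: mult.assoc powr_add[symmetric])
      ultimately have "word_count (L / B) \<le> C2 * word_count L * B powr (- 2 * s)" by (simp only:)
      then have "f * word_count (L / B) \<le> f * (C2 * word_count L * B powr (- 2 * s))"
        by (intro mult_left_mono) (auto simp: f_def)
      also have "\<dots> = C2 * B powr (- 2 * s) * (f * word_count L)" by simp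
      also have "\<dots> \<le> C2 * B powr (- 2 * s) * (C1 * gN)" using fgL C2(1) by (intro mult_left_mono) auto
      finally have "(f * word_count (L / B))\<^sup>2 \<le> (C2 * B powr (- 2 * s) * (C1 * gN))\<^sup>2"
        using word_count_nonneg by (intro power_mono) (auto simp: f_def)
      also have "\<dots> = c2 * (gN\<^sup>2 * (B powr (- 2 * s))\<^sup>2)" by (simp add: c2_def power_mult_distrib)
      also have "(B powr (- 2 * s))\<^sup>2 = B powr (- 4 * s)"
        using B by (simp add: power2_eq_square powr_add[symmetric])
      finally show ?thesis .
    qed
    have t4: "(f * exp (- H / 2) * E)\<^sup>2 \<le> c4 * (gN\<^sup>2 * exp (- H))"
    proof -
      have "E \<le> C3 * word_count (2 * L)" unfolding E_def using L1 by (intro C3(2)) auto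
      also have "\<dots> \<le> C3 * (doubling * word_count L)"
        using word_count_double[OF L1] C3(1) by (intro mult_left_mono) auto
      finally have "f * exp (- H / 2) * E \<le> f * exp (- H / 2) * (C3 * (doubling * word_count L))"
        by (intro mult_left_mono) (auto simp: f_def)
      also have "\<dots> = C3 * doubling * exp (- H / 2) * (f * word_count L)" by simp
      also have "\<dots> \<le> C3 * doubling * exp (- H / 2) * (C1 * gN)"
        using fgL C3(1) doubling_ge_2 by (intro mult_left_mono) auto
      finally have "(f * exp (- H / 2) * E)\<^sup>2 \<le> (C3 * doubling * exp (- H / 2) * (C1 * gN))\<^sup>2"
        by (intro power_mono) (auto simp: f_def E_def intro!: mult_nonneg_nonneg sum_nonneg)
      also have "\<dots> = c4 * (gN\<^sup>2 * (exp (- H / 2))\<^sup>2)" by (simp add: c4_def power_mult_distrib)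
      also have "(exp (- H / 2))\<^sup>2 = exp (- H)" by (simp add: power2_eq_square exp_add[symmetric])
      finally show ?thesis .
    qed
    let ?W = "f * M\<^sup>2 * (D + (word_count (L * H))\<^sup>2 * real (card \<Theta>) / H ^ Suc k)"
    have W0: "0 \<le> ?W" using D0 H by (simp add: f_def)
    have CW0: "0 \<le> C4 * ?W" by (rule mult_nonneg_nonneg[OF _ W0]) (use C4(1) in simp)
    have lW0: "0 \<le> (2 + log 2 (B * H))\<^sup>2 * ?W" by (rule mult_nonneg_nonneg[OF _ W0]) simp
    have P: "(\<Sum>\<theta>\<in>\<Theta>. (cmod (P i \<theta>))\<^sup>2) \<le> C4 * ?W" for i
    proof -
      have fV: "finite (V i)" by (simp add: V_def finite_words_upto)
      have cV: "real (card (V i)) \<le> word_count (L * H)"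
        unfolding word_count_def using finite_words_upto by (intro of_nat_mono card_mono) (auto simp: V_def)
      have cnt: "(\<Sum>w\<in>V i. \<Sum>w'\<in>V i. real (card {\<theta>'\<in>\<Theta>. near_vec (H / M) \<theta> w \<theta>' w'})) \<le> D"
        if \<theta>: "\<theta> \<in> \<Theta>" for \<theta>
      proof (cases "V i = {}")
        case False
        let ?X = "2 ^ i * (L / B)"
        have "?X \<le> L * H" using False by (auto simp: V_def words_upto_def)
        moreover have "1 * (L / B) \<le> ?X" using L1 B by (intro mult_right_mono) auto
        moreover have "V i \<subseteq> {w \<in> lists A. ?X \<le> real (cont w) \<and> real (cont w) \<le> 2 * ?X}"
          by (auto simp: V_def words_upto_def)
        ultimately show ?thesis using D \<theta> unfolding L_def by auto
      qed (use D0 in simp)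
      have "(\<Sum>\<theta>\<in>\<Theta>. (cmod (P i \<theta>))\<^sup>2) \<le> C4 * f * M\<^sup>2 * (D + real (card (V i)) ^ 2 * real (card \<Theta>) / H ^ Suc k)"
        unfolding P_def f_def using N fin\<Theta> fV M(1) H D0 cnt
        by (intro C4(2)) (auto simp: V_def words_upto_def)
      also have "\<dots> \<le> C4 * f * M\<^sup>2 * (D + (word_count (L * H))\<^sup>2 * real (card \<Theta>) / H ^ Suc k)"
        using cV C4(1) H by (intro mult_left_mono add_left_mono divide_right_mono mult_right_mono power_mono)
          (auto simp: f_def)
      finally show ?thesis by (simp add: mult.assoc)
    qed
    have pt: "(cmod (expsum N \<theta>))\<^sup>2 \<le> 4 * (c1 * (gN\<^sup>2 * L powr (- 4 * s)) + c2 * (gN\<^sup>2 * B powr (- 4 * s))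
        + real n * (\<Sum>i<n. (cmod (P i \<theta>))\<^sup>2) + c4 * (gN\<^sup>2 * exp (- H)))" for \<theta>
    proof -
      have "cmod (expsum N \<theta>) \<le> word_count M + f * word_count (L / B) + cmod (\<Sum>i<n. P i \<theta>) + f * exp (- H / 2) * E"
        using expsum_split[OF N M(1) H HN L_def B n2, of \<theta>] unfolding P_def V_def f_def E_def .
      then have "(cmod (expsum N \<theta>))\<^sup>2 \<le> (word_count M + f * word_count (L / B) + cmod (\<Sum>i<n. P i \<theta>) + f * exp (- H / 2) * E)\<^sup>2"
        by (intro power_mono) auto
      also have "\<dots> \<le> 4 * ((word_count M)\<^sup>2 + (f * word_count (L / B))\<^sup>2 + (cmod (\<Sum>i<n. P i \<theta>))\<^sup>2 + (f * exp (- H / 2) * E)\<^sup>2)"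
        by (rule sum4_square_le)
      \<comment> \<open>Cauchy--Schwarz over the n blocks costs one factor n and summing their
        bounds another, hence the squared logarithm.\<close>
      also have "(cmod (\<Sum>i<n. P i \<theta>))\<^sup>2 \<le> real n * (\<Sum>i<n. (cmod (P i \<theta>))\<^sup>2)"
      proof -
        have "(cmod (\<Sum>i<n. P i \<theta>))\<^sup>2 \<le> (\<Sum>i<n. cmod (P i \<theta>))\<^sup>2" by (intro power_mono norm_sum) auto
        also have "\<dots> \<le> (\<Sum>i<n. (cmod (P i \<theta>))\<^sup>2) * card {..<n}" by (rule sum_squared_le_sum_of_squares)
        finally show ?thesis by (simp add: mult.commute)
      qed
      finally show ?thesis using t1 t2 t4 by (smt (verit) mult_left_mono)
    qed
    let ?G = "gN\<^sup>2 * real (card \<Theta>)"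
    have "(\<Sum>\<theta>\<in>\<Theta>. (cmod (expsum N \<theta>))\<^sup>2) \<le> (\<Sum>\<theta>\<in>\<Theta>. 4 * (c1 * (gN\<^sup>2 * L powr (- 4 * s)) + c2 * (gN\<^sup>2 * B powr (- 4 * s))
        + real n * (\<Sum>i<n. (cmod (P i \<theta>))\<^sup>2) + c4 * (gN\<^sup>2 * exp (- H))))" by (intro sum_mono pt)
    also have "\<dots> = 4 * (c1 * (?G * L powr (- 4 * s)) + c2 * (?G * B powr (- 4 * s))
        + real n * (\<Sum>i<n. \<Sum>\<theta>\<in>\<Theta>. (cmod (P i \<theta>))\<^sup>2) + c4 * (?G * exp (- H)))"
    proof -
      have "(\<Sum>\<theta>\<in>\<Theta>. \<Sum>i<n. (cmod (P i \<theta>))\<^sup>2) = (\<Sum>i<n. \<Sum>\<theta>\<in>\<Theta>. (cmod (P i \<theta>))\<^sup>2)" by (rule sum.swap)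
      then show ?thesis by (simp add: sum.distrib sum_distrib_left[symmetric] algebra_simps)
    qed
    also have "(\<Sum>i<n. \<Sum>\<theta>\<in>\<Theta>. (cmod (P i \<theta>))\<^sup>2) \<le> (\<Sum>i<n. C4 * ?W)" by (intro sum_mono P)
    also have "\<dots> = real n * (C4 * ?W)" by simp
    also have "real n * (real n * (C4 * ?W)) = (real n)\<^sup>2 * (C4 * ?W)" by (simp add: power2_eq_square)
    also have "(real n)\<^sup>2 * (C4 * ?W) \<le> (2 + log 2 (B * H))\<^sup>2 * (C4 * ?W)"
      using n1 CW0 by (intro mult_right_mono power_mono) auto
    finally have fin: "(\<Sum>\<theta>\<in>\<Theta>. (cmod (expsum N \<theta>))\<^sup>2) \<le> 4 * (c1 * (?G * L powr (- 4 * s)) + c2 * (?G * B powr (- 4 * s))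
        + (2 + log 2 (B * H))\<^sup>2 * (C4 * ?W) + c4 * (?G * exp (- H)))" by (simp add: mult_left_mono)
    have "4 * (c1 * (?G * L powr (- 4 * s)) + c2 * (?G * B powr (- 4 * s))
        + (2 + log 2 (B * H))\<^sup>2 * (C4 * ?W) + c4 * (?G * exp (- H)))
        = 4 * c1 * (?G * L powr (- 4 * s)) + 4 * c2 * (?G * B powr (- 4 * s)) + 4 * c4 * (?G * exp (- H))
          + 4 * C4 * ((2 + log 2 (B * H))\<^sup>2 * ?W)" by (simp add: algebra_simps)
    also have "\<dots> \<le> C * (?G * L powr (- 4 * s)) + C * (?G * B powr (- 4 * s)) + C * (?G * exp (- H))
          + C * ((2 + log 2 (B * H))\<^sup>2 * ?W)"
      using pos C4(1) lW0 by (intro add_mono mult_right_mono) (auto simp: C_def)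
    also have "\<dots> = C * (?G * (L powr (- 4 * s) + B powr (- 4 * s) + exp (- H)) + (2 + log 2 (B * H))\<^sup>2 * ?W)"
      by (simp only: distrib_left add.assoc)
    finally show ?thesis using fin unfolding gN_def f_def L_def by (simp only: mult.assoc)
  qed
  ultimately show ?thesis by blast
qed

end

subsection \<open>Mean squares over the arcs\<close>

lemma exp_minus_le_powr:
  fixes p :: real
  shows "\<exists>C>0. \<forall>x\<ge>1. exp (- x) \<le> C * x powr (- p)"
proof -
  define m where "m = Suc (nat \<lceil>p\<rceil>)"
  have m: "p \<le> m" "0 < m" unfolding m_def by linarith+
  have "exp (- x) \<le> real m ^ m * x powr (- p)" if x: "1 \<le> x" for x :: real
  proof -
    have "(x / m) ^ m \<le> exp (x / m) ^ m"
    proof (rule power_mono)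
      show "x / m \<le> exp (x / m)" using exp_ge_add_one_self[of "x / m"] by linarith
    qed (use x in simp)
    also have "\<dots> = exp x" using m by (simp add: exp_of_nat_mult[symmetric])
    finally have "inverse (exp x) \<le> inverse ((x / m) ^ m)" using x m by (intro le_imp_inverse_le) auto
    moreover have "inverse ((x / m) ^ m) = real m ^ m * x powr (- real m)"
      using x m(2) by (simp add: power_divide powr_minus powr_realpow field_simps)
    ultimately have "exp (- x) \<le> real m ^ m * x powr (- real m)" by (simp only: exp_minus)
    also have "\<dots> \<le> real m ^ m * x powr (- p)" using m x by (intro mult_left_mono powr_mono) auto
    finally show ?thesis .
  qed
  moreover have "0 < real m ^ m" using m by simp
  ultimately show ?thesis by blast
qed

lemma log_square_le_powr:
  fixes a :: real
  assumes "0 < a"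
  shows "\<exists>C>0. \<forall>x\<ge>1. (2 + log 2 x)\<^sup>2 \<le> C * x powr a"
proof -
  define b where "b = a / 2"
  have b: "0 < b" using assms by (simp add: b_def)
  define C where "C = 2 + 1 / (b * ln 2)"
  have C: "0 < C" using b by (simp add: C_def add_pos_pos)
  have "(2 + log 2 x)\<^sup>2 \<le> C\<^sup>2 * x powr a" if x: "1 \<le> x" for x :: real
  proof -
    have "ln x \<le> x powr b / b" by (rule ln_powr_bound[OF x b])
    then have "log 2 x \<le> x powr b / b / ln 2" unfolding log_def by (intro divide_right_mono) auto
    moreover have "1 \<le> x powr b" using x b by (simp add: ge_one_powr_ge_zero)
    ultimately have "2 + log 2 x \<le> C * x powr b" by (simp add: C_def algebra_simps)
    then have "(2 + log 2 x)\<^sup>2 \<le> (C * x powr b)\<^sup>2" using x by (intro power_mono) auto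
    also have "\<dots> = C\<^sup>2 * x powr a" using x by (simp add: power_mult_distrib b_def power2_eq_square powr_add[symmetric])
    finally show ?thesis .
  qed
  then show ?thesis using C by (intro exI[of _ "C\<^sup>2"]) auto
qed

context dense_alphabet
begin

text \<open>With f the number of stopping words, f g(L)^2 is (f g(L))^2 / f: concatenation bounds
  the numerator by g(M L)^2, and f >> M^(2s) the quotient. This quantifies the loss of completing
  the sum over x.\<close>

lemma stop_words_square_le:
  "\<exists>C>0. \<forall>M L. 1 \<le> M \<longrightarrow> real (card (stop_words M)) * M\<^sup>2 * (word_count L)\<^sup>2
      \<le> C * M powr (2 - 2 * s) * (word_count (M * L))\<^sup>2"
proof -
  obtain C1 where C1: "0 < C1" "\<And>M X. 1 \<le> M \<Longrightarrow> real (card (stop_words M)) * word_count X \<le> C1 * word_count (M * X)"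
    using stop_words_mult_le by blast
  have "real (card (stop_words M)) * M\<^sup>2 * (word_count L)\<^sup>2
      \<le> (C1\<^sup>2 / c0) * M powr (2 - 2 * s) * (word_count (M * L))\<^sup>2" if M: "1 \<le> M" for M L
  proof -
    define f where "f = real (card (stop_words M))"
    have f: "c0 * M powr (2 * s) \<le> f" using stop_words_lower[OF M] by (simp add: f_def)
    have lo: "0 < c0 * M powr (2 * s)" using c0_pos M by simp
    have "(f * word_count L)\<^sup>2 \<le> (C1 * word_count (M * L))\<^sup>2"
      using C1(2)[OF M, of L] word_count_nonneg by (intro power_mono) (auto simp: f_def)
    then have "(f * word_count L)\<^sup>2 * M\<^sup>2 / f \<le> (C1 * word_count (M * L))\<^sup>2 * M\<^sup>2 / f"
      using lo f by (intro divide_right_mono mult_right_mono) auto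
    also have "\<dots> \<le> (C1 * word_count (M * L))\<^sup>2 * M\<^sup>2 / (c0 * M powr (2 * s))"
      using lo f by (intro divide_left_mono mult_pos_pos[of f]) auto
    also have "\<dots> = (C1\<^sup>2 / c0) * (M powr 2 / M powr (2 * s)) * (word_count (M * L))\<^sup>2"
      using M by (simp add: power_mult_distrib powr_numeral)
    also have "M powr 2 / M powr (2 * s) = M powr (2 - 2 * s)" by (simp add: powr_diff)
    finally have "(f * word_count L)\<^sup>2 * M\<^sup>2 / f \<le> C1\<^sup>2 / c0 * M powr (2 - 2 * s) * (word_count (M * L))\<^sup>2" .
    moreover have "(f * word_count L)\<^sup>2 * M\<^sup>2 / f = f * M\<^sup>2 * (word_count L)\<^sup>2"
      using lo f by (simp add: power2_eq_square)
    ultimately show ?thesis by (simp only: f_def)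
  qed
  moreover have "0 < C1\<^sup>2 / c0" using C1 c0_pos by simp
  ultimately show ?thesis by blast
qed

text \<open>With R = Q K the arc has O(R^2) points, so pointwise errors must save more than R^2
  against g(N)^2. The parameters M, H and B are bounded by powers of R, which keeps N / M large, and
  a surplus R^(-1/10) remains for the summation over dyadic arcs.\<close>

lemma major_arc_mean_square:
  "\<exists>C>0. \<exists>N0. \<forall>N Q K. N0 \<le> real N \<longrightarrow> 1 \<le> Q \<longrightarrow> 1 \<le> K \<longrightarrow> Q * K \<le> 8 * real N powr (1/4) \<longrightarrow>
     (\<Sum>\<theta>\<in>major_arc N Q K. (cmod (expsum N \<theta>))\<^sup>2) \<le> C * (word_count N)\<^sup>2 * (Q * K) powr (- 1/10)"
proof -
  define c where "c = growth_exp"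
  have c1: "1 \<le> c" using growth_exp_ge_1 by (simp add: c_def)
  \<comment> \<open>H enters the main term with exponent 2 c + 4: 2 c + 2 from D, one from the
    logarithm and one from M. The total cost is R^(1/8), half of the saving R^(1/4).\<close>
  define h where "h = 1 / (8 * (2 * c + 4))"
  have h: "0 < h" "h \<le> 1/48" "h * (2 * c + 4) = 1/8" using c1 by (auto simp: h_def field_simps)
  \<comment> \<open>This makes the powers of H in the sieve error at most R^(-3), enough against R^2
    points and the loss R^(1/2).\<close>
  define k where "k = nat \<lceil>2 * c + 3 + 3 / h\<rceil>"
  have k: "2 * c + 3 + 3 / h \<le> k" unfolding k_def by linarith
  obtain Cr where Cr: "0 < Cr" and reduction: "\<And>N M H B \<Theta> D. 0 < N \<Longrightarrow> 1 < M \<Longrightarrow> M \<le> real N \<Longrightarrow> 1 \<le> H \<Longrightarrow> 1 \<le> B \<Longrightarrow>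
     2 * (amax + 1) * H \<le> real N \<Longrightarrow> \<Theta> \<subseteq> grid N \<Longrightarrow> 0 \<le> D \<Longrightarrow>
     (\<forall>\<theta>\<in>\<Theta>. \<forall>X V. real N / M / B \<le> X \<longrightarrow> X \<le> real N / M * H \<longrightarrow>
        V \<subseteq> {w \<in> lists A. X \<le> real (cont w) \<and> real (cont w) \<le> 2 * X} \<longrightarrow>
        (\<Sum>w\<in>V. \<Sum>w'\<in>V. real (card {\<theta>'\<in>\<Theta>. near_vec (H / M) \<theta> w \<theta>' w'})) \<le> D) \<Longrightarrow>
     (\<Sum>\<theta>\<in>\<Theta>. (cmod (expsum N \<theta>))\<^sup>2) \<le>
       Cr * ((word_count N)\<^sup>2 * real (card \<Theta>) *
              ((real N / M) powr (- 4 * s) + B powr (- 4 * s) + exp (- H)) +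
            (2 + log 2 (B * H))\<^sup>2 * real (card (stop_words M)) * M\<^sup>2 *
              (D + (word_count (real N / M * H))\<^sup>2 * real (card \<Theta>) / H ^ Suc k))"
    using mean_square_reduction[of k] by blast
  obtain Cp where Cp: "0 < Cp" and pairs: "\<And>N (Q::real) (K::real) (X::real) (\<kappa>::real) \<theta> V. 0 < N \<Longrightarrow> 1 \<le> Q \<Longrightarrow> 1 \<le> K \<Longrightarrow> 0 < X \<Longrightarrow> 0 \<le> \<kappa> \<Longrightarrow>
     2 * (amax + 1) * sqrt K * Q \<le> X \<Longrightarrow> \<kappa> + 4 * K * X / real N < 1 / Q\<^sup>2 \<Longrightarrow> \<theta> \<in> major_arc N Q K \<Longrightarrow>
     V \<subseteq> {w \<in> lists A. X \<le> real (cont w) \<and> real (cont w) \<le> 2 * X} \<Longrightarrow>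
     (\<Sum>w\<in>V. \<Sum>w'\<in>V. real (card {\<theta>'\<in>major_arc N Q K. near_vec \<kappa> \<theta> w \<theta>' w'}))
       \<le> Cp * real (card V) * (1 + \<kappa> * N / X)\<^sup>2 * word_count (2 * X / (sqrt K * Q)) * Q"
    using major_arc_pairs_le by blast
  obtain Cc where Cc: "0 < Cc" and cut: "\<And>(L::real) (G::real) (X::real) (H::real). 0 < G \<Longrightarrow> 1 \<le> L / G \<Longrightarrow> 0 < X \<Longrightarrow> 1 \<le> H \<Longrightarrow> X \<le> L * H \<Longrightarrow>
     word_count (2 * X / G) * (1 + H * L / X) \<le> Cc * H powr (c + 1) * word_count (L / G)"
    using word_count_cut unfolding c_def by blast
  obtain C2 where C2: "0 < C2" "\<And>X Y. 1 \<le> Y \<Longrightarrow> word_count X * Y powr (2 * s) \<le> C2 * word_count (X * Y)"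
    using word_count_dilate by blast
  obtain Cf where Cf: "0 < Cf" "\<And>M L. 1 \<le> M \<Longrightarrow> real (card (stop_words M)) * M\<^sup>2 * (word_count L)\<^sup>2
      \<le> Cf * M powr (2 - 2 * s) * (word_count (M * L))\<^sup>2"
    using stop_words_square_le by blast
  obtain Ce where Ce: "0 < Ce" "\<And>x. 1 \<le> x \<Longrightarrow> exp (- x) \<le> Ce * x powr (- (3 / h))"
    using exp_minus_le_powr by blast
  obtain Cl where Cl: "0 < Cl" "\<And>x. 1 \<le> x \<Longrightarrow> (2 + log 2 x)\<^sup>2 \<le> Cl * x powr h"
    using log_square_le_powr[OF h(1)] by blast
  define Cd where "Cd = Cp * Cc * Cc * C2"
  have Cd: "0 < Cd" using Cp Cc C2 by (simp add: Cd_def)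
  define C where "C = Cr * (12 * (2 + Ce) + Cl * (100 * Cf) * Cd + Cl * (100 * Cf) * (12 * doubling\<^sup>2))"
  have dbl: "0 < doubling" using doubling_ge_2 by simp
  have C0: "0 < C" unfolding C_def
    using Cr Ce(1) Cl(1) Cf(1) Cd dbl by (intro mult_pos_pos add_pos_pos) auto
  define W where "W = 200 * (amax + 1) * 8 powr (37/10)"
  define N0 where "N0 = max 1 (W powr (40/3))"
  have W0: "0 < W" using amax_ge_1 by (simp add: W_def)
  have "(\<Sum>\<theta>\<in>major_arc N Q K. (cmod (expsum N \<theta>))\<^sup>2) \<le> C * (word_count N)\<^sup>2 * (Q * K) powr (- 1/10)"
    if N: "N0 \<le> real N" and Q: "1 \<le> Q" and K: "1 \<le> K" and QK: "Q * K \<le> 8 * real N powr (1/4)" for N Q K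
  proof -
    define R where "R = Q * K"
    have N1: "1 \<le> real N" using N by (simp add: N0_def)
    have R: "1 \<le> R" "Q \<le> R" "K \<le> R"
      using mult_mono[of 1 Q 1 K] mult_left_mono[of 1 K Q] mult_right_mono[of 1 Q K] Q K by (auto simp: R_def)
    have Q2K: "Q\<^sup>2 * K \<le> R\<^sup>2"
    proof -
      have "Q\<^sup>2 * K = R * Q" by (simp add: R_def power2_eq_square)
      also have "\<dots> \<le> R * R" using R by (intro mult_left_mono) auto
      finally show ?thesis by (simp add: power2_eq_square)
    qed
    have sq: "1 \<le> sqrt K" "sqrt K \<le> K" using K by (auto simp: real_le_lsqrt power2_eq_square)
    define G where "G = sqrt K * Q"
    have G: "1 \<le> G" "G \<le> R"
      using mult_mono[of 1 "sqrt K" 1 Q] mult_right_mono[of "sqrt K" K Q] sq Q by (auto simp: G_def R_def mult.commute)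
    \<comment> \<open>R^(37/10) covers all sizes met below: M needs R^(2+h) with h \<le> 1/48, G at
      most R, and B another R^(3/5). As 37/10 times 1/4 is 37/40, a factor N^(3/40) is left for the
      constants; its reciprocal exponent appears in \<open>N0\<close>.\<close>
    have star: "200 * (amax + 1) * R powr (37/10) \<le> N"
    proof -
      have "R powr (37/10) \<le> (8 * real N powr (1/4)) powr (37/10)"
        using R QK unfolding R_def by (intro powr_mono2) auto
      also have "\<dots> = 8 powr (37/10) * real N powr (37/40)" by (simp add: powr_mult powr_powr)
      finally have "200 * (amax + 1) * R powr (37/10) \<le> 200 * (amax + 1) * (8 powr (37/10) * real N powr (37/40))"
        using amax_ge_1 by (intro mult_left_mono) auto
      also have "\<dots> = W * real N powr (37/40)" by (simp add: W_def)
      also have "W \<le> real N powr (3/40)"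
      proof -
        have "W = (W powr (40/3)) powr (3/40)" using W0 by (simp add: powr_powr)
        also have "\<dots> \<le> real N powr (3/40)" using N by (intro powr_mono2) (auto simp: N0_def)
        finally show ?thesis .
      qed
      then have "W * real N powr (37/40) \<le> real N powr (3/40) * real N powr (37/40)"
        by (intro mult_right_mono) auto
      also have "\<dots> = N" using N1 by (simp add: powr_add[symmetric])
      finally show ?thesis .
    qed
    define H where "H = R powr h"
    have H: "1 \<le> H" using R h by (simp add: H_def ge_one_powr_ge_zero)
    \<comment> \<open>Exactness asks for (1 + 4 K) H / M below the inverse square of Q. The left
      side is at most 5 K H / M, so 100 is ample.\<close>
    define M where "M = 100 * (Q\<^sup>2 * K * H)"
    have Q2K1: "1 \<le> Q\<^sup>2 * K" using Q K mult_mono[of 1 "Q\<^sup>2" 1 K] by (simp add: one_le_power)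
    have "1 * 1 \<le> Q\<^sup>2 * K * H" using Q2K1 H by (intro mult_mono) auto
    then have M1: "1 < M" by (simp add: M_def)
    have MR: "M \<le> 100 * R powr (2 + h)"
    proof -
      have "Q\<^sup>2 * K * H \<le> R\<^sup>2 * H" using Q2K H by (intro mult_right_mono) auto
      also have "\<dots> = R powr (2 + h)" using R by (simp add: H_def powr_add powr_numeral)
      finally show ?thesis by (simp add: M_def)
    qed
    \<comment> \<open>For s > 7/8 this gives B^(-4s) \<le> R^(-21/10), just enough to beat the R^2
      points of the arc and leave R^(-1/10).\<close>
    define B where "B = R powr (3/5)"
    have B: "1 \<le> B" using R by (simp add: B_def ge_one_powr_ge_zero)
    have le_N: "2 * (amax + 1) * (R powr e * M) \<le> N" if e: "0 \<le> e" "e \<le> 8/5" for e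
    proof -
      have "2 * (amax + 1) * (R powr e * M) \<le> 2 * (amax + 1) * (R powr e * (100 * R powr (2 + h)))"
        using MR amax_ge_1 by (intro mult_left_mono) auto
      also have "\<dots> = 200 * (amax + 1) * R powr (e + (2 + h))" by (simp add: powr_add)
      also have "\<dots> \<le> 200 * (amax + 1) * R powr (37/10)"
        using R e h amax_ge_1 by (intro mult_left_mono powr_mono) auto
      finally show ?thesis using star by linarith
    qed
    have RM: "R powr e * M \<le> N" if e: "0 \<le> e" "e \<le> 8/5" for e
    proof -
      have "1 * (R powr e * M) \<le> 2 * (amax + 1) * (R powr e * M)"
        using amax_ge_1 M1 by (intro mult_right_mono) auto
      then show ?thesis using le_N[OF e] by linarith
    qed
    have MN: "M \<le> N" using RM[of 0] R by simp
    define L where "L = real N / M"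
    have L1: "1 \<le> L" using MN M1 by (simp add: L_def)
    have LR: "R \<le> L" using RM[of 1] R M1 by (simp add: L_def pos_le_divide_eq)
    have LM: "M * L = N" using M1 by (simp add: L_def)
    have HN: "2 * (amax + 1) * H \<le> N"
    proof -
      have "2 * (amax + 1) * (H * 1) \<le> 2 * (amax + 1) * (H * M)"
        using M1 H amax_ge_1 by (intro mult_left_mono) auto
      also have "\<dots> \<le> N" unfolding H_def using h by (intro le_N) auto
      finally show ?thesis by simp
    qed
    define gL where "gL = word_count L"
    define gN where "gN = word_count N"
    have g0: "0 \<le> gL" "0 \<le> gN" using word_count_nonneg by (auto simp: gL_def gN_def)
    define D where "D = Cd * H powr (2 * c + 2) * gL\<^sup>2 * (G powr (- 2 * s) * Q)"
    have D0: "0 \<le> D" using Cd Q by (simp add: D_def)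
    let ?\<Theta> = "major_arc N Q K"
    have cnt: "(\<Sum>w\<in>V. \<Sum>w'\<in>V. real (card {\<theta>'\<in>?\<Theta>. near_vec (H / M) \<theta> w \<theta>' w'})) \<le> D"
      if \<theta>: "\<theta> \<in> ?\<Theta>" and X: "real N / M / B \<le> X" "X \<le> real N / M * H"
        and V: "V \<subseteq> {w \<in> lists A. X \<le> real (cont w) \<and> real (cont w) \<le> 2 * X}" for \<theta> X V
    proof -
      have X1: "2 * (amax + 1) * sqrt K * Q \<le> X"
      proof -
        have "2 * (amax + 1) * G * (M * B) \<le> 2 * (amax + 1) * R * (M * B)"
          using G amax_ge_1 M1 B by (intro mult_right_mono mult_left_mono) auto
        also have "\<dots> = 2 * (amax + 1) * (R powr (8/5) * M)"
        proof -
          have "R * B = R powr (8/5)" using R powr_add[of R 1 "3/5"] by (simp add: B_def)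
          then show ?thesis by (simp add: ac_simps)
        qed
        also have "\<dots> \<le> N" by (intro le_N) auto
        finally have "2 * (amax + 1) * G \<le> N / (M * B)" using M1 B by (simp add: pos_le_divide_eq)
        then show ?thesis using X(1) by (simp add: G_def mult.assoc)
      qed
      have X0: "0 < X" using X(1) N1 M1 B by (smt (verit) divide_pos_pos)
      have XL: "X \<le> L * H" using X(2) by (simp add: L_def)
      have small: "H / M + 4 * K * X / N < 1 / Q\<^sup>2"
      proof -
        have "4 * K * X / N \<le> 4 * K * (N / M * H) / N"
          using X(2) K by (intro divide_right_mono mult_left_mono) auto
        also have "\<dots> = 4 * K * (H / M)" using N1 by simp
        finally have "H / M + 4 * K * X / N \<le> (1 + 4 * K) * (H / M)" by (simp add: algebra_simps)
        also have "\<dots> \<le> (5 * K) * (H / M)" using K H M1 by (intro mult_right_mono) auto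
        also have "\<dots> = 5 / 100 * (1 / Q\<^sup>2)" using K H Q by (simp add: M_def field_simps)
        also have "\<dots> < 1 / Q\<^sup>2" using Q by (simp add: field_simps)
        finally show ?thesis .
      qed
      define \<Lambda> where "\<Lambda> = 1 + H * L / X"
      have \<Lambda>: "1 + H / M * N / X = \<Lambda>" by (simp add: \<Lambda>_def L_def)
      have \<Lambda>0: "0 \<le> \<Lambda>" using H L1 X0 by (simp add: \<Lambda>_def)
      have cV: "real (card V) \<le> word_count (2 * X / 1)"
        unfolding word_count_def using V by (intro of_nat_mono card_mono finite_words_upto) (auto simp: words_upto_def)
      have "(\<Sum>w\<in>V. \<Sum>w'\<in>V. real (card {\<theta>'\<in>?\<Theta>. near_vec (H / M) \<theta> w \<theta>' w'}))
         \<le> Cp * real (card V) * (1 + H / M * N / X)\<^sup>2 * word_count (2 * X / (sqrt K * Q)) * Q"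
        using N1 Q K X0 X1 small \<theta> V H M1 by (intro pairs) auto
      \<comment> \<open>One factor \<Lambda> is given to each of the two counts, so that
        \<open>cut\<close> applies twice: to V with G = 1 and to the middle parts with G =
        \<open>sqrt K * Q\<close>.\<close>
      also have "\<dots> = Cp * Q * ((real (card V) * \<Lambda>) * (word_count (2 * X / G) * \<Lambda>))"
        unfolding \<Lambda> G_def by (simp add: power2_eq_square)
      also have "\<dots> \<le> Cp * Q * ((Cc * H powr (c + 1) * word_count (L / 1)) * (Cc * H powr (c + 1) * word_count (L / G)))"
      proof (rule mult_left_mono[OF mult_mono])
        have "real (card V) * \<Lambda> \<le> word_count (2 * X / 1) * \<Lambda>" using cV \<Lambda>0 by (intro mult_right_mono)
        also have "\<dots> \<le> Cc * H powr (c + 1) * word_count (L / 1)"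
          unfolding \<Lambda>_def using L1 X0 H XL by (intro cut) auto
        finally show "real (card V) * \<Lambda> \<le> Cc * H powr (c + 1) * word_count (L / 1)" .
        show "word_count (2 * X / G) * \<Lambda> \<le> Cc * H powr (c + 1) * word_count (L / G)"
          unfolding \<Lambda>_def using G LR X0 H XL by (intro cut) auto
      qed (use Cp Q Cc word_count_nonneg \<Lambda>0 in auto)
      also have "\<dots> = (Cp * Cc * Cc * H powr (2 * c + 2) * gL * Q) * word_count (L / G)"
      proof -
        have "H powr (c + 1) * H powr (c + 1) = H powr (2 * c + 2)" using H by (simp add: powr_add[symmetric])
        then show ?thesis by (simp add: gL_def ac_simps)
      qed
      also have "\<dots> \<le> (Cp * Cc * Cc * H powr (2 * c + 2) * gL * Q) * (C2 * gL * G powr (- 2 * s))"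
      proof (intro mult_left_mono)
        have "word_count (L / G) * G powr (2 * s) \<le> C2 * gL" using C2(2)[OF G(1), of "L / G"] G by (simp add: gL_def)
        then have "word_count (L / G) * G powr (2 * s) * G powr (- 2 * s) \<le> C2 * gL * G powr (- 2 * s)"
          by (intro mult_right_mono) auto
        moreover have "word_count (L / G) * G powr (2 * s) * G powr (- 2 * s) = word_count (L / G)"
          using G by (simp add: mult.assoc powr_add[symmetric])
        ultimately show "word_count (L / G) \<le> C2 * gL * G powr (- 2 * s)" by (simp only:)
      qed (use Cp Cc g0 Q in auto)
      also have "\<dots> = D" by (simp add: D_def Cd_def power2_eq_square)
      finally show ?thesis .
    qed
    have arc_le: "real (card ?\<Theta>) \<le> 12 * R\<^sup>2"
    proof -
      have "1 * L \<le> M * L" using M1 L1 by (intro mult_right_mono) auto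
      then have "K \<le> N" using R LR LM by linarith
      then have "real (card ?\<Theta>) \<le> 12 * (Q\<^sup>2 * K)" using N1 Q K by (intro card_major_arc_le) auto
      then show ?thesis using Q2K by linarith
    qed
    have red: "(\<Sum>\<theta>\<in>?\<Theta>. (cmod (expsum N \<theta>))\<^sup>2) \<le>
       Cr * (gN\<^sup>2 * real (card ?\<Theta>) * (L powr (- 4 * s) + B powr (- 4 * s) + exp (- H)) +
            (2 + log 2 (B * H))\<^sup>2 * real (card (stop_words M)) * M\<^sup>2 *
              (D + (word_count (L * H))\<^sup>2 * real (card ?\<Theta>) / H ^ Suc k))"
      unfolding gN_def L_def
    proof (rule reduction)
      show "?\<Theta> \<subseteq> grid N" by (auto simp: major_arc_def)
    qed (use N1 M1 MN H B HN D0 cnt in auto)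
    have T1: "gN\<^sup>2 * real (card ?\<Theta>) * (L powr (- 4 * s) + B powr (- 4 * s) + exp (- H))
        \<le> 12 * (2 + Ce) * (gN\<^sup>2 * R powr (- 1/10))"
    proof -
      have "L powr (- 4 * s) \<le> R powr (- 4 * s)" using LR R s_bounds by (intro powr_mono2') auto
      also have "\<dots> \<le> R powr (- 21/10)" using R s_bounds by (intro powr_mono) auto
      finally have a: "L powr (- 4 * s) \<le> R powr (- 21/10)" .
      have "B powr (- 4 * s) = R powr (3/5 * (- 4 * s))" by (simp add: B_def powr_powr)
      also have "\<dots> \<le> R powr (- 21/10)" using R s_bounds by (intro powr_mono) auto
      finally have b: "B powr (- 4 * s) \<le> R powr (- 21/10)" .
      have "exp (- H) \<le> Ce * H powr (- (3 / h))" by (rule Ce(2)[OF H])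
      also have "H powr (- (3 / h)) = R powr (- 3)" using h by (simp add: H_def powr_powr)
      also have "Ce * R powr (- 3) \<le> Ce * R powr (- 21/10)"
        using R Ce(1) by (intro mult_left_mono powr_mono) auto
      finally have "L powr (- 4 * s) + B powr (- 4 * s) + exp (- H) \<le> (2 + Ce) * R powr (- 21/10)"
        using a b by (simp add: algebra_simps)
      then have "gN\<^sup>2 * real (card ?\<Theta>) * (L powr (- 4 * s) + B powr (- 4 * s) + exp (- H))
          \<le> gN\<^sup>2 * (12 * R\<^sup>2) * ((2 + Ce) * R powr (- 21/10))"
        using arc_le by (intro mult_mono mult_left_mono mult_nonneg_nonneg) auto
      also have "\<dots> = 12 * (2 + Ce) * (gN\<^sup>2 * (R powr 2 * R powr (- 21/10)))"
        using R by (simp add: powr_numeral)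
      also have "R powr 2 * R powr (- 21/10) = R powr (- 1/10)" by (simp add: powr_add[symmetric])
      finally show ?thesis .
    qed
    have lg: "(2 + log 2 (B * H))\<^sup>2 \<le> Cl * H"
    proof -
      have "1 * 1 \<le> B * H" using B H by (intro mult_mono) auto
      then have "(2 + log 2 (B * H))\<^sup>2 \<le> Cl * (B * H) powr h" by (intro Cl(2)) simp
      also have "(B * H) powr h = R powr ((3/5 + h) * h)" by (simp add: B_def H_def powr_add[symmetric] powr_powr)
      also have "\<dots> \<le> R powr (1 * h)" using R h by (intro powr_mono mult_right_mono) auto
      finally show ?thesis using Cl(1) by (simp add: H_def)
    qed
    define mm where "mm = Q powr (4 - 4 * s) * K powr (2 - 2 * s)"
    have fM: "real (card (stop_words M)) * M\<^sup>2 * gL\<^sup>2 \<le> 100 * Cf * (mm * H * gN\<^sup>2)"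
    proof -
      have "real (card (stop_words M)) * M\<^sup>2 * gL\<^sup>2 \<le> Cf * M powr (2 - 2 * s) * gN\<^sup>2"
        using Cf(2)[of M L] M1 LM by (simp add: gL_def gN_def)
      also have "M powr (2 - 2 * s) \<le> 100 * mm * H"
      proof -
        have "M powr (2 - 2 * s) = 100 powr (2 - 2 * s) * mm * H powr (2 - 2 * s)"
        proof -
          have "(Q\<^sup>2) powr (2 - 2 * s) = Q powr (4 - 4 * s)"
            using Q by (simp add: powr_numeral[symmetric] powr_powr algebra_simps del: powr_numeral)
          then show ?thesis using Q K H by (simp add: M_def mm_def powr_mult)
        qed
        also have "\<dots> \<le> 100 powr 1 * mm * H powr 1"
          using s_bounds H by (intro mult_mono mult_right_mono powr_mono) (auto simp: mm_def)
        finally show ?thesis using H by simp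
      qed
      then have "Cf * M powr (2 - 2 * s) * gN\<^sup>2 \<le> Cf * (100 * mm * H) * gN\<^sup>2"
        using Cf(1) by (intro mult_right_mono mult_left_mono) auto
      finally show ?thesis by (simp add: ac_simps)
    qed
    have main: "(2 + log 2 (B * H))\<^sup>2 * real (card (stop_words M)) * M\<^sup>2 * D
        \<le> Cl * (100 * Cf) * Cd * (gN\<^sup>2 * R powr (- 1/10))"
    proof -
      have "(2 + log 2 (B * H))\<^sup>2 * real (card (stop_words M)) * M\<^sup>2 * D
         = (2 + log 2 (B * H))\<^sup>2 * (real (card (stop_words M)) * M\<^sup>2 * gL\<^sup>2) * (Cd * H powr (2 * c + 2) * (G powr (- 2 * s) * Q))"
        by (simp add: D_def)
      also have "\<dots> \<le> (Cl * H) * (100 * Cf * (mm * H * gN\<^sup>2)) * (Cd * H powr (2 * c + 2) * (G powr (- 2 * s) * Q))"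
        by (rule mult_right_mono[OF mult_mono[OF lg fM]]) (use Cd Q Cl(1) H in auto)
      also have "\<dots> = Cl * (100 * Cf) * Cd * (gN\<^sup>2 * ((H * H * H powr (2 * c + 2)) * (mm * (G powr (- 2 * s) * Q))))"
        by (simp only: ac_simps)
      also have "H * H * H powr (2 * c + 2) = H powr (2 * c + 4)"
      proof -
        have "H powr (2 * c + 4) = H powr (1 + (1 + (2 * c + 2)))" by (simp add: algebra_simps)
        also have "\<dots> = H * (H * H powr (2 * c + 2))" unfolding powr_add using H by simp
        finally show ?thesis by simp
      qed
      also have "\<dots> = R powr (1/8)" by (simp only: H_def powr_powr h(3))
      \<comment> \<open>The completion loss \<open>mm\<close> meets the gain of fixing direction and
        residue class. For s > 7/8 both 5 - 6 s and 2 - 3 s are below -1/4.\<close>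
      also have "mm * (G powr (- 2 * s) * Q) = Q powr (5 - 6 * s) * K powr (2 - 3 * s)"
      proof -
        have "G powr (- 2 * s) = K powr (- s) * Q powr (- 2 * s)"
          using Q K by (simp add: G_def powr_mult powr_half_sqrt[symmetric] powr_powr)
        moreover have "Q powr (5 - 6 * s) = Q powr ((4 - 4 * s) + (- 2 * s + 1))" by (simp add: algebra_simps)
        then have "Q powr (5 - 6 * s) = Q powr (4 - 4 * s) * (Q powr (- 2 * s) * Q)"
          unfolding powr_add using Q by simp
        moreover have "K powr (2 - 3 * s) = K powr ((2 - 2 * s) + (- s))" by (simp add: algebra_simps)
        then have "K powr (2 - 3 * s) = K powr (2 - 2 * s) * K powr (- s)" unfolding powr_add .
        ultimately show ?thesis by (simp add: mm_def)
      qed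
      also have "Cl * (100 * Cf) * Cd * (gN\<^sup>2 * (R powr (1/8) * (Q powr (5 - 6 * s) * K powr (2 - 3 * s))))
         \<le> Cl * (100 * Cf) * Cd * (gN\<^sup>2 * (R powr (1/8) * (Q powr (- 1/4) * K powr (- 1/4))))"
        using Cl(1) Cf(1) Cd Q K s_bounds by (intro mult_left_mono mult_mono powr_mono) auto
      also have "Q powr (- 1/4) * K powr (- 1/4) = R powr (- 1/4)" using Q K by (simp add: R_def powr_mult)
      also have "R powr (1/8) * R powr (- 1/4) = R powr (- 1/8)" by (simp add: powr_add[symmetric])
      also have "Cl * (100 * Cf) * Cd * (gN\<^sup>2 * R powr (- 1/8)) \<le> Cl * (100 * Cf) * Cd * (gN\<^sup>2 * R powr (- 1/10))"
        using Cl(1) Cf(1) Cd R by (intro mult_left_mono powr_mono) auto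
      finally show ?thesis .
    qed
    have tail: "(2 + log 2 (B * H))\<^sup>2 * real (card (stop_words M)) * M\<^sup>2 *
         ((word_count (L * H))\<^sup>2 * real (card ?\<Theta>) / H ^ Suc k)
        \<le> Cl * (100 * Cf) * (12 * doubling\<^sup>2) * (gN\<^sup>2 * R powr (- 1/10))"
    proof -
      have "word_count (L * H) \<le> doubling * H powr c * gL"
        using word_count_scale[OF L1 H] by (simp add: c_def gL_def mult.commute)
      then have "(word_count (L * H))\<^sup>2 \<le> (doubling * H powr c * gL)\<^sup>2"
        using word_count_nonneg by (intro power_mono) auto
      then have "(word_count (L * H))\<^sup>2 * real (card ?\<Theta>) / H ^ Suc k \<le> (doubling * H powr c * gL)\<^sup>2 * (12 * R\<^sup>2) / H ^ Suc k"
        using arc_le H by (intro divide_right_mono mult_mono) auto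
      also have "\<dots> = gL\<^sup>2 * (12 * doubling\<^sup>2 * (R powr 2 * (H powr (2 * c) / H powr (Suc k))))"
      proof -
        have "H ^ Suc k = H powr (Suc k)" using H by (simp add: powr_realpow del: power_Suc of_nat_Suc)
        moreover have "(H powr c)\<^sup>2 = H powr (2 * c)" by (simp add: power2_eq_square powr_add[symmetric])
        ultimately show ?thesis using R by (simp add: power_mult_distrib powr_numeral)
      qed
      finally have "(2 + log 2 (B * H))\<^sup>2 * real (card (stop_words M)) * M\<^sup>2 *
         ((word_count (L * H))\<^sup>2 * real (card ?\<Theta>) / H ^ Suc k)
        \<le> (2 + log 2 (B * H))\<^sup>2 * real (card (stop_words M)) * M\<^sup>2 * (gL\<^sup>2 * (12 * doubling\<^sup>2 * (R powr 2 * (H powr (2 * c) / H powr (Suc k)))))"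
        by (intro mult_left_mono) auto
      also have "\<dots> = (2 + log 2 (B * H))\<^sup>2 * (real (card (stop_words M)) * M\<^sup>2 * gL\<^sup>2) * (12 * doubling\<^sup>2 * (R powr 2 * (H powr (2 * c) / H powr (Suc k))))"
        by (simp only: ac_simps)
      also have "\<dots> \<le> (Cl * H) * (100 * Cf * (mm * H * gN\<^sup>2)) * (12 * doubling\<^sup>2 * (R powr 2 * (H powr (2 * c) / H powr (Suc k))))"
        by (rule mult_right_mono[OF mult_mono[OF lg fM]]) (use Cl(1) H in auto)
      also have "\<dots> = Cl * (100 * Cf) * (12 * doubling\<^sup>2) * (gN\<^sup>2 * (R powr 2 * mm * (H * H * H powr (2 * c) / H powr (Suc k))))"
        by (simp only: ac_simps times_divide_eq_left times_divide_eq_right)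
      also have "H * H * H powr (2 * c) / H powr (Suc k) = H powr (1 + (1 + 2 * c) - Suc k)"
        unfolding powr_diff powr_add using H by simp
      also have "\<dots> \<le> H powr (- (3 / h))" using H k by (intro powr_mono) auto
      also have "H powr (- (3 / h)) = R powr (- 3)" using h by (simp add: H_def powr_powr)
      also have "mm \<le> R powr (1/2)"
      proof -
        have "mm \<le> Q powr (1/2) * K powr (1/2)"
          unfolding mm_def using Q K s_bounds by (intro mult_mono powr_mono) auto
        then show ?thesis using Q K by (simp add: R_def powr_mult)
      qed
      finally have "(2 + log 2 (B * H))\<^sup>2 * real (card (stop_words M)) * M\<^sup>2 *
         ((word_count (L * H))\<^sup>2 * real (card ?\<Theta>) / H ^ Suc k)
         \<le> Cl * (100 * Cf) * (12 * doubling\<^sup>2) * (gN\<^sup>2 * (R powr 2 * R powr (1/2) * R powr (- 3)))"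
        using Cl(1) Cf(1) by (simp add: mult_left_mono mult_right_mono mm_def)
      also have "R powr 2 * R powr (1/2) * R powr (- 3) = R powr (- 1/2)" by (simp add: powr_add[symmetric])
      also have "Cl * (100 * Cf) * (12 * doubling\<^sup>2) * (gN\<^sup>2 * R powr (- 1/2))
         \<le> Cl * (100 * Cf) * (12 * doubling\<^sup>2) * (gN\<^sup>2 * R powr (- 1/10))"
        using Cl(1) Cf(1) R by (intro mult_left_mono powr_mono) auto
      finally show ?thesis .
    qed
    have "(\<Sum>\<theta>\<in>?\<Theta>. (cmod (expsum N \<theta>))\<^sup>2) \<le> Cr * (12 * (2 + Ce) * (gN\<^sup>2 * R powr (- 1/10)) +
       (Cl * (100 * Cf) * Cd * (gN\<^sup>2 * R powr (- 1/10)) + Cl * (100 * Cf) * (12 * doubling\<^sup>2) * (gN\<^sup>2 * R powr (- 1/10))))"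
      by (rule order.trans[OF red])
         (use T1 main tail Cr in \<open>intro mult_left_mono add_mono; simp add: distrib_left add_mono\<close>)
    also have "\<dots> = C * (gN\<^sup>2 * R powr (- 1/10))" unfolding C_def by (simp only: distrib_left distrib_right ac_simps)
    finally show ?thesis by (simp add: gN_def R_def mult.assoc)
  qed
  then show ?thesis using C0 by blast
qed

end

section \<open>The mean square over the generic arc\<close>

context dense_alphabet
begin

definition generic_arc :: "nat \<Rightarrow> real set" where
  "generic_arc N = {\<theta> \<in> grid N. \<exists>a q::int. coprime a q \<and> 0 < q \<and> real N powr (1/4) \<le> q \<and>
     real_of_int q \<le> real N powr (3/4) \<and> \<bar>\<theta> - a / q\<bar> \<le> 1 / (real_of_int q)\<^sup>2}"

text \<open>All of these \<theta> are treated with a single M, and the saving is a power of N.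
  Neither direction nor residue class is used, only the scarcity of admissible determinants.\<close>

lemma generic_arc_mean_square:
  "\<exists>C>0. \<exists>N0. \<forall>N. N0 \<le> real N \<longrightarrow>
     (\<Sum>\<theta>\<in>generic_arc N. (cmod (expsum N \<theta>))\<^sup>2) \<le> C * (word_count N)\<^sup>2"
proof -
  define c where "c = growth_exp"
  have c1: "1 \<le> c" using growth_exp_ge_1 by (simp add: c_def)
  define \<sigma> where "\<sigma> = s - 7/8"
  have \<sigma>: "0 < \<sigma>" "\<sigma> < 1/40" using s_bounds by (auto simp: \<sigma>_def)
  \<comment> \<open>H enters the main term with exponent c + 6, namely c + 5 from D and one from the
    logarithm; this costs N^\<sigma> out of the saving N^(2 \<sigma>).\<close>
  define h where "h = \<sigma> / (c + 6)"
  have h: "0 < h" "h \<le> 1/16" "h * (c + 6) = \<sigma>"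
    using \<sigma> c1 by (auto simp: h_def field_simps)
  \<comment> \<open>This makes the powers of H in the sieve error at most N^(-2), against at most N
    grid points and the loss M^(2-2s) \<le> N.\<close>
  define k where "k = nat \<lceil>2 * c + 1 + 2 / h\<rceil>"
  have k: "2 * c + 1 + 2 / h \<le> k" unfolding k_def by linarith
  obtain Cr where Cr: "0 < Cr" and reduction: "\<And>N M H B \<Theta> D. 0 < N \<Longrightarrow> 1 < M \<Longrightarrow> M \<le> real N \<Longrightarrow> 1 \<le> H \<Longrightarrow> 1 \<le> B \<Longrightarrow>
     2 * (amax + 1) * H \<le> real N \<Longrightarrow> \<Theta> \<subseteq> grid N \<Longrightarrow> 0 \<le> D \<Longrightarrow>
     (\<forall>\<theta>\<in>\<Theta>. \<forall>X V. real N / M / B \<le> X \<longrightarrow> X \<le> real N / M * H \<longrightarrow>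
        V \<subseteq> {w \<in> lists A. X \<le> real (cont w) \<and> real (cont w) \<le> 2 * X} \<longrightarrow>
        (\<Sum>w\<in>V. \<Sum>w'\<in>V. real (card {\<theta>'\<in>\<Theta>. near_vec (H / M) \<theta> w \<theta>' w'})) \<le> D) \<Longrightarrow>
     (\<Sum>\<theta>\<in>\<Theta>. (cmod (expsum N \<theta>))\<^sup>2) \<le>
       Cr * ((word_count N)\<^sup>2 * real (card \<Theta>) *
              ((real N / M) powr (- 4 * s) + B powr (- 4 * s) + exp (- H)) +
            (2 + log 2 (B * H))\<^sup>2 * real (card (stop_words M)) * M\<^sup>2 *
              (D + (word_count (real N / M * H))\<^sup>2 * real (card \<Theta>) / H ^ Suc k))"
    using mean_square_reduction[of k] by blast
  obtain Cc where Cc: "0 < Cc" and cut: "\<And>(L::real) (G::real) (X::real) (H::real). 0 < G \<Longrightarrow> 1 \<le> L / G \<Longrightarrow> 0 < X \<Longrightarrow> 1 \<le> H \<Longrightarrow> X \<le> L * H \<Longrightarrow>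
     word_count (2 * X / G) * (1 + H * L / X) \<le> Cc * H powr (c + 1) * word_count (L / G)"
    using word_count_cut unfolding c_def by blast
  obtain C2 where C2: "0 < C2" "\<And>X Y. 1 \<le> Y \<Longrightarrow> word_count X * Y powr (2 * s) \<le> C2 * word_count (X * Y)"
    using word_count_dilate by blast
  obtain Cf where Cf: "0 < Cf" "\<And>M L. 1 \<le> M \<Longrightarrow> real (card (stop_words M)) * M\<^sup>2 * (word_count L)\<^sup>2
      \<le> Cf * M powr (2 - 2 * s) * (word_count (M * L))\<^sup>2"
    using stop_words_square_le by blast
  obtain Ce where Ce: "0 < Ce" "\<And>x. 1 \<le> x \<Longrightarrow> exp (- x) \<le> Ce * x powr (- (1 / h))"
    using exp_minus_le_powr by blast
  obtain Cl where Cl: "0 < Cl" "\<And>x. 1 \<le> x \<Longrightarrow> (2 + log 2 x)\<^sup>2 \<le> Cl * x powr h"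
    using log_square_le_powr[OF h(1)] by blast
  define Cd where "Cd = 72 * Cc * 110"
  have Cd: "0 < Cd" using Cc by (simp add: Cd_def)
  define C where "C = Cr * ((2 + Ce) + (Cl * Cf * Cd * C2 + Cl * Cf * doubling\<^sup>2))"
  have dbl: "0 < doubling" using doubling_ge_2 by simp
  have C0: "0 < C" unfolding C_def
    using Cr Ce(1) Cl(1) Cf(1) Cd C2 dbl by (intro mult_pos_pos add_pos_pos) auto
  \<comment> \<open>17^8 ensures N^(-1/8) \<le> 1/17 and with it
    \<open>16 * (H / M) * X < 1\<close>; the other entry ensures
    \<open>2 * (amax + 1) * H \<le> N\<close>.\<close>
  define N0 where "N0 = max (17 ^ 8) ((2 * (amax + 1))\<^sup>2)"
  have "(\<Sum>\<theta>\<in>generic_arc N. (cmod (expsum N \<theta>))\<^sup>2) \<le> C * (word_count N)\<^sup>2" if N: "N0 \<le> real N" for N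
  proof -
    have N1: "17 ^ 8 \<le> real N" "(2 * (amax + 1))\<^sup>2 \<le> real N" using N by (auto simp: N0_def)
    have N2: "1 < real N" using N1(1) by (rule less_le_trans[rotated]) simp
    have N3: "17 \<le> real N powr (1/8)"
    proof -
      have "17 = ((17::real) ^ 8) powr (1/8)" by (simp add: powr_realpow[symmetric] powr_powr del: powr_numeral)
      also have "\<dots> \<le> real N powr (1/8)" using N1(1) by (intro powr_mono2) auto
      finally show ?thesis .
    qed
    \<comment> \<open>At this M each of L^2 / q, L q / M and L^3 / M is at most N^(1/2) for q
      between N^(1/4) and N^(3/4).\<close>
    define M where "M = real N powr (5/8)"
    define L where "L = real N powr (3/8)"
    define H where "H = real N powr h"
    \<comment> \<open>The saving B^(-4s) must beat the trivial bound N for the number of points: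
      3/10 times 4 times 7/8 is 21/20.\<close>
    define B where "B = real N powr (3/10)"
    have gt1: "1 < real N powr e" if "0 < e" for e using N2 that by simp
    have M1: "1 < M" and L1: "1 \<le> L" and H: "1 \<le> H" and B: "1 \<le> B"
      using gt1[of "5/8"] gt1[of "3/8"] gt1[of h] gt1[of "3/10"] h by (auto simp: M_def L_def H_def B_def)
    have pw: "real N powr a \<le> real N powr b" if "a \<le> b" for a b using N2 that by (intro powr_mono) auto
    have N_pow: "real N powr 1 = N" using N2 by simp
    have MN: "M \<le> N" using pw[of "5/8" 1] N_pow by (simp add: M_def)
    have LM: "M * L = N" using N2 by (simp add: M_def L_def powr_add[symmetric])
    have L_eq: "real N / M = L" using LM M1 by (simp add: field_simps)
    have HN: "2 * (amax + 1) * H \<le> N"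
    proof -
      have "2 * (amax + 1) \<le> real N powr (1/2)"
        using N1(2) amax_ge_1 by (simp add: powr_half_sqrt real_le_rsqrt)
      moreover have "H \<le> real N powr (1/2)" unfolding H_def using h by (intro pw) auto
      ultimately have "2 * (amax + 1) * H \<le> real N powr (1/2) * real N powr (1/2)"
        using H by (intro mult_mono) auto
      also have "\<dots> = N" using N2 by (simp add: powr_add[symmetric])
      finally show ?thesis .
    qed
    define gL where "gL = word_count L"
    define gN where "gN = word_count N"
    have g0: "0 \<le> gL" "0 \<le> gN" using word_count_nonneg by (auto simp: gL_def gN_def)
    have gL1: "L powr (2 * s) \<le> C2 * gL"
    proof -
      have "1 * L powr (2 * s) \<le> word_count 1 * L powr (2 * s)"
        using word_count_ge_1[of 1] by (intro mult_right_mono) auto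
      also have "\<dots> \<le> C2 * word_count (1 * L)" by (rule C2(2)[OF L1])
      finally show ?thesis by (simp add: gL_def)
    qed
    \<comment> \<open>Only one factor g(L) appears: w determines w' up to boundedly many choices
      once the determinant is known, and about N^(1/2) determinants occur, up to powers of
      H.\<close>
    define D where "D = Cd * H powr (c + 5) * gL * real N powr (1/2)"
    have D0: "0 \<le> D" using Cd g0 by (simp add: D_def)
    let ?\<Theta> = "generic_arc N"
    have sub: "?\<Theta> \<subseteq> grid N" by (auto simp: generic_arc_def)
    have cnt: "(\<Sum>w\<in>V. \<Sum>w'\<in>V. real (card {\<theta>'\<in>?\<Theta>. near_vec (H / M) \<theta> w \<theta>' w'})) \<le> D"
      if \<theta>: "\<theta> \<in> ?\<Theta>" and X: "real N / M / B \<le> X" "X \<le> real N / M * H"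
        and V: "V \<subseteq> {w \<in> lists A. X \<le> real (cont w) \<and> real (cont w) \<le> 2 * X}" for \<theta> X V
    proof -
      obtain a q :: int where aq: "coprime a q" "0 < q" "real N powr (1/4) \<le> q" "q \<le> real N powr (3/4)"
        "\<bar>\<theta> - a / q\<bar> \<le> 1 / (real_of_int q)\<^sup>2" using \<theta> unfolding generic_arc_def by blast
      have X0: "0 < X" using X(1) N2 M1 B by (smt (verit) divide_pos_pos)
      have XL: "X \<le> L * H" using X(2) by (simp add: L_eq)
      define \<Lambda> where "\<Lambda> = 1 + H * L / X"
      have \<Lambda>: "1 + H / M * N / X = \<Lambda>" by (simp add: \<Lambda>_def L_eq[symmetric])
      have \<Lambda>0: "0 \<le> \<Lambda>" using H L1 X0 by (simp add: \<Lambda>_def)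
      have \<kappa>X: "H / M * X \<le> H\<^sup>2 * real N powr (- 1/4)"
      proof -
        have "H / M * X \<le> H / M * (L * H)" using XL H M1 by (intro mult_left_mono) auto
        also have "\<dots> = H\<^sup>2 * (L / M)" by (simp add: power2_eq_square)
        also have "L / M = real N powr (- 1/4)" by (simp add: L_def M_def powr_diff[symmetric])
        finally show ?thesis .
      qed
      have "H\<^sup>2 * real N powr (- 1/4) \<le> real N powr (- 1/8)"
      proof -
        have "H\<^sup>2 * real N powr (- 1/4) = real N powr (h + h - 1/4)"
          unfolding H_def power2_eq_square by (simp add: powr_add[symmetric])
        also have "\<dots> \<le> real N powr (- 1/8)" using h by (intro pw) auto
        finally show ?thesis .
      qed
      moreover have "real N powr (- 1/8) \<le> 1 / 17"
      proof -
        have "real N powr (- 1/8) = inverse (real N powr (1/8))" by (simp add: powr_minus[symmetric])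
        also have "\<dots> \<le> inverse 17" using N3 by (intro le_imp_inverse_le) auto
        finally show ?thesis by simp
      qed
      ultimately have small: "16 * (H / M) * X < 1" using \<kappa>X by linarith
      have cV: "real (card V) \<le> word_count (2 * X / 1)"
        unfolding word_count_def using V by (intro of_nat_mono card_mono finite_words_upto) (auto simp: words_upto_def)
      have "(\<Sum>w\<in>V. \<Sum>w'\<in>V. real (card {\<theta>'\<in>?\<Theta>. near_vec (H / M) \<theta> w \<theta>' w'}))
         \<le> 72 * real (card V) * (1 + H / M * N / X) * ((8 * X\<^sup>2 / q + 2) * (8 * (H / M) * X * q + 3))"
        using N2 aq(1,2,5) X0 H M1 small sub V by (intro generic_pairs_le) auto
      also have "\<dots> = 72 * ((real (card V) * \<Lambda>) * ((8 * X\<^sup>2 / q + 2) * (8 * (H / M * X) * q + 3)))"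
        unfolding \<Lambda> by simp
      also have "\<dots> \<le> 72 * ((Cc * H powr (c + 1) * gL) * (H ^ 4 * (110 * real N powr (1/2))))"
      proof (rule mult_left_mono[OF mult_mono])
        have "real (card V) * \<Lambda> \<le> word_count (2 * X / 1) * \<Lambda>" using cV \<Lambda>0 by (intro mult_right_mono)
        also have "\<dots> \<le> Cc * H powr (c + 1) * word_count (L / 1)"
          unfolding \<Lambda>_def using L1 X0 H XL by (intro cut) auto
        finally show "real (card V) * \<Lambda> \<le> Cc * H powr (c + 1) * gL" by (simp add: gL_def)
        have H2: "1 \<le> H\<^sup>2" using H by simp
        have "8 * X\<^sup>2 / q + 2 \<le> H\<^sup>2 * (8 * (L\<^sup>2 / q) + 2)"
        proof -
          have "X\<^sup>2 \<le> (L * H)\<^sup>2" using XL X0 by (intro power_mono) auto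
          then have "8 * X\<^sup>2 / q \<le> 8 * (L * H)\<^sup>2 / q" using aq(2) by (intro divide_right_mono) auto
          then show ?thesis using H2 by (simp add: power_mult_distrib algebra_simps)
        qed
        moreover have "8 * (H / M * X) * q + 3 \<le> H\<^sup>2 * (8 * (real N powr (- 1/4) * q) + 3)"
        proof -
          have "H / M * X * q \<le> H\<^sup>2 * real N powr (- 1/4) * q" using \<kappa>X aq(2) by (intro mult_right_mono) auto
          then have "8 * (H / M * X * q) + 3 \<le> 8 * (H\<^sup>2 * real N powr (- 1/4) * q) + 3 * H\<^sup>2" using H2 by linarith
          then show ?thesis by (simp only: distrib_left ac_simps)
        qed
        ultimately have "(8 * X\<^sup>2 / q + 2) * (8 * (H / M * X) * q + 3)
            \<le> (H\<^sup>2 * (8 * (L\<^sup>2 / q) + 2)) * (H\<^sup>2 * (8 * (real N powr (- 1/4) * q) + 3))"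
          using aq(2) X0 H M1 by (intro mult_mono) auto
        also have "\<dots> = H ^ 4 * (64 * (L\<^sup>2 * real N powr (- 1/4)) + 24 * (L\<^sup>2 / q) + 16 * (real N powr (- 1/4) * q) + 6)"
          using aq(2) by (simp add: field_simps power2_eq_square power4_eq_xxxx)
        \<comment> \<open>110 = 64 + 24 + 16 + 6, each bracketed term being at most N^(1/2).\<close>
        also have "\<dots> \<le> H ^ 4 * (110 * real N powr (1/2))"
        proof (rule mult_left_mono)
          have L2: "L\<^sup>2 = real N powr (3/4)" by (simp add: L_def power2_eq_square powr_add[symmetric])
          have a: "L\<^sup>2 * real N powr (- 1/4) = real N powr (1/2)" by (simp add: L2 powr_add[symmetric])
          have "L\<^sup>2 / q \<le> L\<^sup>2 / real N powr (1/4)" using aq(2,3) N2 by (intro divide_left_mono) auto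
          also have "\<dots> = real N powr (1/2)" by (simp add: L2 powr_diff[symmetric])
          finally have b: "L\<^sup>2 / q \<le> real N powr (1/2)" .
          have "real N powr (- 1/4) * q \<le> real N powr (- 1/4) * real N powr (3/4)"
            using aq(4) by (intro mult_left_mono) auto
          also have "\<dots> = real N powr (1/2)" by (simp add: powr_add[symmetric])
          finally have d: "real N powr (- 1/4) * q \<le> real N powr (1/2)" .
          have "1 \<le> real N powr (1/2)" using gt1[of "1/2"] by simp
          then show "64 * (L\<^sup>2 * real N powr (- 1/4)) + 24 * (L\<^sup>2 / q) + 16 * (real N powr (- 1/4) * q) + 6 \<le> 110 * real N powr (1/2)"
            using a b d by linarith
        qed simp
        finally show "(8 * X\<^sup>2 / q + 2) * (8 * (H / M * X) * q + 3) \<le> H ^ 4 * (110 * real N powr (1/2))" .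
      qed (use Cc g0 aq(2) X0 H M1 in auto)
      also have "\<dots> = D"
      proof -
        have "H powr (c + 5) = H powr (c + 1 + 4)" by (simp add: algebra_simps)
        also have "\<dots> = H powr (c + 1) * H ^ 4" unfolding powr_add using H by (simp add: powr_numeral)
        finally show ?thesis by (simp add: D_def Cd_def)
      qed
      finally show ?thesis .
    qed
    have arc_le: "real (card ?\<Theta>) \<le> N"
      using card_mono[OF finite_grid sub] card_grid_le[of N] by linarith
    have red: "(\<Sum>\<theta>\<in>?\<Theta>. (cmod (expsum N \<theta>))\<^sup>2) \<le>
       Cr * (gN\<^sup>2 * real (card ?\<Theta>) * (L powr (- 4 * s) + B powr (- 4 * s) + exp (- H)) +
            (2 + log 2 (B * H))\<^sup>2 * real (card (stop_words M)) * M\<^sup>2 *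
              (D + (word_count (L * H))\<^sup>2 * real (card ?\<Theta>) / H ^ Suc k))"
      unfolding gN_def L_eq[symmetric]
      by (rule reduction) (use N2 M1 MN H B HN D0 cnt sub in auto)
    have T1: "gN\<^sup>2 * real (card ?\<Theta>) * (L powr (- 4 * s) + B powr (- 4 * s) + exp (- H)) \<le> (2 + Ce) * gN\<^sup>2"
    proof -
      have "L powr (- 4 * s) = real N powr (3/8 * (- 4 * s))" by (simp add: L_def powr_powr)
      also have "\<dots> \<le> real N powr (- 1)" using s_bounds by (intro pw) auto
      finally have a: "L powr (- 4 * s) \<le> real N powr (- 1)" .
      have "B powr (- 4 * s) = real N powr (3/10 * (- 4 * s))" by (simp add: B_def powr_powr)
      also have "\<dots> \<le> real N powr (- 1)" using s_bounds by (intro pw) auto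
      finally have b: "B powr (- 4 * s) \<le> real N powr (- 1)" .
      have "exp (- H) \<le> Ce * H powr (- (1 / h))" by (rule Ce(2)[OF H])
      also have "H powr (- (1 / h)) = real N powr (- 1)" using h by (simp add: H_def powr_powr)
      finally have "L powr (- 4 * s) + B powr (- 4 * s) + exp (- H) \<le> (2 + Ce) * real N powr (- 1)"
        using a b by (simp add: algebra_simps)
      then have "gN\<^sup>2 * real (card ?\<Theta>) * (L powr (- 4 * s) + B powr (- 4 * s) + exp (- H))
          \<le> gN\<^sup>2 * real N * ((2 + Ce) * real N powr (- 1))"
        using arc_le by (intro mult_mono mult_left_mono mult_nonneg_nonneg) auto
      also have "\<dots> = (2 + Ce) * gN\<^sup>2" using N2 by (simp add: powr_minus)
      finally show ?thesis .
    qed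
    have lg: "(2 + log 2 (B * H))\<^sup>2 \<le> Cl * H"
    proof -
      have "1 * 1 \<le> B * H" using B H by (intro mult_mono) auto
      then have "(2 + log 2 (B * H))\<^sup>2 \<le> Cl * (B * H) powr h" by (intro Cl(2)) simp
      also have "(B * H) powr h = real N powr ((3/10 + h) * h)" by (simp add: B_def H_def powr_add[symmetric] powr_powr)
      also have "\<dots> \<le> real N powr (1 * h)" using h by (intro pw mult_right_mono) auto
      finally show ?thesis using Cl(1) by (simp add: H_def)
    qed
    have fM: "real (card (stop_words M)) * M\<^sup>2 * gL\<^sup>2 \<le> Cf * M powr (2 - 2 * s) * gN\<^sup>2"
      using Cf(2)[of M L] M1 LM by (simp add: gL_def gN_def)
    have main: "(2 + log 2 (B * H))\<^sup>2 * real (card (stop_words M)) * M\<^sup>2 * D \<le> Cl * Cf * Cd * C2 * gN\<^sup>2"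
    proof -
      let ?f = "real (card (stop_words M)) * M\<^sup>2"
      have L0: "0 < L powr (2 * s)" using L1 by simp
      have "?f * gL * L powr (2 * s) \<le> ?f * gL * (C2 * gL)"
        using gL1 g0 by (intro mult_left_mono) auto
      also have "\<dots> = C2 * (?f * gL\<^sup>2)" by (simp add: power2_eq_square)
      also have "\<dots> \<le> C2 * (Cf * M powr (2 - 2 * s) * gN\<^sup>2)" using fM C2(1) by (intro mult_left_mono) auto
      finally have fg: "?f * gL \<le> C2 * (Cf * M powr (2 - 2 * s) * gN\<^sup>2) / L powr (2 * s)"
        using L0 by (simp add: pos_le_divide_eq)
      have "(2 + log 2 (B * H))\<^sup>2 * real (card (stop_words M)) * M\<^sup>2 * D
         = (2 + log 2 (B * H))\<^sup>2 * (?f * gL) * (Cd * H powr (c + 5) * real N powr (1/2))"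
        by (simp add: D_def)
      also have "\<dots> \<le> (Cl * H) * (C2 * (Cf * M powr (2 - 2 * s) * gN\<^sup>2) / L powr (2 * s)) * (Cd * H powr (c + 5) * real N powr (1/2))"
        by (rule mult_right_mono[OF mult_mono[OF lg fg]]) (use Cd Cl(1) H g0 in auto)
      also have "\<dots> = Cl * Cf * Cd * C2 * gN\<^sup>2 * ((H * H powr (c + 5)) * (M powr (2 - 2 * s) / L powr (2 * s) * real N powr (1/2)))"
        by (simp only: ac_simps times_divide_eq_left times_divide_eq_right)
      also have "H * H powr (c + 5) = real N powr \<sigma>"
      proof -
        have "H powr (c + 6) = H powr (1 + (c + 5))" by (simp add: algebra_simps)
        also have "\<dots> = H * H powr (c + 5)" unfolding powr_add using H by simp
        finally have "H * H powr (c + 5) = H powr (c + 6)" ..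
        also have "\<dots> = real N powr \<sigma>" by (simp only: H_def powr_powr h(3))
        finally show ?thesis .
      qed
      \<comment> \<open>Loss M^(2-2s), gain L^(-2s) and N^(1/2) determinants combine to the exponent
        7/4 - 2 s, which is negative exactly when s > 7/8.\<close>
      also have "M powr (2 - 2 * s) / L powr (2 * s) * real N powr (1/2) = real N powr (- 2 * \<sigma>)"
      proof -
        have "M powr (2 - 2 * s) / L powr (2 * s) * real N powr (1/2)
          = real N powr (5/8 * (2 - 2 * s) - 3/8 * (2 * s) + 1/2)"
          by (simp only: M_def L_def powr_powr powr_add[symmetric] powr_diff[symmetric])
        also have "5/8 * (2 - 2 * s) - 3/8 * (2 * s) + 1/2 = - 2 * \<sigma>" by (simp add: \<sigma>_def field_simps)
        finally show ?thesis .
      qed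
      also have "real N powr \<sigma> * real N powr (- 2 * \<sigma>) = real N powr (- \<sigma>)" by (simp add: powr_add[symmetric])
      also have "Cl * Cf * Cd * C2 * gN\<^sup>2 * real N powr (- \<sigma>) \<le> Cl * Cf * Cd * C2 * gN\<^sup>2 * real N powr 0"
        using Cl(1) Cf(1) Cd C2(1) \<sigma> by (intro mult_left_mono pw) auto
      finally show ?thesis using N2 by simp
    qed
    have tail: "(2 + log 2 (B * H))\<^sup>2 * real (card (stop_words M)) * M\<^sup>2 *
         ((word_count (L * H))\<^sup>2 * real (card ?\<Theta>) / H ^ Suc k) \<le> Cl * Cf * doubling\<^sup>2 * gN\<^sup>2"
    proof -
      have "word_count (L * H) \<le> doubling * H powr c * gL"
        using word_count_scale[OF L1 H] by (simp add: c_def gL_def mult.commute)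
      then have "(word_count (L * H))\<^sup>2 \<le> (doubling * H powr c * gL)\<^sup>2"
        using word_count_nonneg by (intro power_mono) auto
      then have "(word_count (L * H))\<^sup>2 * real (card ?\<Theta>) / H ^ Suc k \<le> (doubling * H powr c * gL)\<^sup>2 * real N / H ^ Suc k"
        using arc_le H by (intro divide_right_mono mult_mono) auto
      also have "\<dots> = gL\<^sup>2 * (doubling\<^sup>2 * (real N powr 1 * (H powr (2 * c) / H powr (Suc k))))"
      proof -
        have "H ^ Suc k = H powr (Suc k)" using H by (simp add: powr_realpow del: power_Suc of_nat_Suc)
        moreover have "(H powr c)\<^sup>2 = H powr (2 * c)" by (simp add: power2_eq_square powr_add[symmetric])
        ultimately show ?thesis using N2 by (simp add: power_mult_distrib)
      qed
      finally have "(2 + log 2 (B * H))\<^sup>2 * real (card (stop_words M)) * M\<^sup>2 *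
         ((word_count (L * H))\<^sup>2 * real (card ?\<Theta>) / H ^ Suc k)
        \<le> (2 + log 2 (B * H))\<^sup>2 * real (card (stop_words M)) * M\<^sup>2 * (gL\<^sup>2 * (doubling\<^sup>2 * (real N powr 1 * (H powr (2 * c) / H powr (Suc k)))))"
        by (intro mult_left_mono) auto
      also have "\<dots> = (2 + log 2 (B * H))\<^sup>2 * (real (card (stop_words M)) * M\<^sup>2 * gL\<^sup>2) * (doubling\<^sup>2 * (real N powr 1 * (H powr (2 * c) / H powr (Suc k))))"
        by (simp only: ac_simps)
      also have "\<dots> \<le> (Cl * H) * (Cf * M powr (2 - 2 * s) * gN\<^sup>2) * (doubling\<^sup>2 * (real N powr 1 * (H powr (2 * c) / H powr (Suc k))))"
        by (rule mult_right_mono[OF mult_mono[OF lg fM]]) (use Cl(1) H in auto)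
      also have "\<dots> = Cl * Cf * doubling\<^sup>2 * gN\<^sup>2 * (M powr (2 - 2 * s) * (real N powr 1 * (H * H powr (2 * c) / H powr (Suc k))))"
        by (simp only: ac_simps times_divide_eq_left times_divide_eq_right)
      also have "\<dots> \<le> Cl * Cf * doubling\<^sup>2 * gN\<^sup>2 * (real N powr 1 * (real N powr 1 * real N powr (- 2)))"
      proof (intro mult_left_mono mult_mono)
        have "M powr (2 - 2 * s) = real N powr (5/8 * (2 - 2 * s))" by (simp add: M_def powr_powr)
        also have "\<dots> \<le> real N powr 1" using s_bounds by (intro pw) auto
        finally show "M powr (2 - 2 * s) \<le> real N powr 1" .
        have "H * H powr (2 * c) / H powr (Suc k) = H powr (1 + 2 * c - Suc k)"
          unfolding powr_diff powr_add using H by simp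
        also have "\<dots> \<le> H powr (- (2 / h))" using H k by (intro powr_mono) auto
        also have "\<dots> = real N powr (- 2)" using h by (simp add: H_def powr_powr)
        finally show "H * H powr (2 * c) / H powr (Suc k) \<le> real N powr (- 2)" .
      qed (use Cl(1) Cf(1) H in auto)
      also have "real N powr 1 * (real N powr 1 * real N powr (- 2)) = 1"
        using N2 by (simp add: powr_minus powr_numeral power2_eq_square field_simps)
      finally show ?thesis by simp
    qed
    have "(\<Sum>\<theta>\<in>?\<Theta>. (cmod (expsum N \<theta>))\<^sup>2) \<le> Cr * ((2 + Ce) * gN\<^sup>2 +
       (Cl * Cf * Cd * C2 * gN\<^sup>2 + Cl * Cf * doubling\<^sup>2 * gN\<^sup>2))"
      by (rule order.trans[OF red])
         (use T1 main tail Cr in \<open>intro mult_left_mono add_mono; simp add: distrib_left add_mono\<close>)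
    also have "\<dots> = C * gN\<^sup>2" unfolding C_def by (simp only: distrib_left distrib_right ac_simps)
    finally show ?thesis by (simp add: gN_def)
  qed
  then show ?thesis using C0 by blast
qed

end

subsection \<open>From the mean square to positive proportion\<close>

lemma dyadic_bracket:
  fixes x :: real
  shows "\<exists>i::nat. x \<le> 2 ^ i \<and> (i = 0 \<or> 2 ^ i / 2 \<le> x)"
proof -
  obtain n :: nat where "x < 2 ^ n" using real_arch_pow[of 2 x] by auto
  then have ex: "\<exists>i::nat. x \<le> 2 ^ i" by (intro exI[of _ n]) simp
  define i where "i = (LEAST i::nat. x \<le> 2 ^ i)"
  have "x \<le> 2 ^ i" unfolding i_def using ex by (rule LeastI_ex)
  moreover have "2 ^ i / 2 \<le> x" if i0: "i \<noteq> 0"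
  proof -
    obtain j where j: "i = Suc j" using i0 by (cases i) auto
    then have "\<not> x \<le> 2 ^ j" using not_less_Least[of j "\<lambda>i. x \<le> 2 ^ i"] unfolding i_def by simp
    then show ?thesis using j by simp
  qed
  ultimately show ?thesis by (intro exI[of _ i]) auto
qed

lemma sum_UN_le:
  fixes f :: "'a \<Rightarrow> real"
  assumes "finite I" "\<And>i. i \<in> I \<Longrightarrow> finite (S i)" "\<And>x. 0 \<le> f x"
  shows "sum f (\<Union>i\<in>I. S i) \<le> (\<Sum>i\<in>I. sum f (S i))"
  using assms(1,2)
proof (induction I)
  case (insert i I)
  have fin: "finite (S i)" "finite (\<Union>j\<in>I. S j)" using insert by auto
  have "sum f (\<Union>j\<in>insert i I. S j) = sum f (S i \<union> (\<Union>j\<in>I. S j))" by simp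
  also have "\<dots> \<le> sum f (S i) + sum f (\<Union>j\<in>I. S j)"
    using sum.union_inter[OF fin, of f] sum_nonneg[of "S i \<inter> (\<Union>j\<in>I. S j)" f] assms(3) by simp
  also have "\<dots> \<le> sum f (S i) + (\<Sum>j\<in>I. sum f (S j))" using insert by auto
  finally show ?case using insert by simp
qed simp

text \<open>The value is N or 0. Recording it as a nonnegative real lets all terms beyond the wanted
  collisions be dropped later.\<close>

lemma sum_roots_of_unity:
  fixes m :: int
  assumes "0 < N"
  shows "\<exists>\<gamma>\<ge>0. (\<Sum>j<N. cis (2 * pi * (real j / real N * real_of_int m))) = of_real \<gamma> \<and> (m = 0 \<longrightarrow> \<gamma> = real N)"
proof -
  define z where "z = cis (2 * pi * real_of_int m / real N)"
  have z: "cis (2 * pi * (real j / real N * real_of_int m)) = z ^ j" for j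
    unfolding z_def Complex.DeMoivre by (rule arg_cong[of _ _ cis]) simp
  have "z ^ N = cis (2 * pi * real_of_int m)"
    unfolding z_def Complex.DeMoivre using assms by simp
  then have zN: "z ^ N = 1" by (simp add: cis_multiple_2pi)
  show ?thesis
  proof (cases "z = 1")
    case True
    then show ?thesis unfolding z by (intro exI[of _ "real N"]) simp
  next
    case False
    then have "(\<Sum>j<N. z ^ j) = 0" using zN by (simp add: geometric_sum)
    moreover have "m \<noteq> 0" using False by (auto simp: z_def)
    ultimately show ?thesis unfolding z by (intro exI[of _ 0]) simp
  qed
qed

section \<open>Collisions of continuants and the Cauchy--Schwarz step\<close>

context alphabet
begin

text \<open>Orthogonality over the grid turns the mean square into a sum over pairs congruent modulo
  N with nonnegative weights. Keeping only equal continuants up to N, each pair retains N times a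
  damping of at least exp (-2).\<close>

lemma collisions_le_mean_square:
  assumes N: "0 < N"
  shows "real N * exp (- 2) * real (card {(w, w'). w \<in> words_upto N \<and> w' \<in> words_upto N \<and> cont w = cont w'})
      \<le> (\<Sum>\<theta>\<in>grid N. (cmod (expsum N \<theta>))\<^sup>2)"
proof -
  let ?\<Omega> = "words_upto ((real N)\<^sup>2)"
  define P where "P = {(w, w'). w \<in> words_upto N \<and> w' \<in> words_upto N \<and> cont w = cont w'}"
  have "\<exists>\<gamma>. \<forall>m::int. 0 \<le> \<gamma> m \<and> (\<Sum>j<N. cis (2 * pi * (real j / real N * real_of_int m))) = of_real (\<gamma> m) \<and> (m = 0 \<longrightarrow> \<gamma> m = real N)"
    using sum_roots_of_unity[OF N] by metis
  then obtain \<gamma> :: "int \<Rightarrow> real" where \<gamma>: "\<And>m. 0 \<le> \<gamma> m"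
    "\<And>m. (\<Sum>j<N. cis (2 * pi * (real j / real N * real_of_int m))) = of_real (\<gamma> m)" "\<gamma> 0 = real N" by blast
  define e where "e = (\<lambda>w w'. exp (- (real (cont w) + real (cont w')) / N))"
  define F where "F = (\<lambda>(w, w'). e w w' * \<gamma> (int (cont w) - int (cont w')))"
  have inj: "inj_on (\<lambda>j. real j / real N) {..<N}" using N by (auto simp: inj_on_def)
  have "complex_of_real (\<Sum>\<theta>\<in>grid N. (cmod (expsum N \<theta>))\<^sup>2)
     = (\<Sum>j<N. expsum N (real j / N) * cnj (expsum N (real j / N)))"
    unfolding grid_def sum.reindex[OF inj]
    by (simp add: complex_norm_square del: of_real_power flip: of_real_power)
  also have "\<dots> = (\<Sum>j<N. \<Sum>w\<in>?\<Omega>. \<Sum>w'\<in>?\<Omega>. of_real (e w w') * cis (2 * pi * (real j / N * real_of_int (int (cont w) - int (cont w')))))"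
  proof (rule sum.cong[OF refl])
    fix j
    have "expsum N (real j / N) * cnj (expsum N (real j / N)) =
      (\<Sum>w\<in>?\<Omega>. \<Sum>w'\<in>?\<Omega>. damped N (real j / N) ^ cont w * cnj (damped N (real j / N) ^ cont w'))"
      unfolding expsum_def cnj_sum sum_product ..
    also have "\<dots> = (\<Sum>w\<in>?\<Omega>. \<Sum>w'\<in>?\<Omega>. of_real (e w w') * cis (2 * pi * (real j / N * real_of_int (int (cont w) - int (cont w')))))"
      unfolding damped_mult_cnj e_def by (simp add: right_diff_distrib)
    finally show "expsum N (real j / N) * cnj (expsum N (real j / N)) = \<dots>" .
  qed
  also have "\<dots> = (\<Sum>w\<in>?\<Omega>. \<Sum>j<N. \<Sum>w'\<in>?\<Omega>. of_real (e w w') * cis (2 * pi * (real j / N * real_of_int (int (cont w) - int (cont w')))))"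
    by (rule sum.swap)
  also have "\<dots> = (\<Sum>w\<in>?\<Omega>. \<Sum>w'\<in>?\<Omega>. \<Sum>j<N. of_real (e w w') * cis (2 * pi * (real j / N * real_of_int (int (cont w) - int (cont w')))))"
    by (intro sum.cong refl sum.swap)
  also have "\<dots> = (\<Sum>w\<in>?\<Omega>. \<Sum>w'\<in>?\<Omega>. of_real (F (w, w')))"
    unfolding sum_distrib_left[symmetric] \<gamma>(2) by (simp add: F_def)
  also have "\<dots> = of_real (\<Sum>p\<in>?\<Omega> \<times> ?\<Omega>. F p)"
    unfolding sum.cartesian_product by (simp add: case_prod_beta)
  finally have eq: "(\<Sum>\<theta>\<in>grid N. (cmod (expsum N \<theta>))\<^sup>2) = (\<Sum>p\<in>?\<Omega> \<times> ?\<Omega>. F p)"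
    unfolding of_real_eq_iff .
  have "real N \<le> (real N)\<^sup>2" using N by (simp add: power2_eq_square)
  then have sub: "P \<subseteq> ?\<Omega> \<times> ?\<Omega>" by (auto simp: P_def words_upto_def)
  have "real N * exp (- 2) * real (card P) = (\<Sum>p\<in>P. exp (- 2) * real N)" by simp
  also have "\<dots> \<le> (\<Sum>p\<in>P. F p)"
  proof (rule sum_mono)
    fix p assume "p \<in> P"
    then obtain w w' where p: "p = (w, w')" "w \<in> words_upto N" "w' \<in> words_upto N" "cont w = cont w'"
      by (auto simp: P_def)
    then have "real (cont w) + real (cont w') \<le> 2 * N" by (simp add: words_upto_def)
    then have "exp (- 2) \<le> e w w'" using N by (simp add: e_def field_simps)
    then show "exp (- 2) * real N \<le> F p" using p(1,4) \<gamma>(3) by (simp add: F_def mult_right_mono)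
  qed
  also have "\<dots> \<le> (\<Sum>p\<in>?\<Omega> \<times> ?\<Omega>. F p)"
    using sub \<gamma>(1) finite_words_upto by (intro sum_mono2) (auto simp: F_def e_def)
  finally show ?thesis unfolding eq P_def .
qed

lemma continuant_in_cfrac_denoms:
  assumes "w \<in> words_upto X" "w \<noteq> []"
  shows "cont w \<in> cfrac_denoms A X"
proof -
  have w: "w \<in> lists A" "0 \<notin> set w" "real (cont w) \<le> X"
    using assms pos_word by (auto simp: words_upto_def)
  have "0 < cont_tl w" using cont_tl_eq_0_iff[OF w(2)] assms(2) by simp
  moreover have "coprime (cont_tl w) (cont w)" using coprime_cont[of w] by (simp add: coprime_commute)
  moreover have "real (cont_tl w) / real (cont w) = cfrac w" using cfrac_eq_cont[OF w(2)] by simp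
  ultimately show ?thesis using w cont_pos[OF w(2)] assms(2) unfolding cfrac_denoms_def by auto
qed

lemma finite_cfrac_denoms: "finite (cfrac_denoms A X)"
proof (rule finite_subset)
  show "cfrac_denoms A X \<subseteq> {..nat \<lfloor>X\<rfloor>}" unfolding cfrac_denoms_def by (auto simp: le_nat_floor)
qed simp

text \<open>Cauchy--Schwarz for the number of representations of each continuant. The empty word
  yields no admissible fraction and is removed; since \<open>amax \<le> N\<close> provides a
  one-letter word, this at most halves the count, whence 4 after squaring.\<close>

lemma card_cfrac_denoms_ge:
  assumes N: "amax \<le> real N"
  shows "(word_count N)\<^sup>2 \<le> 4 * real (card (cfrac_denoms A N)) *
     real (card {(w, w'). w \<in> words_upto N \<and> w' \<in> words_upto N \<and> cont w = cont w'})"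
proof -
  define W where "W = words_upto N - {[]}"
  define P where "P = {(w, w'). w \<in> words_upto N \<and> w' \<in> words_upto N \<and> cont w = cont w'}"
  define E where "E = cont ` W"
  define r where "r = (\<lambda>n. {w \<in> W. cont w = n})"
  have fin: "finite W" "finite E" using finite_words_upto by (auto simp: W_def E_def)
  have cN: "word_count N \<le> 2 * real (card W)"
  proof -
    obtain d where d: "d \<in> A" using A_nonempty by blast
    then have "[d] \<in> W" using le_amax[OF d] N by (auto simp: W_def words_upto_def)
    then have "0 < card W" using fin card_gt_0_iff by blast
    moreover have "[] \<in> words_upto N" using N amax_ge_1 by (simp add: words_upto_def)
    then have "card (words_upto N) = Suc (card W)"
      unfolding W_def by (rule card.remove[OF finite_words_upto])
    ultimately show ?thesis by (simp add: word_count_def)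
  qed
  have "W = (\<Union>n\<in>E. r n)" by (auto simp: E_def r_def)
  then have "card W = card (\<Union>n\<in>E. r n)" by simp
  also have "\<dots> \<le> (\<Sum>n\<in>E. card (r n))" by (rule card_UN_le[OF fin(2)])
  finally have "real (card W) \<le> (\<Sum>n\<in>E. real (card (r n)))" unfolding of_nat_sum[symmetric] of_nat_le_iff .
  then have "(real (card W))\<^sup>2 \<le> (\<Sum>n\<in>E. real (card (r n)))\<^sup>2" by (intro power_mono) auto
  also have "\<dots> \<le> (\<Sum>n\<in>E. (real (card (r n)))\<^sup>2) * card E" by (rule sum_squared_le_sum_of_squares)
  also have "(\<Sum>n\<in>E. (real (card (r n)))\<^sup>2) \<le> real (card P)"
  proof -
    have finP: "finite P"
      by (rule finite_subset[of _ "words_upto N \<times> words_upto N"]) (auto simp: P_def finite_words_upto)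
    have "(\<Sum>n\<in>E. card (r n \<times> r n)) = card (\<Union>n\<in>E. r n \<times> r n)"
      using fin by (intro card_UN_disjoint[symmetric]) (auto simp: r_def)
    also have "\<dots> \<le> card P"
      using finP by (intro card_mono) (auto simp: r_def P_def W_def)
    finally have "(\<Sum>n\<in>E. card (r n) * card (r n)) \<le> card P" by (simp add: card_cartesian_product)
    then have "real (\<Sum>n\<in>E. card (r n) * card (r n)) \<le> real (card P)" unfolding of_nat_le_iff .
    then show ?thesis by (simp add: power2_eq_square)
  qed
  finally have "(real (card W))\<^sup>2 \<le> real (card P) * card E" by (simp add: mult_right_mono)
  also have "real (card E) \<le> card (cfrac_denoms A N)"
    unfolding E_def of_nat_le_iff using continuant_in_cfrac_denoms
    by (intro card_mono finite_cfrac_denoms) (auto simp: W_def)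
  finally have a: "(real (card W))\<^sup>2 \<le> real (card P) * card (cfrac_denoms A N)" by (simp add: mult_left_mono)
  have "(word_count N)\<^sup>2 \<le> (2 * real (card W))\<^sup>2" using cN word_count_nonneg by (intro power_mono) auto
  also have "\<dots> = 4 * (real (card W))\<^sup>2" by simp
  finally show ?thesis using a by (simp add: P_def mult.commute)
qed

end

section \<open>Covering the grid by arcs and summing up\<close>

context dense_alphabet
begin

text \<open>Dirichlet approximation with denominators up to N^(3/4). If q is at least N^(1/4), the
  approximation is generic. Otherwise \<bar>\<beta>\<bar> < 1 / (q n) with n about N^(3/4) bounds
  the product of q and N \<bar>\<beta>\<bar> by O(N^(1/4)), and both are rounded up to powers of
  two.\<close>

lemma grid_subset_arcs:
  assumes N: "1 \<le> N"
  shows "grid N \<subseteq> generic_arc N \<union> (\<Union>(i, l)\<in>{(i, l). 2 ^ i * 2 ^ l \<le> 8 * real N powr (1/4)}. major_arc N (2 ^ i) (2 ^ l))"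
proof
  fix \<theta> assume \<theta>: "\<theta> \<in> grid N"
  define x where "x = real N powr (3/4)"
  define y where "y = real N powr (1/4)"
  have x1: "1 \<le> x" and y1: "1 \<le> y" using N by (auto simp: x_def y_def ge_one_powr_ge_zero)
  have xy: "real N = x * y" using N by (simp add: x_def y_def powr_add[symmetric])
  define n where "n = nat \<lfloor>x\<rfloor>"
  have fl: "1 \<le> \<lfloor>x\<rfloor>" using x1 by simp
  then have "real n = real_of_int \<lfloor>x\<rfloor>" by (simp add: n_def)
  then have n: "0 < n" "real n \<le> x" "x \<le> 2 * real n" using fl by linarith+
  obtain a q :: int where aq: "coprime a q" "0 < q" "q \<le> int n" "\<bar>of_int q * \<theta> - of_int a\<bar> < 1 / n"
    using Dirichlet_approx_coprime[OF n(1)] by metis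
  define \<beta> where "\<beta> = \<theta> - a / q"
  have "\<bar>of_int q * \<theta> - of_int a\<bar> = q * \<bar>\<beta>\<bar>"
  proof -
    have "of_int q * \<theta> - of_int a = q * \<beta>" using aq(2) by (simp add: \<beta>_def field_simps)
    then show ?thesis using aq(2) by (simp add: abs_mult)
  qed
  then have \<beta>: "q * \<bar>\<beta>\<bar> * n \<le> 1" using aq(4) n(1) by (simp add: field_simps)
  have qn: "real_of_int q \<le> real n" using aq(3) by linarith
  have q1: "1 \<le> real_of_int q" using aq(2) by linarith
  show "\<theta> \<in> generic_arc N \<union> (\<Union>(i, l)\<in>{(i, l). 2 ^ i * 2 ^ l \<le> 8 * real N powr (1/4)}. major_arc N (2 ^ i) (2 ^ l))"
  proof (cases "y \<le> q")
    case True
    have "q * \<bar>\<beta>\<bar> * q \<le> q * \<bar>\<beta>\<bar> * n" using qn q1 by (intro mult_left_mono) auto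
    then have "\<bar>\<beta>\<bar> * (real_of_int q)\<^sup>2 \<le> 1" using \<beta> by (simp add: power2_eq_square ac_simps)
    then have "\<bar>\<beta>\<bar> \<le> 1 / (real_of_int q)\<^sup>2" using q1 by (simp add: pos_le_divide_eq)
    then have "\<theta> \<in> generic_arc N"
      using \<theta> aq(1,2) True qn n(2) unfolding generic_arc_def y_def x_def \<beta>_def by force
    then show ?thesis by blast
  next
    case False
    obtain i :: nat where i: "q \<le> 2 ^ i" "i = 0 \<or> 2 ^ i / 2 \<le> real_of_int q" using dyadic_bracket[of q] by auto
    define t where "t = real N * \<bar>\<beta>\<bar>"
    obtain l :: nat where l: "t \<le> 2 ^ l" "l = 0 \<or> 2 ^ l / 2 \<le> t" using dyadic_bracket by blast
    have N0: "0 < real N" using N by simp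
    have tq: "t * q \<le> 2 * y"
    proof -
      have "t * q = y * (x * (q * \<bar>\<beta>\<bar>))" by (simp add: t_def xy)
      also have "\<dots> \<le> y * ((2 * n) * (q * \<bar>\<beta>\<bar>))" using n y1 q1 by (intro mult_left_mono mult_right_mono) auto
      also have "\<dots> = 2 * y * (q * \<bar>\<beta>\<bar> * n)" by simp
      also have "\<dots> \<le> 2 * y * 1" using \<beta> y1 by (intro mult_left_mono) auto
      finally show ?thesis by simp
    qed
    have Q: "2 ^ i \<le> 2 * real_of_int q" using i q1 by auto
    \<comment> \<open>8 = 2 * 2 * 2: one factor from each rounding up and one from
      \<open>x \<le> 2 * real n\<close>.\<close>
    have prod: "(2::real) ^ i * 2 ^ l \<le> 8 * y"
    proof (cases "l = 0")
      case True
      then show ?thesis using Q False y1 by simp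
    next
      case l0: False
      then have "2 ^ l \<le> 2 * t" using l by simp
      then have "(2::real) ^ i * 2 ^ l \<le> (2 * real_of_int q) * (2 * t)" using Q q1 by (intro mult_mono) auto
      also have "\<dots> = 4 * (t * q)" by simp
      finally show ?thesis using tq by linarith
    qed
    have "\<theta> \<in> major_arc N (2 ^ i) (2 ^ l)"
      unfolding major_arc_def
    proof (intro CollectI conjI exI)
      show "\<theta> \<in> grid N" "coprime a q" "0 < q" by fact+
      show "2 ^ i / 2 \<le> real_of_int q" using i q1 by auto
      show "real_of_int q \<le> 2 ^ i" using i by simp
      have "\<bar>\<beta>\<bar> \<le> 2 ^ l / N" using l(1) N0 by (simp add: t_def field_simps)
      then show "\<bar>\<theta> - a / q\<bar> \<le> 2 ^ l / N" by (simp add: \<beta>_def)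
      have "l = 0 \<or> 2 ^ l / (2 * real N) \<le> \<bar>\<beta>\<bar>" using l(2) N0 by (simp add: t_def field_simps)
      then show "2 ^ l = (1::real) \<or> 2 ^ l / (2 * real N) \<le> \<bar>\<theta> - a / q\<bar>" by (auto simp: \<beta>_def)
    qed
    then show ?thesis using prod unfolding y_def by blast
  qed
qed

text \<open>The power saving in Q K makes the bounds for the dyadic arcs a double geometric series,
  so their number, which grows with N, does no harm.\<close>

lemma expsum_mean_square:
  "\<exists>C>0. \<exists>N0. \<forall>N. N0 \<le> real N \<longrightarrow> (\<Sum>\<theta>\<in>grid N. (cmod (expsum N \<theta>))\<^sup>2) \<le> C * (word_count N)\<^sup>2"
proof -
  obtain C1 N1 where C1: "0 < C1" "\<And>N. N1 \<le> real N \<Longrightarrow>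
     (\<Sum>\<theta>\<in>generic_arc N. (cmod (expsum N \<theta>))\<^sup>2) \<le> C1 * (word_count N)\<^sup>2"
    using generic_arc_mean_square by blast
  obtain C2 N2 where C2: "0 < C2" "\<And>N Q K. N2 \<le> real N \<Longrightarrow> 1 \<le> Q \<Longrightarrow> 1 \<le> K \<Longrightarrow> Q * K \<le> 8 * real N powr (1/4) \<Longrightarrow>
     (\<Sum>\<theta>\<in>major_arc N Q K. (cmod (expsum N \<theta>))\<^sup>2) \<le> C2 * (word_count N)\<^sup>2 * (Q * K) powr (- 1/10)"
    using major_arc_mean_square by blast
  define \<rho> :: real where "\<rho> = 2 powr (- 1/10)"
  have \<rho>: "0 < \<rho>" "\<rho> < 1" unfolding \<rho>_def using powr_less_cancel_iff[of 2 "- 1/10" 0] by auto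
  have geo: "(\<Sum>i<n. \<rho> ^ i) \<le> 1 / (1 - \<rho>)" for n
    using sum_le_suminf[of "\<lambda>i. \<rho> ^ i" "{..<n}"] suminf_geometric[of \<rho>] summable_geometric[of \<rho>] \<rho> by simp
  have \<rho>_pow: "(2 ^ i * 2 ^ l) powr (- 1/10) = \<rho> ^ i * \<rho> ^ l" for i l :: nat
    by (simp add: \<rho>_def powr_mult powr_power powr_realpow[symmetric] powr_powr ac_simps)
  define C where "C = C1 + C2 * (1 / (1 - \<rho>))\<^sup>2"
  have "0 < C" using C1 C2 by (simp add: C_def add_pos_nonneg)
  moreover have "(\<Sum>\<theta>\<in>grid N. (cmod (expsum N \<theta>))\<^sup>2) \<le> C * (word_count N)\<^sup>2"
    if N: "max 1 (max N1 N2) \<le> real N" for N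
  proof -
    let ?f = "\<lambda>\<theta>. (cmod (expsum N \<theta>))\<^sup>2" and ?I = "{(i, l). 2 ^ i * 2 ^ l \<le> 8 * real N powr (1/4)}"
    define m where "m = nat \<lceil>8 * real N powr (1/4)\<rceil> + 1"
    have I: "?I \<subseteq> {..<m} \<times> {..<m}"
    proof clarify
      fix i l :: nat assume le: "2 ^ i * 2 ^ l \<le> 8 * real N powr (1/4)"
      have "(2::real) ^ i * 1 \<le> 2 ^ i * 2 ^ l" "1 * (2::real) ^ l \<le> 2 ^ i * 2 ^ l"
        by (intro mult_mono; simp)+
      moreover have "real i < 2 ^ i" "real l < 2 ^ l" by (rule of_nat_less_two_power)+
      ultimately have "real i < 8 * real N powr (1/4)" "real l < 8 * real N powr (1/4)" using le by linarith+
      then show "i \<in> {..<m} \<and> l \<in> {..<m}" unfolding m_def by (auto; linarith)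
    qed
    then have finI: "finite ?I" using finite_subset by blast
    let ?A = "\<lambda>(i, l). major_arc N (2 ^ i) (2 ^ l)"
    have fin: "finite (generic_arc N)" "finite (major_arc N Q K)" for Q K
      by (rule finite_subset[OF _ finite_grid[of N]], force simp: generic_arc_def major_arc_def)+
    have finU: "finite (\<Union>p\<in>?I. ?A p)" using finI fin by auto
    have "sum ?f (grid N) \<le> sum ?f (generic_arc N \<union> (\<Union>p\<in>?I. ?A p))"
      using grid_subset_arcs[of N] N fin finU by (intro sum_mono2) auto
    also have "\<dots> \<le> sum ?f (generic_arc N) + sum ?f (\<Union>p\<in>?I. ?A p)"
      using sum.union_inter[OF fin(1) finU, of ?f] sum_nonneg[of "generic_arc N \<inter> (\<Union>p\<in>?I. ?A p)" ?f] by simp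
    also have "sum ?f (\<Union>p\<in>?I. ?A p) \<le> (\<Sum>p\<in>?I. sum ?f (?A p))"
      using finI fin by (intro sum_UN_le) auto
    also have "\<dots> \<le> (\<Sum>p\<in>?I. C2 * (word_count N)\<^sup>2 * (\<rho> ^ fst p * \<rho> ^ snd p))"
    proof (rule sum_mono, clarify)
      fix i l :: nat assume le: "2 ^ i * 2 ^ l \<le> 8 * real N powr (1/4)"
      have "sum ?f (major_arc N (2 ^ i) (2 ^ l)) \<le> C2 * (word_count N)\<^sup>2 * (2 ^ i * 2 ^ l) powr (- 1/10)"
        using N le by (intro C2(2)) auto
      then show "sum ?f (major_arc N (2 ^ i) (2 ^ l)) \<le> C2 * (word_count N)\<^sup>2 * (\<rho> ^ fst (i, l) * \<rho> ^ snd (i, l))"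
        unfolding \<rho>_pow by simp
    qed
    also have "\<dots> \<le> (\<Sum>p\<in>{..<m} \<times> {..<m}. C2 * (word_count N)\<^sup>2 * (\<rho> ^ fst p * \<rho> ^ snd p))"
      using I C2(1) \<rho> by (intro sum_mono2) auto
    also have "\<dots> = C2 * (word_count N)\<^sup>2 * ((\<Sum>i<m. \<rho> ^ i) * (\<Sum>l<m. \<rho> ^ l))"
    proof -
      have "(\<Sum>i<m. \<rho> ^ i) * (\<Sum>l<m. \<rho> ^ l) = (\<Sum>p\<in>{..<m} \<times> {..<m}. \<rho> ^ fst p * \<rho> ^ snd p)"
        unfolding sum_product sum.cartesian_product by (simp add: case_prod_beta)
      then show ?thesis by (simp only: sum_distrib_left)
    qed
    also have "\<dots> \<le> C2 * (word_count N)\<^sup>2 * ((1 / (1 - \<rho>)) * (1 / (1 - \<rho>)))"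
      using geo \<rho> C2(1) by (intro mult_left_mono mult_mono sum_nonneg) auto
    also have "sum ?f (generic_arc N) \<le> C1 * (word_count N)\<^sup>2" using N by (intro C1(2)) auto
    finally show ?thesis by (simp add: C_def power2_eq_square algebra_simps)
  qed
  ultimately show ?thesis by blast
qed

lemma cfrac_denoms_positive_proportion:
  "\<exists>c>0. \<forall>\<^sub>F N::real in at_top. real (card (cfrac_denoms A N)) \<ge> c * N"
proof -
  obtain C N0 where C: "0 < C" "\<And>N. N0 \<le> real N \<Longrightarrow> (\<Sum>\<theta>\<in>grid N. (cmod (expsum N \<theta>))\<^sup>2) \<le> C * (word_count N)\<^sup>2"
    using expsum_mean_square by blast
  \<comment> \<open>The factor exp (-2) is the damping lost on collisions, and 4 comes from
    \<open>card_cfrac_denoms_ge\<close>.\<close>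
  define c where "c = exp (- 2) / (4 * C)"
  have c: "0 < c" using C by (simp add: c_def)
  have ge: "c * real N \<le> real (card (cfrac_denoms A N))" if N: "max 1 (max N0 amax) \<le> real N" for N :: nat
  proof -
    define P where "P = real (card {(w, w'). w \<in> words_upto N \<and> w' \<in> words_upto N \<and> cont w = cont w'})"
    define d where "d = real (card (cfrac_denoms A N))"
    define g where "g = word_count N"
    have "0 < g" using word_count_ge_1[of "real N"] N by (simp add: g_def)
    have "real N * exp (- 2) * P \<le> C * g\<^sup>2"
      unfolding P_def g_def using collisions_le_mean_square[of N] C(2)[of N] N by force
    moreover have g4: "g\<^sup>2 \<le> 4 * d * P"
      unfolding P_def g_def d_def using card_cfrac_denoms_ge[of N] N by simp
    ultimately have "real N * exp (- 2) * P \<le> C * (4 * d * P)"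
      using C(1) by (meson mult_left_mono order_trans less_imp_le)
    moreover have "0 < P"
    proof (rule ccontr)
      assume "\<not> 0 < P"
      then have "P = 0" by (simp add: P_def)
      then show False using g4 \<open>0 < g\<close> by simp
    qed
    ultimately have "real N * exp (- 2) \<le> C * (4 * d)" by (simp add: mult.assoc[symmetric])
    then show ?thesis using C(1) unfolding c_def d_def[symmetric] by (simp add: field_simps)
  qed
  \<comment> \<open>For real X the bound at the integer part is used; halving the constant covers
    the rounding.\<close>
  have "\<forall>\<^sub>F N::real in at_top. real (card (cfrac_denoms A N)) \<ge> c / 2 * N"
    using eventually_ge_at_top[of "max 1 (max N0 amax) + 1"]
  proof eventually_elim
    case (elim X)
    define N where "N = nat \<lfloor>X\<rfloor>"
    have X: "1 \<le> X" using elim by simp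
    have N: "real N \<le> X" "X < real N + 1" using X unfolding N_def by linarith+
    have N1: "max 1 (max N0 amax) \<le> real N" using elim N by linarith
    then have "X \<le> 2 * real N" using N by linarith
    then have "c / 2 * X \<le> c * real N" using c by (simp add: field_simps)
    also have "\<dots> \<le> real (card (cfrac_denoms A N))" by (rule ge[OF N1])
    also have "\<dots> \<le> real (card (cfrac_denoms A X))"
      using N(1) by (intro of_nat_mono card_mono finite_cfrac_denoms) (auto simp: cfrac_denoms_def)
    finally show ?case .
  qed
  then show ?thesis using c by (intro exI[of _ "c / 2"]) auto
qed

end

theorem theorem2:
  fixes A :: "nat set"
  assumes "finite A" and "0 \<notin> A" and "2 \<le> card A"
    and "hausdorff_dim (cfrac_set A) > ereal (7 / 8)"
  shows "\<exists>c::real. c > 0 \<and>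
           (\<forall>\<^sub>F N::real in at_top. real (card (cfrac_denoms A N)) \<ge> c * N)"
proof -
  interpret alphabet A using assms by unfold_locales auto
  \<comment> \<open>Below the dimension every exponent has nonzero measure, as the dimension is an
    infimum over null exponents. The cap places s in the window of
    \<open>dense_alphabet\<close>.\<close>
  have "min (hausdorff_dim (cfrac_set A)) (ereal (9/10)) > ereal (7/8)" using assms(4) by simp
  then obtain s where s: "ereal (7/8) < ereal s" "ereal s < min (hausdorff_dim (cfrac_set A)) (ereal (9/10))"
    using ereal_dense2 by blast
  then have s': "7/8 < s" "s < 9/10" "ereal s < hausdorff_dim (cfrac_set A)" by auto
  have "hausdorff_measure s (cfrac_set A) \<noteq> 0"
  proof
    assume "hausdorff_measure s (cfrac_set A) = 0"
    then have "hausdorff_dim (cfrac_set A) \<le> ereal s"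
      unfolding hausdorff_dim_def using s' by (intro INF_lower) auto
    then show False using s'(3) by simp
  qed
  then obtain c0 where c0: "0 < c0" "\<forall>M\<ge>1. c0 * M powr (2 * s) \<le> real (card (stop_words M))"
    using stop_words_lower_bound[of s] s' by auto
  interpret dense_alphabet A s c0 using s' c0 by unfold_locales auto
  show ?thesis using cfrac_denoms_positive_proportion by auto
qed

end
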